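(* Fix a polynomial $p$. There is an $\mathcal{RNC}^2$ algorithm WEIGHTED-2-MRCT that, on input a connected graph $G=(V,E)$ with edge-weight function $w:E\to\{0,1,\ldots,p(|V|)\}$, two vertices $s_1,s_2\in V$ and a number $\lambda\ge 1$, with high probability (probability tending to $1$ as $|V|\to\infty$) outputs a spanning tree $T$ of $G$ with $c^{(2)}_w(T,s_1,s_2,\lambda)\le (2+o(1))\, c^{(2)}_w(\text{W-2-MRCT}(G))$, where $o(1)$ denotes a quantity tending to $0$ as $|V|\to\infty$; whenever it does not output such a spanning tree, it outputs ``fail''.
   Context: For a spanning tree $T$ of $G=(V,E)$ with nonnegative edge weights $w$, $d_T(u,v)$ is the weight of the unique simple $u$-$v$ path in $T$. The weighted two-source routing cost with sources $s_1,s_2$ and weight $\lambda\ge1$ is $c^{(2)}_w(T,s_1,s_2,\lambda)=\sum_{v\in V}\left(\lambda\, d_T(s_1,v)+d_T(s_2,v)\right)$. $\text{W-2-MRCT}(G)$ denotes a spanning tree of $G$ minimizing $c^{(2)}_w(\cdot,s_1,s_2,\lambda)$, and $c^{(2)}_w(\text{W-2-MRCT}(G))$ is its weighted two-source routing cost. An $\mathcal{RNC}^2$ algorithm is a uniform family of polynomial-size circuits of depth $O(\log^2 n)$ that additionally receive polynomially many uniformly random input bits. *)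

theory Defs
  imports
    "HOL-Probability.Probability"
    "HOL-Computational_Algebra.Polynomial"
    "HOL-Library.Landau_Symbols"
    "HOL-Library.Log_Nat"
begin

section \<open>Graphs, spanning trees and routing cost\<close>

text \<open>
  A finite simple undirected graph has vertex set \<open>{..<n}\<close> and a set of edges, each edge being
  a two-element set of vertices. (A circuit receives its input graph with numbered vertices.)
\<close>

definition simple_graph :: "nat \<Rightarrow> nat set set \<Rightarrow> bool" where
  "simple_graph n E \<longleftrightarrow> E \<subseteq> {{u, v} | u v. u < n \<and> v < n \<and> u \<noteq> v}"

definition simple_path :: "nat set set \<Rightarrow> nat \<Rightarrow> nat list \<Rightarrow> nat \<Rightarrow> bool" where
  "simple_path E u p v \<longleftrightarrow>
     p \<noteq> [] \<and> hd p = u \<and> last p = v \<and> distinct p \<and>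
     (\<forall>i. Suc i < length p \<longrightarrow> {p ! i, p ! Suc i} \<in> E)"

definition connected_graph :: "nat \<Rightarrow> nat set set \<Rightarrow> bool" where
  "connected_graph n E \<longleftrightarrow> (\<forall>u<n. \<forall>v<n. \<exists>p. simple_path E u p v)"

definition is_cycle :: "nat set set \<Rightarrow> nat list \<Rightarrow> bool" where
  "is_cycle E p \<longleftrightarrow>
     3 \<le> length p \<and> distinct p \<and> (\<forall>i. Suc i < length p \<longrightarrow> {p ! i, p ! Suc i} \<in> E) \<and>
     {last p, hd p} \<in> E"

definition spanning_tree :: "nat \<Rightarrow> nat set set \<Rightarrow> nat set set \<Rightarrow> bool" where
  "spanning_tree n E T \<longleftrightarrow> T \<subseteq> E \<and> connected_graph n T \<and> (\<nexists>p. is_cycle T p)"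

definition path_weight :: "(nat set \<Rightarrow> nat) \<Rightarrow> nat list \<Rightarrow> nat" where
  "path_weight w p = (\<Sum>i<length p - 1. w {p ! i, p ! Suc i})"

definition tree_dist :: "(nat set \<Rightarrow> nat) \<Rightarrow> nat set set \<Rightarrow> nat \<Rightarrow> nat \<Rightarrow> nat" where
  "tree_dist w T u v = path_weight w (THE p. simple_path T u p v)"

definition routing_cost2 ::
  "nat \<Rightarrow> (nat set \<Rightarrow> nat) \<Rightarrow> nat \<Rightarrow> nat \<Rightarrow> real \<Rightarrow> nat set set \<Rightarrow> real" where
  "routing_cost2 n w s1 s2 lam T =
     (\<Sum>v<n. lam * real (tree_dist w T s1 v) + real (tree_dist w T s2 v))"

definition W2MRCT ::
  "nat \<Rightarrow> nat set set \<Rightarrow> (nat set \<Rightarrow> nat) \<Rightarrow> nat \<Rightarrow> nat \<Rightarrow> real \<Rightarrow> nat set set" where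
  "W2MRCT n E w s1 s2 lam = arg_min (routing_cost2 n w s1 s2 lam) (spanning_tree n E)"


section \<open>Boolean circuits with random inputs\<close>

text \<open>
  Circuits have fan-in two and are written as straight-line programs: a gate refers to earlier
  gates by their position. \<open>GIn i\<close> reads the \<open>i\<close>-th input bit, \<open>GRnd i\<close> the \<open>i\<close>-th random bit.
  The second component of a circuit lists the gates that form the output word.
\<close>

datatype gate = GConst bool | GIn nat | GRnd nat | GNot nat | GAnd nat nat | GOr nat nat

datatype circuit = Circuit (gates: "gate list") (outs: "nat list")

fun gate_preds :: "gate \<Rightarrow> nat set" where
  "gate_preds (GNot i) = {i}"
| "gate_preds (GAnd i j) = {i, j}"
| "gate_preds (GOr i j) = {i, j}"
| "gate_preds _ = {}"

definition wf_circuit :: "nat \<Rightarrow> nat \<Rightarrow> circuit \<Rightarrow> bool" where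
  "wf_circuit N r C \<longleftrightarrow>
     (\<forall>k<length (gates C). \<forall>j\<in>gate_preds (gates C ! k). j < k) \<and>
     (\<forall>i. GIn i \<in> set (gates C) \<longrightarrow> i < N) \<and>
     (\<forall>i. GRnd i \<in> set (gates C) \<longrightarrow> i < r) \<and>
     (\<forall>j\<in>set (outs C). j < length (gates C))"

fun gate_value :: "bool list \<Rightarrow> bool list \<Rightarrow> bool list \<Rightarrow> gate \<Rightarrow> bool" where
  "gate_value x \<rho> vs (GConst b) = b"
| "gate_value x \<rho> vs (GIn i) = x ! i"
| "gate_value x \<rho> vs (GRnd i) = \<rho> ! i"
| "gate_value x \<rho> vs (GNot i) = (\<not> vs ! i)"
| "gate_value x \<rho> vs (GAnd i j) = (vs ! i \<and> vs ! j)"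
| "gate_value x \<rho> vs (GOr i j) = (vs ! i \<or> vs ! j)"

definition run_circuit :: "circuit \<Rightarrow> bool list \<Rightarrow> bool list \<Rightarrow> bool list" where
  "run_circuit C x \<rho> =
     (let vs = foldl (\<lambda>vs g. vs @ [gate_value x \<rho> vs g]) [] (gates C)
      in map (\<lambda>j. vs ! j) (outs C))"

fun gate_depth :: "nat list \<Rightarrow> gate \<Rightarrow> nat" where
  "gate_depth ds (GNot i) = Suc (ds ! i)"
| "gate_depth ds (GAnd i j) = Suc (max (ds ! i) (ds ! j))"
| "gate_depth ds (GOr i j) = Suc (max (ds ! i) (ds ! j))"
| "gate_depth ds _ = 0"

definition circuit_depth :: "circuit \<Rightarrow> nat" where
  "circuit_depth C =
     Max (insert 0 (set (foldl (\<lambda>ds g. ds @ [gate_depth ds g]) [] (gates C))))"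

definition circuit_size :: "circuit \<Rightarrow> nat" where
  "circuit_size C = length (gates C) + length (outs C)"


section \<open>Log-space uniformity\<close>

text \<open>
  The machine model is a register machine with a write-only output stream, a program using a fixed
  finite number of registers. Space is charged logarithmically: a register costs the bit length of
  its content. Since there are constantly many registers, a bound \<open>O(log N)\<close> on each of them is the
  same as a bound \<open>O(log N)\<close> on the total, and a Turing machine simulates such a computation in
  work space \<open>O(log N)\<close>.
\<close>

datatype instr =
    IConst nat nat       \<comment> \<open>\<open>IConst d c\<close>: store the constant \<open>c\<close> in register \<open>d\<close>\<close>
  | IAdd nat nat nat     \<comment> \<open>target register first, then the two source registers\<close>
  | ISub nat nat nat
  | IMul nat nat nat
  | IDiv nat nat nat
  | IJz nat nat          \<comment> \<open>\<open>IJz a l\<close>: continue at address \<open>l\<close> if register \<open>a\<close> is zero\<close>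
  | IEmit nat            \<comment> \<open>append the content of a register to the output\<close>

type_synonym config = "nat \<times> (nat \<Rightarrow> nat) \<times> nat list"  \<comment> \<open>address, registers, output\<close>

fun exec_instr :: "instr \<Rightarrow> config \<Rightarrow> config" where
  "exec_instr (IConst d c) (pc, R, out) = (Suc pc, R(d := c), out)"
| "exec_instr (IAdd d a b) (pc, R, out) = (Suc pc, R(d := R a + R b), out)"
| "exec_instr (ISub d a b) (pc, R, out) = (Suc pc, R(d := R a - R b), out)"
| "exec_instr (IMul d a b) (pc, R, out) = (Suc pc, R(d := R a * R b), out)"
| "exec_instr (IDiv d a b) (pc, R, out) = (Suc pc, R(d := R a div R b), out)"
| "exec_instr (IJz a l) (pc, R, out) = (if R a = 0 then l else Suc pc, R, out)"
| "exec_instr (IEmit a) (pc, R, out) = (Suc pc, R, out @ [R a])"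

text \<open>The machine halts when the address leaves the program.\<close>

definition step :: "instr list \<Rightarrow> config \<Rightarrow> config" where
  "step P cf = (if fst cf < length P then exec_instr (P ! fst cf) cf else cf)"

definition config_after :: "instr list \<Rightarrow> nat \<Rightarrow> nat \<Rightarrow> config" where
  "config_after P N t = (step P ^^ t) (0, (\<lambda>_. 0)(0 := N), [])"

definition generates_in_logspace :: "instr list \<Rightarrow> (nat \<Rightarrow> nat list) \<Rightarrow> bool" where
  "generates_in_logspace P f \<longleftrightarrow>
     (\<forall>N. \<exists>t R pc. config_after P N t = (pc, R, f N) \<and> length P \<le> pc) \<and>
     (\<exists>s :: nat \<Rightarrow> nat.
        (\<lambda>N. real (s N)) \<in> O(\<lambda>N. ln (real N)) \<and>
        (\<forall>N t a. floorlog 2 (fst (snd (config_after P N t)) a) \<le> s N))"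

fun gate_code :: "gate \<Rightarrow> nat list" where
  "gate_code (GConst b) = [0, of_bool b, 0]"
| "gate_code (GIn i) = [1, i, 0]"
| "gate_code (GRnd i) = [2, i, 0]"
| "gate_code (GNot i) = [3, i, 0]"
| "gate_code (GAnd i j) = [4, i, j]"
| "gate_code (GOr i j) = [5, i, j]"

definition circuit_code :: "circuit \<Rightarrow> nat list" where
  "circuit_code C = concat (map gate_code (gates C)) @ concat (map (\<lambda>j. [6, j, 0]) (outs C))"

definition logspace_uniform :: "(nat \<Rightarrow> circuit) \<Rightarrow> bool" where
  "logspace_uniform C \<longleftrightarrow> (\<exists>P. generates_in_logspace P (\<lambda>N. circuit_code (C N)))"


section \<open>Randomized \<open>NC\<^sup>2\<close> algorithms\<close>

definition poly_bounded :: "(nat \<Rightarrow> nat) \<Rightarrow> bool" where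
  "poly_bounded f \<longleftrightarrow> (\<exists>k. (\<lambda>N. real (f N)) \<in> O(\<lambda>N. real N ^ k))"

text \<open>
  \<open>C N\<close> is the circuit for input words of length \<open>N\<close>, and \<open>r N\<close> is the number of random bits it
  receives.
\<close>

definition RNC2_algorithm :: "(nat \<Rightarrow> nat) \<Rightarrow> (nat \<Rightarrow> circuit) \<Rightarrow> bool" where
  "RNC2_algorithm r C \<longleftrightarrow>
     (\<forall>N. wf_circuit N (r N) (C N)) \<and>
     poly_bounded r \<and>
     poly_bounded (\<lambda>N. circuit_size (C N)) \<and>
     (\<lambda>N. real (circuit_depth (C N))) \<in> O(\<lambda>N. (ln (real N))\<^sup>2) \<and>
     logspace_uniform C"

definition random_bits :: "nat \<Rightarrow> bool list pmf" where
  "random_bits m = pmf_of_set {\<rho>. length \<rho> = m}"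


section \<open>Input and output words\<close>

text \<open>Binary words of length \<open>b\<close>, least significant bit first.\<close>

definition word_of :: "nat \<Rightarrow> nat \<Rightarrow> bool list" where
  "word_of b m = map (bit m) [0..<b]"

text \<open>
  The instance consists of the number of vertices in unary, the weighted adjacency matrix (for each
  ordered pair an edge flag and a weight), the two sources as one-hot vectors, and the rational
  \<open>\<lambda> = num / den\<close>. All weights, \<open>num\<close> and \<open>den\<close> are written with \<open>b\<close> bits. The word determines
  \<open>n\<close>, and then \<open>b\<close> by its length.
\<close>

definition encode_instance ::
  "nat \<Rightarrow> nat \<Rightarrow> nat set set \<Rightarrow> (nat set \<Rightarrow> nat) \<Rightarrow> nat \<Rightarrow> nat \<Rightarrow> nat \<Rightarrow> nat \<Rightarrow> bool list" where
  "encode_instance b n E w s1 s2 num den =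
     replicate n True @ [False] @
     concat (map (\<lambda>u. concat (map (\<lambda>v.
       if {u, v} \<in> E then True # word_of b (w {u, v}) else False # word_of b 0) [0..<n])) [0..<n]) @
     map (\<lambda>v. v = s1) [0..<n] @ map (\<lambda>v. v = s2) [0..<n] @
     word_of b num @ word_of b den"

text \<open>
  An output word starting with \<open>False\<close> means ``fail'', represented by \<open>None\<close>. Otherwise the leading
  \<open>True\<close> is followed by an adjacency matrix, of which the entries \<open>u < v\<close> are read; bits after
  the matrix are padding, since the length of the output word depends on the input length only.
\<close>

fun decode_output :: "nat \<Rightarrow> bool list \<Rightarrow> nat set set option" where
  "decode_output n (True # bs) =
     Some {{u, v} | u v. u < v \<and> v < n \<and> u * n + v < length bs \<and> bs ! (u * n + v)}"
| "decode_output n _ = None"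

end

theory Submission
  imports Defs "HOL-Real_Asymp.Real_Asymp"
begin

text \<open>
  The algorithm is deterministic and its factor is exactly \<open>2\<close>. Let \<open>D\<^sub>i\<close> be the sum of the distances
  from \<open>s\<^sub>i\<close> in \<open>G\<close>; every spanning tree costs at least \<open>\<lambda> D\<^sub>1 + D\<^sub>2\<close>. As \<open>n d(s\<^sub>1, s\<^sub>2) \<le> D\<^sub>1 + D\<^sub>2\<close>, the
  shortest path tree of \<open>s\<^sub>1\<close> costs at most \<open>(\<lambda> + 2) D\<^sub>1 + D\<^sub>2\<close> and that of \<open>s\<^sub>2\<close> at most
  \<open>\<lambda> D\<^sub>1 + (2\<lambda> + 1) D\<^sub>2\<close>. The first is a \<open>2\<close>-approximation if \<open>(2 - \<lambda>) D\<^sub>1 \<le> D\<^sub>2\<close>, the second if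
  \<open>(2\<lambda> - 1) D\<^sub>2 \<le> \<lambda> D\<^sub>1\<close>, and one of the two holds because \<open>(2\<lambda> - 1) (2 - \<lambda>) = \<lambda> - 2 (\<lambda> - 1)\<^sup>2 \<le> \<lambda>\<close>.

  Hence it suffices to decide the edges of the appropriate shortest path tree. This is done by a
  fixed formula of first-order logic with arithmetic and transitive closure over numbers below a
  polynomial in the input length: distances, sums and the comparison that involves \<open>\<lambda>\<close> are all
  reachability problems, since the weights are polynomially bounded. Quantifiers become trees of
  or-gates of depth \<open>O(log N)\<close> and transitive closures become \<open>O(log N)\<close> rounds of squaring a Boolean
  matrix, which gives depth \<open>O(log\<^sup>2 N)\<close>. The gate at a given position is an arithmetic expression in
  that position, so that a register machine prints the circuit in a single loop.
\<close>

section \<open>Arithmetic expressions on the register machine\<close>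

text \<open>The obstacle is uniformity against a concrete machine: a gate has to be printed from its
  number alone, with registers of polynomial size. The layout therefore wastes gates in order to be
  regular. Every subformula gets equally many rows, every row one entry for each assignment to all
  variables, and every entry a complete or-tree, so that quotients and remainders of the gate number
  tell what the gate is. Ranges are powers of two for the sake of complete trees. The number
  \<lambda> is the one datum without polynomial bound, because \<open>num\<close> and
  \<open>den\<close> may be as large as their word length permits. It cannot be the value of a
  variable, so its two parts are consumed bit by bit. Everything else fits below a fixed power of
  \<open>2 ^ lg N\<close>, even after pairing with an index.\<close>

datatype aexp = Var nat | Cst nat | Add aexp aexp | Sub aexp aexp | Mul aexp aexp | Div aexp aexp

fun aval :: "aexp \<Rightarrow> (nat \<Rightarrow> nat) \<Rightarrow> nat" where
  "aval (Var i) R = R i"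
| "aval (Cst c) R = c"
| "aval (Add a b) R = aval a R + aval b R"
| "aval (Sub a b) R = aval a R - aval b R"
| "aval (Mul a b) R = aval a R * aval b R"
| "aval (Div a b) R = aval a R div aval b R"

fun vars_below :: "nat \<Rightarrow> aexp \<Rightarrow> bool" where
  "vars_below d (Var i) = (i < d)"
| "vars_below d (Cst c) = True"
| "vars_below d (Add a b) = (vars_below d a \<and> vars_below d b)"
| "vars_below d (Sub a b) = (vars_below d a \<and> vars_below d b)"
| "vars_below d (Mul a b) = (vars_below d a \<and> vars_below d b)"
| "vars_below d (Div a b) = (vars_below d a \<and> vars_below d b)"

text \<open>Every subexpression has to be bounded along with the value, since intermediate results
  sit in registers. Hence \<open>Sub\<close> and \<open>Div\<close> add up their operands, and the
  factors of \<open>Mul\<close> are increased by 1, so that a factor 0 does not erase the bound on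
  the other one.\<close>

fun abound :: "aexp \<Rightarrow> nat \<Rightarrow> nat" where
  "abound (Var i) m = m"
| "abound (Cst c) m = c"
| "abound (Add a b) m = abound a m + abound b m"
| "abound (Sub a b) m = abound a m + abound b m"
| "abound (Mul a b) m = (abound a m + 1) * (abound b m + 1)"
| "abound (Div a b) m = abound a m + abound b m"

lemma aval_cong:
  "vars_below d a \<Longrightarrow> (\<And>i. i < d \<Longrightarrow> R i = R' i) \<Longrightarrow> aval a R = aval a R'"
  by (induction a) auto

lemma aval_le_abound:
  assumes "vars_below d a" "\<And>i. i < d \<Longrightarrow> R i \<le> m"
  shows "aval a R \<le> abound a m"
  using assms
proof (induction a)
  case (Mul a b)
  then have "aval a R * aval b R \<le> abound a m * abound b m" by (simp add: mult_le_mono)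
  then show ?case by simp
next
  case (Div a b)
  have "aval a R div aval b R \<le> aval a R" by simp
  also have "\<dots> \<le> abound a m" using Div by auto
  finally show ?case by simp
qed (auto intro!: add_mono simp: diff_le_mono le_diff_conv trans_le_add1)

section \<open>Polynomial bounds\<close>

text \<open>The bound holds at every \<open>N\<close>, with \<open>N + 1\<close> so that 0 is
  included; closure under sums and products then needs no reasoning about large arguments.\<close>

definition polyf :: "(nat \<Rightarrow> nat) \<Rightarrow> bool" where
  "polyf f \<longleftrightarrow> (\<exists>c d. \<forall>N. f N \<le> c * (N + 1) ^ d)"

lemma polyf_mono: "polyf g \<Longrightarrow> (\<And>N. f N \<le> g N) \<Longrightarrow> polyf f"
  unfolding polyf_def by (meson order_trans)

lemma polyf_const: "polyf (\<lambda>_. c)"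
  unfolding polyf_def by (rule exI[of _ c], rule exI[of _ 0]) simp

lemma polyf_id: "polyf (\<lambda>N. N)"
  unfolding polyf_def by (rule exI[of _ 1], rule exI[of _ 1]) simp

lemma polyf_add:
  assumes "polyf f" "polyf g"
  shows "polyf (\<lambda>N. f N + g N)"
proof -
  obtain c d c' d' where f: "\<And>N. f N \<le> c * (N + 1) ^ d" and g: "\<And>N. g N \<le> c' * (N + 1) ^ d'"
    using assms unfolding polyf_def by blast
  have "f N + g N \<le> (c + c') * (N + 1) ^ (d + d')" for N
  proof -
    have "(N + 1) ^ d \<le> (N + 1) ^ (d + d')" "(N + 1) ^ d' \<le> (N + 1) ^ (d + d')"
      by (rule power_increasing; simp)+
    then have "c * (N + 1) ^ d + c' * (N + 1) ^ d' \<le> c * (N + 1) ^ (d + d') + c' * (N + 1) ^ (d + d')"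
      by (intro add_mono mult_le_mono) auto
    then show ?thesis using f[of N] g[of N] by (simp add: algebra_simps)
  qed
  then show ?thesis unfolding polyf_def by blast
qed

lemma polyf_mult:
  assumes "polyf f" "polyf g"
  shows "polyf (\<lambda>N. f N * g N)"
proof -
  obtain c d c' d' where f: "\<And>N. f N \<le> c * (N + 1) ^ d" and g: "\<And>N. g N \<le> c' * (N + 1) ^ d'"
    using assms unfolding polyf_def by blast
  have "f N * g N \<le> (c * c') * (N + 1) ^ (d + d')" for N
    using mult_le_mono[OF f[of N] g[of N]] by (simp add: power_add algebra_simps)
  then show ?thesis unfolding polyf_def by blast
qed

lemma polyf_abound: "polyf f \<Longrightarrow> polyf (\<lambda>N. abound a (f N))"
proof (induction a)
  case (Mul a b)
  then show ?case
    by (simp only: abound.simps) (intro polyf_mult polyf_add polyf_const, auto)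
qed (simp_all add: polyf_const polyf_add)

lemma poly_bounded_polyf: 
  assumes "polyf f"
  shows "poly_bounded f"
proof -
  obtain c d where f: "\<And>N. f N \<le> c * (N + 1) ^ d"
    using assms unfolding polyf_def by blast
  have "(\<lambda>N. real (f N)) \<in> O(\<lambda>N. real N ^ d)"
  proof (rule bigoI[of _ "real (c * 2 ^ d)"])
    show "\<forall>\<^sub>F N in sequentially. norm (real (f N)) \<le> real (c * 2 ^ d) * norm (real N ^ d)"
    proof (rule eventually_sequentiallyI[of 1])
      fix N :: nat assume "1 \<le> N"
      then have "(N + 1) ^ d \<le> (2 * N) ^ d" by (intro power_mono) auto
      then have "f N \<le> c * (2 * N) ^ d" using f[of N] by (meson le_trans mult_le_mono2)
      then have "f N \<le> c * 2 ^ d * N ^ d" by (simp add: power_mult_distrib mult.assoc)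
      then have "real (f N) \<le> real (c * 2 ^ d * N ^ d)" by (simp only: of_nat_le_iff)
      then show "norm (real (f N)) \<le> real (c * 2 ^ d) * norm (real N ^ d)" by simp
    qed
  qed
  then show ?thesis unfolding poly_bounded_def by blast
qed

lemma floorlog_polyf:
  assumes "polyf f"
  shows "(\<lambda>N. real (floorlog 2 (f N))) \<in> O(\<lambda>N. ln (real N))"
proof -
  obtain c d where f: "\<And>N. f N \<le> c * (N + 1) ^ d"
    using assms unfolding polyf_def by blast
  let ?k = "1 + floorlog 2 c + 2 * d"
  have "floorlog 2 (f N) \<le> ?k * floorlog 2 N" if N: "N \<ge> 1" for N
  proof -
    have c: "c \<le> 2 ^ floorlog 2 c"
      using floorlog_bounds[of c 2] by (cases "c = 0") (auto intro: less_imp_le)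
    have n: "N < 2 ^ floorlog 2 N" using floorlog_bounds[of N 2] N by auto
    have pos: "floorlog 2 N \<ge> 1" using n N by (cases "floorlog 2 N") auto
    have "f N \<le> 2 ^ floorlog 2 c * (2 ^ floorlog 2 N) ^ d"
      using f[of N] mult_le_mono[OF c power_mono[of "N + 1" "2 ^ floorlog 2 N" d]] n by linarith
    also have "\<dots> = 2 ^ (floorlog 2 c + floorlog 2 N * d)" by (simp add: power_add power_mult)
    also have "\<dots> < 2 ^ Suc (floorlog 2 c + floorlog 2 N * d)" by simp
    finally have "f N < 2 ^ Suc (floorlog 2 c + floorlog 2 N * d)" .
    then have "floorlog 2 (f N) \<le> Suc (floorlog 2 c + floorlog 2 N * d)"
      by (intro floorlog_leI) auto
    also have "\<dots> \<le> ?k * floorlog 2 N" 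
    proof -
      have "floorlog 2 c * 1 \<le> floorlog 2 c * floorlog 2 N" using pos by (intro mult_le_mono2)
      moreover have "floorlog 2 N * d \<le> 2 * d * floorlog 2 N" by (simp add: mult.commute)
      ultimately show ?thesis using pos unfolding distrib_right by linarith
    qed
    finally show ?thesis .
  qed
  \<comment> \<open>From 8 on \<open>log 2 N\<close> is at least 3, so the summand 1 in
    \<open>floorlog\<close> costs a factor 4/3; the remaining factor \<open>1 / ln 2\<close> is at
    most 9/4.\<close>
  moreover have "real (floorlog 2 N) \<le> 3 * ln (real N)" if N: "N \<ge> 8" for N
  proof -
    have l: "floorlog 2 N = nat \<lfloor>log 2 (real N)\<rfloor> + 1"
      using N by (simp add: floorlog_def)
    have "log 2 (real N) \<ge> log 2 8" using N by simp
    moreover have "log 2 8 = (3::real)" using log_pow_cancel[of "2::real" 3] by simp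
    ultimately have ge: "log 2 (real N) \<ge> 3" by simp
    then have "real (floorlog 2 N) \<le> log 2 (real N) + 1"
      unfolding l by (simp add: nat_add_distrib)
    also have "\<dots> \<le> (4/3) * log 2 (real N)" using ge by simp
    also have "\<dots> = (4/3) * (ln (real N) / ln 2)" by (simp add: log_def)
    also have "\<dots> \<le> 3 * ln (real N)"
    proof -
      have "(4/9::real) \<le> ln 2" using ln2_ge_two_thirds by simp
      then have "ln (real N) * (4/9) \<le> ln (real N) * ln 2" using N by (intro mult_left_mono) auto
      then show ?thesis by (simp add: field_simps)
    qed
    finally show ?thesis .
  qed
  ultimately have *: "real (floorlog 2 (f N)) \<le> real ?k * 3 * ln (real N)" if "N \<ge> 8" for N
  proof -
    assume a: "\<And>N. 1 \<le> N \<Longrightarrow> floorlog 2 (f N) \<le> (1 + floorlog 2 c + 2 * d) * floorlog 2 N"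
      and b: "\<And>N. 8 \<le> N \<Longrightarrow> real (floorlog 2 N) \<le> 3 * ln (real N)"
    have "real (floorlog 2 (f N)) \<le> real (?k * floorlog 2 N)"
      using a[of N] that by (simp only: of_nat_le_iff)
    also have "\<dots> \<le> real ?k * (3 * ln (real N))"
      unfolding of_nat_mult by (intro mult_left_mono b that) simp
    finally show ?thesis by (simp only: mult.assoc)
  qed
  show ?thesis
    by (rule bigoI[of _ "real ?k * 3"], rule eventually_sequentiallyI[of 8])
       (use * in \<open>auto\<close>)
qed

section \<open>Evaluation of expressions with a stack of registers\<close>

text \<open>Registers from \<open>d\<close> on serve as the stack: the result is left in
  \<open>d\<close>, the right operand in \<open>Suc d\<close>, and registers below \<open>d\<close>
  survive. The machine cannot copy a register, so \<open>Var i\<close> adds it to a cleared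
  one.\<close>

fun acomp :: "aexp \<Rightarrow> nat \<Rightarrow> instr list" where
  "acomp (Var i) d = [IConst d 0, IAdd d d i]"
| "acomp (Cst c) d = [IConst d c]"
| "acomp (Add a b) d = acomp a d @ acomp b (Suc d) @ [IAdd d d (Suc d)]"
| "acomp (Sub a b) d = acomp a d @ acomp b (Suc d) @ [ISub d d (Suc d)]"
| "acomp (Mul a b) d = acomp a d @ acomp b (Suc d) @ [IMul d d (Suc d)]"
| "acomp (Div a b) d = acomp a d @ acomp b (Suc d) @ [IDiv d d (Suc d)]"

text \<open>The bound is part of the notion because the space condition speaks of all times, not
  only of the final configuration.\<close>

definition runs :: "instr list \<Rightarrow> nat \<Rightarrow> config \<Rightarrow> config \<Rightarrow> bool" where
  "runs P B cf cf' \<longleftrightarrow>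
     (\<exists>t. (step P ^^ t) cf = cf' \<and> (\<forall>t'\<le>t. \<forall>a. fst (snd ((step P ^^ t') cf)) a \<le> B))"

lemma runs_trans:
  assumes "runs P B cf cf'" "runs P B cf' cf''"
  shows "runs P B cf cf''"
proof -
  obtain t where t: "(step P ^^ t) cf = cf'" "\<And>t' a. t' \<le> t \<Longrightarrow> fst (snd ((step P ^^ t') cf)) a \<le> B"
    using assms(1) unfolding runs_def by blast
  obtain s where s: "(step P ^^ s) cf' = cf''" "\<And>t' a. t' \<le> s \<Longrightarrow> fst (snd ((step P ^^ t') cf')) a \<le> B"
    using assms(2) unfolding runs_def by blast
  have *: "(step P ^^ (u + t)) cf = (step P ^^ u) cf'" for u
    using t(1) by (simp add: funpow_add)
  have "fst (snd ((step P ^^ t') cf)) a \<le> B" if "t' \<le> s + t" for t' a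
  proof (cases "t' \<le> t")
    case False
    then obtain u where u: "t' = u + t" by (metis add.commute le_Suc_ex nat_le_linear)
    then show ?thesis using s(2)[of u a] that by (simp add: *)
  qed (use t(2) in auto)
  then show ?thesis unfolding runs_def using *[of s] s(1) by blast
qed

lemma runs_instr:
  assumes "pc < length P" "P ! pc = i" "\<And>a. R a \<le> B"
    and "exec_instr i (pc, R, out) = cf'" "\<And>a. fst (snd cf') a \<le> B"
  shows "runs P B (pc, R, out) cf'"
proof -
  have "step P (pc, R, out) = cf'" using assms(1,2,4) by (simp add: step_def)
  then show ?thesis
    unfolding runs_def using assms(3,5)
    by (intro exI[of _ 1]) (auto simp: le_Suc_eq)
qed

definition code_at :: "'a list \<Rightarrow> nat \<Rightarrow> 'a list \<Rightarrow> bool" where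
  "code_at P pc cs \<longleftrightarrow> (\<forall>i<length cs. pc + i < length P \<and> P ! (pc + i) = cs ! i)"

lemma code_at_append:
  "code_at P pc (cs @ ds) \<longleftrightarrow> code_at P pc cs \<and> code_at P (pc + length cs) ds"
proof (intro iffI conjI)
  assume *: "code_at P pc (cs @ ds)"
  show "code_at P pc cs"
    unfolding code_at_def
  proof (intro allI impI)
    fix i assume "i < length cs"
    then show "pc + i < length P \<and> P ! (pc + i) = cs ! i"
      using *[unfolded code_at_def, rule_format, of i] by (simp add: nth_append)
  qed
  show "code_at P (pc + length cs) ds"
    unfolding code_at_def
  proof (intro allI impI)
    fix i assume "i < length ds"
    then show "pc + length cs + i < length P \<and> P ! (pc + length cs + i) = ds ! i"
      using *[unfolded code_at_def, rule_format, of "length cs + i"] by (simp add: nth_append add.assoc)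
  qed
next
  assume *: "code_at P pc cs \<and> code_at P (pc + length cs) ds"
  show "code_at P pc (cs @ ds)"
    unfolding code_at_def
  proof (intro allI impI)
    fix i assume i: "i < length (cs @ ds)"
    show "pc + i < length P \<and> P ! (pc + i) = (cs @ ds) ! i"
    proof (cases "i < length cs")
      case True
      then show ?thesis using * by (auto simp: code_at_def nth_append)
    next
      case False
      then obtain j where j: "i = length cs + j" by (metis le_Suc_ex not_less)
      then show ?thesis using * i by (auto simp: code_at_def nth_append add.assoc)
    qed
  qed
qed

lemma code_at_Cons:
  "code_at P pc (c # cs) \<longleftrightarrow> pc < length P \<and> P ! pc = c \<and> code_at P (Suc pc) cs"
  using code_at_append[of P pc "[c]" cs] by (simp add: code_at_def)

lemma code_at_Nil: "code_at P pc []"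
  by (simp add: code_at_def)

text \<open>The inductive step shared by the four operations, \<open>h\<close> being the operation
  that the instruction \<open>i\<close> performs.\<close>

lemma acomp_binop:
  assumes op: "\<And>pc R out. exec_instr i (pc, R, out) = (Suc pc, R(d := h (R d) (R (Suc d))), out)"
    and c: "code_at P pc (ca @ cb @ [i])"
    and a: "\<exists>R'. runs P B (pc, R, out) (pc + length ca, R', out) \<and> R' d = x \<and>
              (\<forall>i<d. R' i = R i) \<and> (\<forall>i. R' i \<le> B)"
    and b: "\<And>R'. (\<forall>i<d. R' i = R i) \<Longrightarrow> (\<forall>i. R' i \<le> B) \<Longrightarrow>
        \<exists>R''. runs P B (pc + length ca, R', out) (pc + length ca + length cb, R'', out) \<and>
          R'' (Suc d) = y \<and> (\<forall>i<Suc d. R'' i = R' i) \<and> (\<forall>i. R'' i \<le> B)"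
    and h: "h x y \<le> B"
  shows "\<exists>R'. runs P B (pc, R, out) (pc + length (ca @ cb @ [i]), R', out) \<and> R' d = h x y \<and>
              (\<forall>i<d. R' i = R i) \<and> (\<forall>i. R' i \<le> B)"
proof -
  obtain R1 where R1: "runs P B (pc, R, out) (pc + length ca, R1, out)" "R1 d = x"
    "\<forall>i<d. R1 i = R i" "\<forall>i. R1 i \<le> B" using a by blast
  obtain R2 where R2: "runs P B (pc + length ca, R1, out) (pc + length ca + length cb, R2, out)"
    "R2 (Suc d) = y" "\<forall>i<Suc d. R2 i = R1 i" "\<forall>i. R2 i \<le> B" using b R1 by blast
  have at: "pc + length ca + length cb < length P" "P ! (pc + length ca + length cb) = i"
    using c by (auto simp: code_at_append code_at_Cons)
  have d: "R2 d = x" using R1 R2 by simp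
  have "runs P B (pc + length ca + length cb, R2, out)
      (Suc (pc + length ca + length cb), R2(d := h x y), out)"
    by (rule runs_instr[OF at]) (use R2 h op d in auto)
  with R1(1) R2(1) have "runs P B (pc, R, out) (Suc (pc + length ca + length cb), R2(d := h x y), out)"
    by (meson runs_trans)
  then show ?thesis using R1 R2 h by (intro exI[of _ "R2(d := h x y)"]) (auto simp: add.assoc)
qed

text \<open>Evaluating the first operand has changed registers from \<open>d\<close> on only. The
  variables of \<open>b\<close> lie below \<open>d0\<close> and hence below \<open>d\<close>, so
  \<open>b\<close> still has its value under the original \<open>R\<close>.\<close>

lemma acomp_second_operand:
  assumes IH: "\<And>pc d R. code_at P pc (acomp b d) \<Longrightarrow> vars_below d0 b \<Longrightarrow> d0 \<le> d \<Longrightarrow> \<forall>i. R i \<le> B \<Longrightarrow>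
        \<forall>i<d0. R i \<le> m \<Longrightarrow> abound b m \<le> B \<Longrightarrow>
        \<exists>R'. runs P B (pc, R, out) (pc + length (acomp b d), R', out) \<and> R' d = aval b R \<and>
           (\<forall>i<d. R' i = R i) \<and> (\<forall>i. R' i \<le> B)"
      and R': "\<forall>i<d. R' i = R i" "\<forall>i. R' i \<le> B"
      and c: "code_at P (pc + l) (acomp b (Suc d))" "vars_below d0 b" "d0 \<le> d" "\<forall>i<d0. R i \<le> m"
        "abound b m \<le> B"
  shows "\<exists>R''. runs P B (pc + l, R', out) (pc + l + length (acomp b (Suc d)), R'', out) \<and>
          R'' (Suc d) = aval b R \<and> (\<forall>i<Suc d. R'' i = R' i) \<and> (\<forall>i. R'' i \<le> B)"
  proof -
    have "aval b R' = aval b R" by (rule aval_cong[OF c(2)]) (use R' c in auto)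
    moreover have "\<forall>i<d0. R' i \<le> m" using R' c by auto
    ultimately show ?thesis using IH[OF c(1,2), of R'] R' c by auto
  qed

lemma acomp_correct:
  assumes "code_at P pc (acomp a d)" "vars_below d0 a" "d0 \<le> d"
    and "\<forall>i. R i \<le> B" "\<forall>i<d0. R i \<le> m" "abound a m \<le> B"
  shows "\<exists>R'. runs P B (pc, R, out) (pc + length (acomp a d), R', out) \<and> R' d = aval a R \<and>
           (\<forall>i<d. R' i = R i) \<and> (\<forall>i. R' i \<le> B)"
  using assms
proof (induction a arbitrary: pc d R)
  case (Var i)
  have *: "runs P B (pc, R, out) (Suc pc, R(d := 0), out)"
    by (rule runs_instr) (use Var in \<open>auto simp: code_at_Cons\<close>)
  have "runs P B (Suc pc, R(d := 0), out) (Suc (Suc pc), R(d := R i), out)"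
    by (rule runs_instr) (use Var in \<open>auto simp: code_at_Cons\<close>)
  with * have "runs P B (pc, R, out) (pc + length (acomp (Var i) d), R(d := R i), out)"
    using runs_trans by auto
  moreover have "(R(d := R i)) d = aval (Var i) R" "\<forall>j<d. (R(d := R i)) j = R j" "\<forall>j. (R(d := R i)) j \<le> B"
    using Var by auto
  ultimately show ?case by blast
next
  case (Cst c)
  have "runs P B (pc, R, out) (Suc pc, R(d := c), out)"
    by (rule runs_instr) (use Cst in \<open>auto simp: code_at_Cons\<close>)
  then have "runs P B (pc, R, out) (pc + length (acomp (Cst c) d), R(d := c), out)" by auto
  moreover have "(R(d := c)) d = aval (Cst c) R" "\<forall>j<d. (R(d := c)) j = R j" "\<forall>j. (R(d := c)) j \<le> B"
    using Cst by auto
  ultimately show ?case by blast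
next
  case (Add a b)
  have "aval (Add a b) R \<le> abound (Add a b) m" by (rule aval_le_abound[OF Add.prems(2)]) (use Add.prems in auto)
  with Add.prems show ?case unfolding acomp.simps aval.simps
    by (intro acomp_binop[where h = "(+)"] Add.IH acomp_second_operand[OF Add.IH(2)]) (auto simp: code_at_append)
next
  case (Sub a b)
  have "aval (Sub a b) R \<le> abound (Sub a b) m" by (rule aval_le_abound[OF Sub.prems(2)]) (use Sub.prems in auto)
  with Sub.prems show ?case unfolding acomp.simps aval.simps
    by (intro acomp_binop[where h = "(-)"] Sub.IH acomp_second_operand[OF Sub.IH(2)]) (auto simp: code_at_append)
next
  case (Mul a b)
  have "aval (Mul a b) R \<le> abound (Mul a b) m" by (rule aval_le_abound[OF Mul.prems(2)]) (use Mul.prems in auto)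
  with Mul.prems show ?case unfolding acomp.simps aval.simps
    by (intro acomp_binop[where h = "(*)"] Mul.IH acomp_second_operand[OF Mul.IH(2)]) (auto simp: code_at_append)
next
  case (Div a b)
  have "aval (Div a b) R \<le> abound (Div a b) m" by (rule aval_le_abound[OF Div.prems(2)]) (use Div.prems in auto)
  with Div.prems show ?case unfolding acomp.simps aval.simps
    by (intro acomp_binop[where h = "(div)"] Div.IH acomp_second_operand[OF Div.IH(2)]) (auto simp: code_at_append)
qed

section \<open>Binary length, and the program that prints a table of triples\<close>

definition lg :: "nat \<Rightarrow> nat" where
  "lg N = (LEAST l. N < 2 ^ l)"

lemma less_two_power_lg: "N < 2 ^ lg N"
  unfolding lg_def by (rule LeastI[of _ N]) simp

lemma two_power_lg_le: "2 ^ lg N \<le> 2 * N + 1"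
proof (cases "lg N")
  case (Suc l)
  then have "\<not> N < 2 ^ l" unfolding lg_def by (metis lessI not_less_Least)
  then show ?thesis using Suc by simp
qed simp

lemma lg_le: "lg N \<le> 2 * N + 1"
  using two_power_lg_le[of N] less_exp[of "lg N"] by linarith

lemma lg_le_floorlog: "lg N \<le> floorlog 2 N"
proof (cases "N = 0")
  case False
  then show ?thesis unfolding lg_def using floorlog_bounds[of N 2] by (intro Least_le) auto
qed (auto simp: lg_def)

definition table_env :: "nat \<Rightarrow> nat \<Rightarrow> nat \<Rightarrow> nat" where
  "table_env N k = (\<lambda>i. if i = 0 then N else if i = 1 then lg N else if i = 2 then 2 ^ lg N else k)"

text \<open>Registers 1 and 2 run through \<open>l\<close> and \<open>2 ^ l\<close>. Register 4
  becomes \<open>N + 1 - 2 ^ l\<close>, which truncated subtraction makes zero exactly when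
  \<open>N < 2 ^ l\<close>. The pair \<open>IConst 4 0, IJz 4 3\<close> is an unconditional jump,
  and the last instruction turns register 3 from the constant 1 into the counter of the next
  loop.\<close>

definition log_code :: "instr list" where
  "log_code = [IConst 1 0, IConst 2 1, IConst 3 1, IAdd 4 0 3, ISub 4 4 2, IJz 4 10,
     IAdd 2 2 2, IAdd 1 1 3, IConst 4 0, IJz 4 3, IConst 3 0]"

text \<open>Jump targets are absolute, so the loop has to know its own address \<open>st\<close>.
  Register 3 counts up to the number of triples, kept in register 4; expressions are evaluated from
  register 5 on.\<close>

definition loop_code :: "nat \<Rightarrow> aexp \<Rightarrow> aexp \<Rightarrow> aexp \<Rightarrow> instr list" where
  "loop_code st E1 E2 E3 =
     (let body = acomp E1 5 @ [IEmit 5] @ acomp E2 5 @ [IEmit 5] @ acomp E3 5 @ [IEmit 5] @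
            [IConst 5 1, IAdd 3 3 5, IConst 5 0, IJz 5 st]
      in [ISub 5 4 3, IJz 5 (st + 2 + length body)] @ body)"

definition table_code :: "aexp \<Rightarrow> aexp \<Rightarrow> aexp \<Rightarrow> aexp \<Rightarrow> instr list" where
  "table_code S E1 E2 E3 =
     log_code @ acomp S 4 @ loop_code (11 + length (acomp S 4)) E1 E2 E3"

definition triple_at :: "aexp \<Rightarrow> aexp \<Rightarrow> aexp \<Rightarrow> nat \<Rightarrow> nat \<Rightarrow> nat list" where
  "triple_at E1 E2 E3 N k =
     [aval E1 (table_env N k), aval E2 (table_env N k), aval E3 (table_env N k)]"

lemma log_code_loop:
  assumes c: "code_at P 0 log_code" and B: "2 * N + 2 \<le> B"
    and R: "R 0 = N" "R 1 = l" "R 2 = 2 ^ l" "R 3 = 1" "\<forall>i. R i \<le> B" and l: "l \<le> lg N"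
  shows "\<exists>R'. runs P B (3, R, out) (11, R', out) \<and> (\<forall>i<4. R' i = table_env N 0 i) \<and> (\<forall>i. R' i \<le> B)"
  using R l
proof (induction "lg N - l" arbitrary: l R)
  case 0
  then have l: "l = lg N" by simp
  let ?R1 = "R(4 := N + 1)" and ?R2 = "R(4 := 0)" and ?R3 = "R(4 := 0, 3 := 0)"
  have lt: "N < 2 ^ l" using l less_two_power_lg by simp
  have "runs P B (3, R, out) (4, ?R1, out)"
    by (rule runs_instr[where i = "IAdd 4 0 3"]) (use c 0 B in \<open>auto simp: code_at_Cons log_code_def eval_nat_numeral\<close>)
  moreover have "runs P B (4, ?R1, out) (5, ?R2, out)"
    by (rule runs_instr[where i = "ISub 4 4 2"]) (use c 0 B lt in \<open>auto simp: code_at_Cons log_code_def eval_nat_numeral fun_eq_iff\<close>)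
  moreover have "runs P B (5, ?R2, out) (10, ?R2, out)"
    by (rule runs_instr[where i = "IJz 4 10"]) (use c 0 B in \<open>auto simp: code_at_Cons log_code_def eval_nat_numeral\<close>)
  moreover have "runs P B (10, ?R2, out) (11, ?R3, out)"
    by (rule runs_instr[where i = "IConst 3 0"]) (use c 0 B in \<open>auto simp: code_at_Cons log_code_def eval_nat_numeral\<close>)
  ultimately have "runs P B (3, R, out) (11, ?R3, out)" by (meson runs_trans)
  moreover have "\<forall>i<4. ?R3 i = table_env N 0 i"
    using 0 l by (auto simp: table_env_def less_Suc_eq numeral_eq_Suc)
  moreover have "\<forall>i. ?R3 i \<le> B" using 0 by auto
  ultimately show ?case by blast
next
  case (Suc d)
  then have "l < lg N" by simp
  then have le: "2 ^ l \<le> N" using not_less_Least[of l "\<lambda>l. N < 2 ^ l"] unfolding lg_def by simp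
  then have l: "l < N" using less_exp[of l] by linarith
  let ?R1 = "R(4 := N + 1)" and ?R2 = "R(4 := N + 1 - 2 ^ l)"
  let ?R3 = "?R2(2 := 2 ^ Suc l)" 
  let ?R4 = "?R3(1 := Suc l)"
  let ?R5 = "?R4(4 := 0)"
  have "runs P B (3, R, out) (4, ?R1, out)"
    by (rule runs_instr[where i = "IAdd 4 0 3"]) (use c Suc.prems B in \<open>auto simp: code_at_Cons log_code_def eval_nat_numeral\<close>)
  moreover have "runs P B (4, ?R1, out) (5, ?R2, out)"
    by (rule runs_instr[where i = "ISub 4 4 2"]) (use c Suc.prems B in \<open>auto simp: code_at_Cons log_code_def eval_nat_numeral fun_eq_iff\<close>)
  moreover have "runs P B (5, ?R2, out) (6, ?R2, out)"
    by (rule runs_instr[where i = "IJz 4 10"]) (use c Suc.prems B le in \<open>auto simp: code_at_Cons log_code_def eval_nat_numeral\<close>)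
  moreover have "runs P B (6, ?R2, out) (7, ?R3, out)"
    by (rule runs_instr[where i = "IAdd 2 2 2"]) (use c Suc.prems B le in \<open>auto simp: code_at_Cons log_code_def eval_nat_numeral\<close>)
  moreover have "runs P B (7, ?R3, out) (8, ?R4, out)"
    by (rule runs_instr[where i = "IAdd 1 1 3"]) (use c Suc.prems B le l in \<open>auto simp: code_at_Cons log_code_def eval_nat_numeral\<close>)
  moreover have "runs P B (8, ?R4, out) (9, ?R5, out)"
    by (rule runs_instr[where i = "IConst 4 0"]) (use c Suc.prems B le l in \<open>auto simp: code_at_Cons log_code_def eval_nat_numeral\<close>)
  moreover have "runs P B (9, ?R5, out) (3, ?R5, out)"
    by (rule runs_instr[where i = "IJz 4 3"]) (use c Suc.prems B le l in \<open>auto simp: code_at_Cons log_code_def eval_nat_numeral\<close>)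
  ultimately have 1: "runs P B (3, R, out) (3, ?R5, out)" by (meson runs_trans)
  have "\<exists>R'. runs P B (3, ?R5, out) (11, R', out) \<and> (\<forall>i<4. R' i = table_env N 0 i) \<and> (\<forall>i. R' i \<le> B)"
    by (rule Suc.hyps(1)[of "Suc l"]) (use Suc.hyps(2) Suc.prems le l B in auto)
  then show ?case using runs_trans[OF 1] by blast
qed

lemma emit_expr:
  assumes c: "code_at P pc (acomp E 5 @ [IEmit 5])" and E: "vars_below 4 E"
    and R: "\<forall>i<4. R i = table_env N k i" "R 4 = s" "\<forall>i. R i \<le> B" and B: "abound E m \<le> B"
    and m: "\<forall>i<4. table_env N k i \<le> m"
  shows "\<exists>R'. runs P B (pc, R, out) (pc + length (acomp E 5 @ [IEmit 5]), R', out @ [aval E (table_env N k)])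
      \<and> (\<forall>i<4. R' i = table_env N k i) \<and> R' 4 = s \<and> (\<forall>i. R' i \<le> B)"
proof -
  have v: "aval E R = aval E (table_env N k)" by (rule aval_cong[OF E]) (use R in auto)
  have "\<exists>R'. runs P B (pc, R, out) (pc + length (acomp E 5), R', out) \<and> R' 5 = aval E R \<and>
           (\<forall>i<5. R' i = R i) \<and> (\<forall>i. R' i \<le> B)"
    by (rule acomp_correct[OF _ E]) (use c R B m in \<open>auto simp: code_at_append\<close>)
  then obtain R' where R': "runs P B (pc, R, out) (pc + length (acomp E 5), R', out)" "R' 5 = aval E R"
    "\<forall>i<5. R' i = R i" "\<forall>i. R' i \<le> B" by blast
  have "runs P B (pc + length (acomp E 5), R', out)
     (Suc (pc + length (acomp E 5)), R', out @ [aval E (table_env N k)])"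
    by (rule runs_instr[where i = "IEmit 5"]) (use c R' v in \<open>auto simp: code_at_append code_at_Cons\<close>)
  from runs_trans[OF R'(1) this] show ?thesis using R' R by (intro exI[of _ R']) auto
qed

lemma loop_code_correct:
  assumes c: "code_at P st (loop_code st E1 E2 E3)"
    and E: "vars_below 4 E1" "vars_below 4 E2" "vars_below 4 E3"
    and B: "abound E1 m \<le> B" "abound E2 m \<le> B" "abound E3 m \<le> B" "s + 1 \<le> B"
    and m: "2 * N + 1 \<le> m" "s \<le> m"
    and R: "\<forall>i<4. R i = table_env N k i" "R 4 = s" "\<forall>i. R i \<le> B" "k \<le> s"
  shows "\<exists>R'. runs P B (st, R, concat (map (triple_at E1 E2 E3 N) [0..<k]))
     (st + length (loop_code st E1 E2 E3), R', concat (map (triple_at E1 E2 E3 N) [0..<s]))"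
  using R
proof (induction "s - k" arbitrary: k R)
  case 0
  then have k: "k = s" by simp
  let ?R1 = "R(5 := 0)" and ?out = "concat (map (triple_at E1 E2 E3 N) [0..<s])"
  have "R 3 = k" using 0 by (simp add: table_env_def)
  then have "runs P B (st, R, ?out) (st + 1, ?R1, ?out)"
    by (intro runs_instr[where i = "ISub 5 4 3"])
      (use c 0 in \<open>auto simp: code_at_Cons loop_code_def Let_def\<close>)
  moreover have "runs P B (st + 1, ?R1, ?out) (st + length (loop_code st E1 E2 E3), ?R1, ?out)"
    by (rule runs_instr[OF _ refl])
      (use c 0 in \<open>auto simp: code_at_Cons loop_code_def Let_def\<close>)
  ultimately show ?case using k runs_trans by blast
next
  case (Suc d)
  then have ks: "k < s" by simp
  let ?R1 = "R(5 := s - k)" and ?out = "concat (map (triple_at E1 E2 E3 N) [0..<k])"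
  let ?e1 = "aval E1 (table_env N k)" and ?e2 = "aval E2 (table_env N k)" and ?e3 = "aval E3 (table_env N k)"
  have mm: "\<forall>i<4. table_env N k i \<le> m"
    using m ks two_power_lg_le[of N] lg_le[of N] unfolding table_env_def by auto
  let ?p1 = "st + 2 + length (acomp E1 5 @ [IEmit 5])"
  let ?p2 = "?p1 + length (acomp E2 5 @ [IEmit 5])"
  let ?p3 = "?p2 + length (acomp E3 5 @ [IEmit 5])"
  have c': "code_at P (st + 2) (acomp E1 5 @ [IEmit 5])" "code_at P ?p1 (acomp E2 5 @ [IEmit 5])"
    "code_at P ?p2 (acomp E3 5 @ [IEmit 5])" "code_at P ?p3 [IConst 5 1, IAdd 3 3 5, IConst 5 0, IJz 5 st]"
    using c unfolding loop_code_def Let_def code_at_append by (auto simp: add.assoc)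
  have c0: "code_at P st [ISub 5 4 3, IJz 5 (st + length (loop_code st E1 E2 E3))]"
    using c by (simp add: loop_code_def Let_def code_at_Cons code_at_Nil)
  have R3: "R 3 = k" using Suc.prems by (simp add: table_env_def)
  have R1: "\<forall>i<4. ?R1 i = table_env N k i" "?R1 4 = s" "\<forall>i. ?R1 i \<le> B" using Suc.prems B by auto
  have r0: "runs P B (st, R, ?out) (st + 1, ?R1, ?out)"
    by (rule runs_instr[where i = "ISub 5 4 3"])
      (use c0 R3 R1 Suc.prems in \<open>auto simp: code_at_Cons\<close>)
  have r1: "runs P B (st + 1, ?R1, ?out) (st + 2, ?R1, ?out)"
    by (rule runs_instr[where i = "IJz 5 (st + length (loop_code st E1 E2 E3))"])
      (use c0 R1 ks in \<open>auto simp: code_at_Cons\<close>)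
  obtain R2 where R2: "runs P B (st + 2, ?R1, ?out) (?p1, R2, ?out @ [?e1])"
    "\<forall>i<4. R2 i = table_env N k i" "R2 4 = s" "\<forall>i. R2 i \<le> B"
    using emit_expr[OF c'(1) E(1) R1 B(1) mm] by blast
  obtain R3 where R3: "runs P B (?p1, R2, ?out @ [?e1]) (?p2, R3, (?out @ [?e1]) @ [?e2])"
    "\<forall>i<4. R3 i = table_env N k i" "R3 4 = s" "\<forall>i. R3 i \<le> B"
    using emit_expr[OF c'(2) E(2) R2(2-) B(2) mm] by blast
  obtain R4 where R4: "runs P B (?p2, R3, (?out @ [?e1]) @ [?e2]) (?p3, R4, ((?out @ [?e1]) @ [?e2]) @ [?e3])"
    "\<forall>i<4. R4 i = table_env N k i" "R4 4 = s" "\<forall>i. R4 i \<le> B"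
    using emit_expr[OF c'(3) E(3) R3(2-) B(3) mm] by blast
  have o: "((?out @ [?e1]) @ [?e2]) @ [?e3] = concat (map (triple_at E1 E2 E3 N) [0..<Suc k])" (is "?o4 = ?out'")
    by (simp add: triple_at_def)
  have k3: "R4 3 = k" using R4 by (simp add: table_env_def)
  let ?R5 = "R4(5 := 1)" and ?R6 = "R4(5 := 1, 3 := Suc k)" and ?R7 = "R4(3 := Suc k, 5 := 0)"
  have "runs P B (?p3, R4, ?o4) (?p3 + 1, ?R5, ?o4)"
    by (rule runs_instr[where i = "IConst 5 1"]) (use c'(4) R4 B ks in \<open>auto simp: code_at_Cons\<close>)
  moreover have "runs P B (?p3 + 1, ?R5, ?o4) (?p3 + 2, ?R6, ?o4)"
    by (rule runs_instr[where i = "IAdd 3 3 5"]) (use c'(4) R4 B ks k3 in \<open>auto simp: code_at_Cons\<close>)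
  moreover have "runs P B (?p3 + 2, ?R6, ?o4) (?p3 + 3, ?R7, ?o4)"
    by (rule runs_instr[where i = "IConst 5 0"]) (use c'(4) R4 B ks k3 in \<open>auto simp: code_at_Cons fun_eq_iff\<close>)
  moreover have "runs P B (?p3 + 3, ?R7, ?o4) (st, ?R7, ?o4)"
    by (rule runs_instr[where i = "IJz 5 st"]) (use c'(4) R4 B ks k3 in \<open>auto simp: code_at_Cons eval_nat_numeral\<close>)
  ultimately have "runs P B (?p3, R4, ?o4) (st, ?R7, ?out')" unfolding o by (meson runs_trans)
  with r0 r1 R2(1) R3(1) R4(1) have 1: "runs P B (st, R, ?out) (st, ?R7, ?out')" by (meson runs_trans)
  have "\<exists>R'. runs P B (st, ?R7, ?out')
     (st + length (loop_code st E1 E2 E3), R', concat (map (triple_at E1 E2 E3 N) [0..<s]))"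
    by (rule Suc.hyps(1)) (use Suc.hyps(2) R4 ks B in \<open>auto simp: table_env_def\<close>)
  then show ?case using runs_trans[OF 1] by blast
qed

text \<open>Here \<open>m\<close> bounds all variables of the expressions: \<open>2 ^ lg N\<close>
  is at most \<open>2 * N + 1\<close>, and the counter stays within the number of triples, itself
  bounded by \<open>abound S (2 * N + 1)\<close>.\<close>

lemma table_code_correct:
  assumes "vars_below 3 S" "vars_below 4 E1" "vars_below 4 E2" "vars_below 4 E3"
  defines "P \<equiv> table_code S E1 E2 E3"
  assumes B: "2 * N + 2 \<le> B" "abound S (2 * N + 1) + 1 \<le> B" "m = 2 * N + 1 + abound S (2 * N + 1)"
     "abound E1 m \<le> B" "abound E2 m \<le> B" "abound E3 m \<le> B"
  shows "\<exists>R. runs P B (0, (\<lambda>_. 0)(0 := N), [])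
     (length P, R, concat (map (triple_at E1 E2 E3 N) [0..<aval S (table_env N 0)]))"
proof -
  have len11: "length log_code = 11" by (simp add: log_code_def)
  have "code_at P 0 P" by (simp add: code_at_def)
  then have c: "code_at P 0 log_code" "code_at P 11 (acomp S 4)"
     "code_at P (11 + length (acomp S 4)) (loop_code (11 + length (acomp S 4)) E1 E2 E3)"
     and len: "length P = 11 + length (acomp S 4) + length (loop_code (11 + length (acomp S 4)) E1 E2 E3)"
    using len11 unfolding P_def table_code_def code_at_append by auto
  let ?R0 = "(\<lambda>_. 0::nat)(0 := N)"
  let ?R1 = "?R0(1 := 0)" let ?R2 = "?R1(2 := 1)" let ?R3 = "?R2(3 := 1)"
  have "runs P B (0, ?R0, []) (1, ?R1, [])"
    by (rule runs_instr[where i = "IConst 1 0"]) (use c(1) B(1) in \<open>auto simp: log_code_def code_at_Cons\<close>)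
  moreover have "runs P B (1, ?R1, []) (2, ?R2, [])"
    by (rule runs_instr[where i = "IConst 2 1"]) (use c(1) B(1) in \<open>auto simp: log_code_def code_at_Cons numeral_2_eq_2\<close>)
  moreover have "runs P B (2, ?R2, []) (3, ?R3, [])"
    by (rule runs_instr[where i = "IConst 3 1"]) (use c(1) B(1) in \<open>auto simp: log_code_def code_at_Cons eval_nat_numeral\<close>)
  ultimately have r0: "runs P B (0, ?R0, []) (3, ?R3, [])" by (meson runs_trans)
  have "\<exists>R'. runs P B (3, ?R3, []) (11, R', []) \<and> (\<forall>i<4. R' i = table_env N 0 i) \<and> (\<forall>i. R' i \<le> B)"
    by (rule log_code_loop[OF c(1) B(1), of _ 0]) (use B(1) in auto)
  then obtain R4 where R4: "runs P B (3, ?R3, []) (11, R4, [])" "\<forall>i<4. R4 i = table_env N 0 i"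
    "\<forall>i. R4 i \<le> B" by blast
  have bd: "\<forall>i<3. table_env N 0 i \<le> 2 * N + 1"
    using two_power_lg_le[of N] lg_le[of N] unfolding table_env_def by auto
  have v: "aval S R4 = aval S (table_env N 0)" by (rule aval_cong[OF assms(1)]) (use R4 in auto)
  have s: "aval S (table_env N 0) \<le> abound S (2 * N + 1)"
    by (rule aval_le_abound[OF assms(1)]) (use bd in auto)
  have "\<exists>R'. runs P B (11, R4, []) (11 + length (acomp S 4), R', []) \<and> R' 4 = aval S R4 \<and>
           (\<forall>i<4. R' i = R4 i) \<and> (\<forall>i. R' i \<le> B)"
    by (rule acomp_correct[OF c(2) assms(1), where m = "2 * N + 1"]) (use R4 bd B in auto)
  then obtain R5 where R5: "runs P B (11, R4, []) (11 + length (acomp S 4), R5, [])"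
    "R5 4 = aval S (table_env N 0)" "\<forall>i<4. R5 i = table_env N 0 i" "\<forall>i. R5 i \<le> B"
    using v R4 by auto
  obtain R6 where "runs P B (11 + length (acomp S 4), R5, concat (map (triple_at E1 E2 E3 N) [0..<0]))
     (length P, R6, concat (map (triple_at E1 E2 E3 N) [0..<aval S (table_env N 0)]))"
    using loop_code_correct[OF c(3) assms(2-4) B(4-6) _ _ _ R5(3,2,4)] B s unfolding len by (auto simp: add.assoc)
  then have "runs P B (11 + length (acomp S 4), R5, [])
     (length P, R6, concat (map (triple_at E1 E2 E3 N) [0..<aval S (table_env N 0)]))" by simp
  from runs_trans[OF runs_trans[OF runs_trans[OF r0 R4(1)] R5(1)] this] show ?thesis by blast
qed

lemma halted_stays: "length P \<le> fst cf \<Longrightarrow> (step P ^^ t) cf = cf"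
  by (induction t) (auto simp: step_def)

text \<open>All registers stay below a polynomial in \<open>N\<close>, which has logarithmically
  many bits. Times after halting add nothing, because the configuration is then frozen.\<close>

theorem table_in_logspace:
  assumes "vars_below 3 S" "vars_below 4 E1" "vars_below 4 E2" "vars_below 4 E3"
  shows "generates_in_logspace (table_code S E1 E2 E3)
    (\<lambda>N. concat (map (triple_at E1 E2 E3 N) [0..<aval S (table_env N 0)]))"
proof -
  let ?P = "table_code S E1 E2 E3"
  define m where "m N = 2 * N + 1 + abound S (2 * N + 1)" for N
  define B where "B N = (2 * N + 2) + (abound S (2 * N + 1) + 1) + abound E1 (m N) + abound E2 (m N) + abound E3 (m N)" for N
  have p1: "polyf (\<lambda>N. 2 * N + c)" for c by (intro polyf_add polyf_mult polyf_const polyf_id)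
  have pm: "polyf m" unfolding m_def by (intro polyf_add p1 polyf_abound)
  have pB: "polyf B" unfolding B_def by (intro polyf_add p1 polyf_abound polyf_const pm)
  have run: "\<exists>R. runs ?P (B N) (0, (\<lambda>_. 0)(0 := N), [])
     (length ?P, R, concat (map (triple_at E1 E2 E3 N) [0..<aval S (table_env N 0)]))" for N
    by (rule table_code_correct[OF assms, where m = "m N"]) (auto simp: B_def m_def)
  have halt: "\<exists>t R pc. config_after ?P N t = (pc, R, concat (map (triple_at E1 E2 E3 N) [0..<aval S (table_env N 0)])) \<and> length ?P \<le> pc"
    for N using run[of N] unfolding runs_def config_after_def by blast
  have bnd: "fst (snd (config_after ?P N u)) a \<le> B N" for N u a
  proof -
    obtain t R out where t: "(step ?P ^^ t) (0, (\<lambda>_. 0)(0 := N), []) = (length ?P, R, out)"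
      and le: "\<And>t' a. t' \<le> t \<Longrightarrow> fst (snd ((step ?P ^^ t') (0, (\<lambda>_. 0)(0 := N), []))) a \<le> B N"
      using run[of N] unfolding runs_def by blast
    show ?thesis
    proof (cases "u \<le> t")
      case False
      then obtain v where v: "u = v + t" by (metis add.commute le_Suc_ex nat_le_linear)
      have "config_after ?P N u = (length ?P, R, out)"
        unfolding config_after_def v funpow_add o_apply t by (rule halted_stays) simp
      then show ?thesis using le[of t a] t by simp
    qed (use le in \<open>auto simp: config_after_def\<close>)
  qed
  show ?thesis
    unfolding generates_in_logspace_def
    using halt floorlog_polyf[OF pB] floorlog_mono[OF bnd] by (intro conjI allI exI[of _ "\<lambda>N. floorlog 2 (B N)"]) auto
qed

section \<open>Circuits for formulas with transitive closure\<close>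

lemma foldl_snoc_length: "length (foldl (\<lambda>vs g. vs @ [h vs g]) [] gs) = length gs"
  by (induction gs rule: rev_induct) auto

lemma foldl_snoc_take:
  "take K (foldl (\<lambda>vs g. vs @ [h vs g]) [] gs) = foldl (\<lambda>vs g. vs @ [h vs g]) [] (take K gs)"
proof (induction gs rule: rev_induct)
  case (snoc g gs)
  then show ?case by (cases "K \<le> length gs") (auto simp: foldl_snoc_length)
qed simp

lemma foldl_snoc_nth:
  assumes "K < length gs"
  shows "foldl (\<lambda>vs g. vs @ [h vs g]) [] gs ! K
    = h (take K (foldl (\<lambda>vs g. vs @ [h vs g]) [] gs)) (gs ! K)"
proof -
  have "foldl (\<lambda>vs g. vs @ [h vs g]) [] gs ! K = take (Suc K) (foldl (\<lambda>vs g. vs @ [h vs g]) [] gs) ! K"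
    by simp
  also have "\<dots> = h (take K (foldl (\<lambda>vs g. vs @ [h vs g]) [] gs)) (gs ! K)"
    using assms by (simp add: foldl_snoc_take take_Suc_conv_app_nth nth_append foldl_snoc_length)
  finally show ?thesis .
qed

text \<open>Gates read an arbitrary valuation \<open>v\<close> of all gates instead of the list of
  values computed so far. The circuits built here contain no \<open>GRnd\<close>, whose value
  \<open>False\<close> is a default.\<close>

fun gate_sem :: "bool list \<Rightarrow> (nat \<Rightarrow> bool) \<Rightarrow> gate \<Rightarrow> bool" where
  "gate_sem x v (GConst b) = b"
| "gate_sem x v (GIn i) = x ! i"
| "gate_sem x v (GRnd i) = False"
| "gate_sem x v (GNot i) = (\<not> v i)"
| "gate_sem x v (GAnd i j) = (v i \<and> v j)"
| "gate_sem x v (GOr i j) = (v i \<or> v j)"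

text \<open>As wires lead backwards, the final list of values satisfies one equation per gate. What
  follows works with these equations and not with the order of evaluation.\<close>

lemma run_circuit_sem:
  assumes preds: "\<And>K j. K < length (gates C) \<Longrightarrow> j \<in> gate_preds (gates C ! K) \<Longrightarrow> j < K"
    and norand: "\<And>i. GRnd i \<notin> set (gates C)"
  obtains v where "run_circuit C x \<rho> = map v (outs C)"
    and "\<And>K. K < length (gates C) \<Longrightarrow> v K = gate_sem x v (gates C ! K)"
proof -
  define vs where "vs = foldl (\<lambda>vs g. vs @ [gate_value x \<rho> vs g]) [] (gates C)"
  have "vs ! K = gate_sem x ((!) vs) (gates C ! K)" if K: "K < length (gates C)" for K
  proof -
    have "vs ! K = gate_value x \<rho> (take K vs) (gates C ! K)"
      unfolding vs_def by (rule foldl_snoc_nth[OF K])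
    also have "\<dots> = gate_sem x ((!) vs) (gates C ! K)"
      using preds[OF K] norand nth_mem[OF K] by (cases "gates C ! K") auto
    finally show ?thesis .
  qed
  then show ?thesis using that[of "(!) vs"] by (simp add: run_circuit_def vs_def)
qed

lemma circuit_depth_le:
  assumes preds: "\<And>K j. K < length (gates C) \<Longrightarrow> j \<in> gate_preds (gates C ! K) \<Longrightarrow> j < K"
    and bnd: "\<And>K j. K < length (gates C) \<Longrightarrow> j \<in> gate_preds (gates C ! K) \<Longrightarrow> Suc (d j) \<le> d K"
    and D: "\<And>K. K < length (gates C) \<Longrightarrow> d K \<le> D"
  shows "circuit_depth C \<le> D"
proof -
  define ds where "ds = foldl (\<lambda>ds g. ds @ [gate_depth ds g]) [] (gates C)"
  have len: "length ds = length (gates C)" by (simp add: ds_def foldl_snoc_length)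
  have le: "ds ! K \<le> d K" if "K < length (gates C)" for K
    using that
  proof (induction K rule: less_induct)
    case (less K)
    have "ds ! K = gate_depth (take K ds) (gates C ! K)"
      unfolding ds_def by (rule foldl_snoc_nth[OF less.prems])
    moreover have "Suc (ds ! j) \<le> d K" "take K ds ! j = ds ! j" if "j \<in> gate_preds (gates C ! K)" for j
      using less.IH[of j] preds[OF less.prems that] bnd[OF less.prems that] less.prems by auto
    ultimately show ?case by (cases "gates C ! K") (auto simp: max_def)
  qed
  have "\<forall>y\<in>insert 0 (set ds). y \<le> D" using order_trans[OF le D] len by (auto simp: in_set_conv_nth)
  then show ?thesis unfolding circuit_depth_def ds_def[symmetric] by (subst Max_le_iff) auto
qed

text \<open>
  Formulas are evaluated over assignments whose variables \<open>0\<close>, \<open>1\<close>, \<open>2\<close> hold the input length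
  \<open>N\<close>, \<open>lg N\<close> and \<open>2 ^ lg N\<close>; bound variables are numbered from \<open>3\<close> on, and range over \<open>{..<M}\<close>.
\<close>

datatype fm = Rel aexp | Inp aexp | Neg fm | Conj fm fm | Ex nat fm | Sbst nat aexp fm | TC nat nat fm

text \<open>\<open>Sbst\<close> is false if the value leaves the range, because a circuit has
  entries only for assignments with values below \<open>M\<close>; likewise \<open>Inp\<close> is
  false beyond the end of the input.\<close>

fun fsem :: "nat \<Rightarrow> bool list \<Rightarrow> fm \<Rightarrow> (nat \<Rightarrow> nat) \<Rightarrow> bool" where
  "fsem M x (Rel e) s = (aval e s \<noteq> 0)"
| "fsem M x (Inp e) s = (aval e s < length x \<and> x ! aval e s)"
| "fsem M x (Neg f) s = (\<not> fsem M x f s)"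
| "fsem M x (Conj f g) s = (fsem M x f s \<and> fsem M x g s)"
| "fsem M x (Ex i f) s = (\<exists>y<M. fsem M x f (s(i := y)))"
| "fsem M x (Sbst i e f) s = (aval e s < M \<and> fsem M x f (s(i := aval e s)))"
| "fsem M x (TC i j f) s = ((s i, s j) \<in> {(a, b). a < M \<and> b < M \<and> fsem M x f (s(i := a, j := b))}\<^sup>*)"

fun wff :: "nat \<Rightarrow> fm \<Rightarrow> bool" where
  "wff k (Rel e) = vars_below (k + 3) e"
| "wff k (Inp e) = vars_below (k + 3) e"
| "wff k (Neg f) = wff k f"
| "wff k (Conj f g) = (wff k f \<and> wff k g)"
| "wff k (Ex i f) = (3 \<le> i \<and> i < k + 3 \<and> wff k f)"
| "wff k (Sbst i e f) = (3 \<le> i \<and> i < k + 3 \<and> vars_below (k + 3) e \<and> wff k f)"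
| "wff k (TC i j f) = (3 \<le> i \<and> i < k + 3 \<and> 3 \<le> j \<and> j < k + 3 \<and> i \<noteq> j \<and> wff k f)"

datatype cmd = CRel aexp | CInp aexp | CNeg nat | CConj nat nat | CEx nat nat | CSbst nat aexp nat
  | CTC nat nat nat

text \<open>Postorder: the commands of \<open>comp f b\<close> are numbered from \<open>b\<close>
  on, and the last one computes \<open>f\<close>. The shift by 3 turns a bound variable into its
  digit position.\<close>

fun comp :: "fm \<Rightarrow> nat \<Rightarrow> cmd list" where
  "comp (Rel e) b = [CRel e]"
| "comp (Inp e) b = [CInp e]"
| "comp (Neg f) b = (let cs = comp f b in cs @ [CNeg (b + length cs - 1)])"
| "comp (Conj f g) b =
    (let cs = comp f b; ds = comp g (b + length cs)
     in cs @ ds @ [CConj (b + length cs - 1) (b + length cs + length ds - 1)])"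
| "comp (Ex i f) b = (let cs = comp f b in cs @ [CEx (i - 3) (b + length cs - 1)])"
| "comp (Sbst i e f) b = (let cs = comp f b in cs @ [CSbst (i - 3) e (b + length cs - 1)])"
| "comp (TC i j f) b = (let cs = comp f b in cs @ [CTC (i - 3) (j - 3) (b + length cs - 1)])"

fun wf_cmd :: "nat \<Rightarrow> nat \<Rightarrow> cmd \<Rightarrow> bool" where
  "wf_cmd k c (CRel e) = vars_below (k + 3) e"
| "wf_cmd k c (CInp e) = vars_below (k + 3) e"
| "wf_cmd k c (CNeg a) = (a < c)"
| "wf_cmd k c (CConj a b) = (a < c \<and> b < c)"
| "wf_cmd k c (CEx i a) = (i < k \<and> a < c)"
| "wf_cmd k c (CSbst i e a) = (i < k \<and> vars_below (k + 3) e \<and> a < c)"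
| "wf_cmd k c (CTC i j a) = (i < k \<and> j < k \<and> i \<noteq> j \<and> a < c)"

lemma comp_length: "comp f b \<noteq> []" "0 < length (comp f b)"
  by (cases f; simp add: Let_def)+

lemma comp_wf:
  "wff k f \<Longrightarrow> i < length (comp f b) \<Longrightarrow> wf_cmd k (b + i) (comp f b ! i)"
proof (induction f arbitrary: b i)
  case (Conj f g)
  let ?cs = "comp f b"
  let ?ds = "comp g (b + length ?cs)"
  consider "i < length ?cs" | "length ?cs \<le> i" "i < length ?cs + length ?ds" | "i = length ?cs + length ?ds"
    using Conj.prems by (fastforce simp: Let_def)
  then show ?case
  proof cases
    case 2
    then obtain i' where "i = length ?cs + i'" by (metis le_Suc_ex)
    with 2 Conj show ?thesis by (simp add: Let_def nth_append add.assoc[symmetric])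
  next
    case 3
    moreover obtain a d where "length ?cs = Suc a" "length ?ds = Suc d"
      using comp_length(2) gr0_implies_Suc by metis
    ultimately show ?thesis by (simp add: Let_def nth_append)
  qed (use Conj comp_length in \<open>auto simp: Let_def nth_append\<close>)
qed (use comp_length in \<open>auto simp: Let_def nth_append less_Suc_eq\<close>)

text \<open>
  Every command owns \<open>T\<close> consecutive rows of \<open>X = M ^ k\<close> entries, one for every assignment, coded
  in base \<open>M\<close>. An entry is a disjunction of \<open>M\<close> leaves; it consists of \<open>2 * M\<close> gates: the leaves,
  a binary tree of or-gates whose root has offset \<open>2 * M - 2\<close>, and the negation of the root. Only a
  closure command needs different rows: row \<open>t\<close> contains the paths of length at most \<open>2 ^ t\<close>.
\<close>

locale layout =
  fixes N m k :: nat
  assumes k: "0 < k" and m: "0 < m"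
begin

definition M :: nat where "M = (2 ^ lg N) ^ m"
definition "X = M ^ k"
text \<open>\<open>2 ^ L = M * M\<close> bounds the number of pairs of a relation on
  \<open>{..<M}\<close>, so paths of length at most \<open>2 ^ L\<close> yield the whole
  closure.\<close>

definition "L = 2 * m * lg N"
definition "T = L + 1"
definition "dig x i = x div M ^ i mod M"
definition "upd x i y = x - dig x i * M ^ i + y * M ^ i"
definition "env x = (\<lambda>i. if i = 0 then N else if i = 1 then lg N else if i = 2 then 2 ^ lg N
   else dig x (i - 3))"
text \<open>\<open>s = 0\<close> addresses the root of an entry and \<open>s = 1\<close> its
  negation.\<close>

definition "ref r x s = (r * X + x) * (2 * M) + (2 * M - 2) + s" for s :: nat
definition "res c x s = ref (c * T + L) x s" for s :: nat

text \<open>The rows of a command other than \<open>CTC\<close> are copies of each other. The leaf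
  number \<open>y\<close> matters for \<open>CEx\<close>, as witness, and for the rows
  \<open>t > 0\<close> of \<open>CTC\<close>, as midpoint of a path; elsewhere all leaves of an
  entry agree. A conjunction of a gate with itself serves as a wire.\<close>

fun leaf :: "cmd \<Rightarrow> nat \<Rightarrow> nat \<Rightarrow> nat \<Rightarrow> nat \<Rightarrow> gate" where
  "leaf (CRel e) c t x y = GConst (aval e (env x) \<noteq> 0)"
| "leaf (CInp e) c t x y = (if aval e (env x) < N then GIn (aval e (env x)) else GConst False)"
| "leaf (CNeg a) c t x y = GAnd (res a x 1) (res a x 1)"
| "leaf (CConj a b) c t x y = GAnd (res a x 0) (res b x 0)"
| "leaf (CEx i a) c t x y = GAnd (res a (upd x i y) 0) (res a (upd x i y) 0)"
| "leaf (CSbst i e a) c t x y =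
    (if aval e (env x) < M
     then GAnd (res a (upd x i (aval e (env x))) 0) (res a (upd x i (aval e (env x))) 0)
     else GConst False)"
| "leaf (CTC i j a) c t x y =
    (if t = 0 then if dig x i = dig x j then GConst True else GAnd (res a x 0) (res a x 0)
     else GAnd (ref (c * T + t - 1) (upd x j y) 0) (ref (c * T + t - 1) (upd x i y) 0))"

text \<open>Or-gate \<open>M + i\<close> joins the gates \<open>2 * i\<close> and
  \<open>2 * i + 1\<close> of its entry, which lists the tree level by level from the leaves to the
  root.\<close>

definition gate_at :: "cmd list \<Rightarrow> nat \<Rightarrow> gate" where
  "gate_at prog K =
     (let j = K mod (2 * M); e = K div (2 * M); x = e mod X; r = e div X
      in if j < M then leaf (prog ! (r div T)) (r div T) (r mod T) x j
         else if j < 2 * M - 1 then GOr (K - j + 2 * (j - M)) (K - j + 2 * (j - M) + 1)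
         else GNot (K - 1))"

definition "size_of prog = length prog * T * X * (2 * M)" for prog :: "cmd list"

text \<open>Output \<open>j\<close> is read at the assignment with code \<open>j\<close>: as
  \<open>j < N < M\<close>, variable 3 is \<open>j\<close> and all other bound variables are
  0.\<close>

definition circuit_of :: "cmd list \<Rightarrow> circuit" where
  "circuit_of prog = Circuit (map (gate_at prog) [0..<size_of prog])
     (map (\<lambda>j. res (length prog - 1) j 0) [0..<N])"

lemma M_pos: "0 < M" "0 < 2 * M" by (auto simp: M_def)
lemma X_pos: "0 < X" by (auto simp: M_pos X_def)
lemma N_less_M: "N < M"
proof -
  have "(2 ^ lg N) ^ 1 \<le> (2 ^ lg N :: nat) ^ m" using m by (intro power_increasing) auto
  then show ?thesis using less_two_power_lg[of N] unfolding M_def by simp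
qed
lemma N_less_X: "N < X"
proof -
  have "M ^ 1 \<le> M ^ k" using k M_pos by (intro power_increasing) auto
  then show ?thesis using N_less_M unfolding X_def by simp
qed
lemma M_power2: "M = 2 ^ (m * lg N)" by (simp add: M_def power_mult[symmetric] mult.commute)
lemma two_power_L: "2 ^ L = M * M"
  by (simp add: M_power2 L_def power_add[symmetric])

section \<open>Digits of assignments\<close>

lemma dig_less: "dig x i < M" by (simp add: dig_def M_pos)

lemma split_at_digit:
  "x = x div M ^ Suc i * M ^ Suc i + dig x i * M ^ i + x mod M ^ i"
proof -
  have "x = (x div M ^ i) * M ^ i + x mod M ^ i" by (rule div_mult_mod_eq[symmetric])
  also have "x div M ^ i = (x div M ^ i) div M * M + dig x i" unfolding dig_def by (rule div_mult_mod_eq[symmetric])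
  also have "(x div M ^ i) div M = x div M ^ Suc i" by (simp only: power_Suc2 div_mult2_eq)
  finally show ?thesis by (simp add: algebra_simps)
qed

lemma upd_eq: "upd x i y = x div M ^ Suc i * M ^ Suc i + y * M ^ i + x mod M ^ i"
  unfolding upd_def using split_at_digit[of x i] by linarith

lemma upd_mod: "upd x i y mod M ^ i = x mod M ^ i"
proof -
  have "upd x i y = (x div M ^ Suc i * M + y) * M ^ i + x mod M ^ i"
    unfolding upd_eq by (simp add: algebra_simps)
  then show ?thesis by simp
qed

lemma upd_div: "y < M \<Longrightarrow> upd x i y div M ^ i = x div M ^ Suc i * M + y"
proof -
  have "upd x i y = (x div M ^ Suc i * M + y) * M ^ i + x mod M ^ i"
    unfolding upd_eq by (simp add: algebra_simps)
  then show ?thesis using M_pos by simp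
qed

lemma upd_div_Suc: 
  assumes "y < M"
  shows "upd x i y div M ^ Suc i = x div M ^ Suc i"
proof -
  have "upd x i y div M ^ Suc i = upd x i y div M ^ i div M" by (simp only: power_Suc2 div_mult2_eq)
  also have "\<dots> = (x div M ^ Suc i * M + y) div M" by (simp only: upd_div[OF assms])
  finally show ?thesis using assms by simp
qed

lemma dig_upd: 
  assumes "y < M"
  shows "dig (upd x i y) j = (if j = i then y else dig x j)"
proof -
  consider "j = i" | "j < i" | "i < j" by linarith
  then show ?thesis
  proof cases
    case 1
    then show ?thesis using upd_div[OF assms] assms by (simp add: dig_def)
  next
    case 2
    have low: "dig z j = dig (z mod M ^ i) j" for z
    proof -
      obtain d where d: "i = Suc j + d" using 2 by (metis Suc_leI le_Suc_ex)
      have "z mod M ^ i div M ^ j = z div M ^ j mod M ^ Suc d"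
        unfolding d using mod_mult2_eq[of z "M ^ j" "M ^ Suc d"] M_pos by (simp add: power_add algebra_simps)
      then show ?thesis unfolding dig_def by (simp add: mod_mod_cancel)
    qed
    show ?thesis using low[of "upd x i y"] low[of x] upd_mod 2 by simp
  next
    case 3
    have high: "dig z j = dig (z div M ^ Suc i) (j - Suc i)" for z
    proof -
      have "M ^ j = M ^ Suc i * M ^ (j - Suc i)" using 3 by (simp only: power_add[symmetric]) simp
      then show ?thesis by (simp only: dig_def div_mult2_eq)
    qed
    show ?thesis using high[of "upd x i y"] high[of x] upd_div_Suc[OF assms] 3 by simp
  qed
qed

lemma upd_less:
  assumes "x < X" "y < M" "i < k"
  shows "upd x i y < X"
proof -
  have "X = M ^ Suc i * M ^ (k - Suc i)" unfolding X_def using assms(3)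
    by (simp only: power_add[symmetric]) simp
  moreover have "x div M ^ Suc i < M ^ (k - Suc i)"
    using assms(1) calculation M_pos by (simp add: less_mult_imp_div_less mult.commute)
  then have "upd x i y div M ^ Suc i < M ^ (k - Suc i)" using upd_div_Suc assms by simp
  then have "upd x i y < M ^ (k - Suc i) * M ^ Suc i"
    using div_less_iff_less_mult[of "M ^ Suc i"] M_pos by simp
  ultimately show ?thesis by (simp add: mult.commute)
qed

lemma env_upd:
  assumes "y < M" "3 \<le> i"
  shows "env (upd x (i - 3) y) = (env x)(i := y)"
  using assms by (auto simp: env_def fun_eq_iff dig_upd)

lemma upd_dig: "upd x i (dig x i) = x"
  unfolding upd_eq using split_at_digit[of x i] by simp

lemma dig_ext: "\<lbrakk>x < X; x' < X; \<And>i. i < k \<Longrightarrow> dig x i = dig x' i\<rbrakk> \<Longrightarrow> x = x'"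
proof -
  assume a: "x < X" "x' < X" and d: "\<And>i. i < k \<Longrightarrow> dig x i = dig x' i"
  have "x mod M ^ j = x' mod M ^ j" if "j \<le> k" for j
    using that
  proof (induction j)
    case (Suc j)
    have "z mod M ^ Suc j = dig z j * M ^ j + z mod M ^ j" for z
      using mod_mult2_eq[of z "M ^ j" M] by (simp add: dig_def algebra_simps)
    then show ?case using Suc d[of j] by simp
  qed simp
  from this[of k] show ?thesis using a by (simp add: X_def)
qed

section \<open>Gate numbers, wires and depth\<close>

lemma ref_alt: "ref r x s = (r * X + x) * (2 * M) + (2 * M - 2 + s)"
  by (simp add: ref_def)

lemma entry_decode:
  assumes "x < X" "j < 2 * M"
  shows "((r * X + x) * (2 * M) + j) mod (2 * M) = j"
    and "((r * X + x) * (2 * M) + j) div (2 * M) mod X = x"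
    and "((r * X + x) * (2 * M) + j) div (2 * M) div X = r"
proof -
  have 1: "((r * X + x) * (2 * M) + j) div (2 * M) = r * X + x" using assms by simp
  show "((r * X + x) * (2 * M) + j) mod (2 * M) = j" using assms by simp
  show "((r * X + x) * (2 * M) + j) div (2 * M) mod X = x" unfolding 1 using assms by simp
  show "((r * X + x) * (2 * M) + j) div (2 * M) div X = r" unfolding 1 using assms by simp
qed

lemma gate_at_entry:
  assumes "x < X" "j < 2 * M" "t < T" and q: "q = ((c * T + t) * X + x) * (2 * M) + j"
  shows "gate_at prog q =
    (if j < M then leaf (prog ! c) c t x j
     else if j < 2 * M - 1 then GOr (q - j + 2 * (j - M)) (q - j + 2 * (j - M) + 1)
     else GNot (q - 1))"
  unfolding gate_at_def Let_def q entry_decode[OF assms(1,2)] using assms(3) by simp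

lemma entry_less_size:
  assumes "x < X" "j < 2 * M" "r < length prog * T"
  shows "(r * X + x) * (2 * M) + j < size_of prog"
proof -
  have "r * X + x < Suc r * X" using assms by simp
  also have "\<dots> \<le> length prog * T * X" using assms by (intro mult_le_mono1) simp
  finally have "Suc (r * X + x) * (2 * M) \<le> length prog * T * X * (2 * M)" by (intro mult_le_mono1) simp
  then show ?thesis using assms(2) by (simp add: size_of_def)
qed

lemma gate_cases:
  assumes "q < size_of prog"
  obtains c t x j where "c < length prog" "t < T" "x < X" "j < 2 * M"
    "q = ((c * T + t) * X + x) * (2 * M) + j"
proof
  let ?e = "q div (2 * M)"
  let ?r = "?e div X"
  have e: "?e < length prog * T * X"
    using assms M_pos by (simp add: size_of_def less_mult_imp_div_less)
  then have r: "?r < length prog * T" by (simp add: less_mult_imp_div_less)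
  then show "?r div T < length prog" by (simp add: less_mult_imp_div_less)
  show "?r mod T < T" by (simp add: T_def)
  show "?e mod X < X" using X_pos by simp
  show "q mod (2 * M) < 2 * M" using M_pos by simp
  show "q = ((?r div T * T + ?r mod T) * X + ?e mod X) * (2 * M) + q mod (2 * M)"
    by (simp only: div_mult_mod_eq)
qed

lemma row_less:
  assumes "a < (c::nat)"
  shows "a * T + L < c * T + t"
proof -
  have "a * T + L < Suc a * T" by (simp add: T_def)
  also have "\<dots> \<le> c * T" using assms by (intro mult_le_mono1) simp
  finally show ?thesis by simp
qed

text \<open>Leaves read from earlier rows only, so within a row just the or-tree and the negation
  contribute to the depth.\<close>

lemma leaf_preds:
  assumes "wf_cmd k c cm" "t < T" "x < X" "y < M" "q \<in> gate_preds (leaf cm c t x y)"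
  shows "\<exists>r x' s. r < c * T + t \<and> x' < X \<and> s < 2 \<and> q = ref r x' s"
proof -
  have res: "\<exists>r x'' s'. r < c * T + t \<and> x'' < X \<and> s' < 2 \<and> res a x' s = ref r x'' s'"
    if "a < c" "x' < X" "s < 2" for a x' s
    using row_less[OF that(1), of t] that(2,3) unfolding res_def by blast
  show ?thesis
  proof (cases cm)
    case (CTC i j a)
    then have ij: "i < k" "j < k" "a < c" using assms by auto
    show ?thesis
    proof (cases "t = 0")
      case True
      then have "q = ref (a * T + L) x 0" using assms CTC by (auto simp: res_def split: if_splits)
      then show ?thesis using row_less[OF ij(3), of t] assms by (intro exI[of _ "a * T + L"] exI[of _ x] exI[of _ 0]) auto
    next
      case False
      then have "q = ref (c * T + t - 1) (upd x j y) 0 \<or> q = ref (c * T + t - 1) (upd x i y) 0"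
        using assms CTC by auto
      moreover have "upd x i y < X" "upd x j y < X" using upd_less assms ij by auto
      moreover have "c * T + t - 1 < c * T + t" using False by simp
      ultimately show ?thesis by (metis pos2)
    qed
  qed (use assms res upd_less in \<open>auto split: if_splits\<close>)
qed

lemma ref_less:
  assumes "r < r'" "x < X" "s < 2"
  shows "ref r x s < (r' * X + x') * (2 * M)"
proof -
  have "r * X + x < Suc r * X" using assms by simp
  also have "\<dots> \<le> r' * X" using assms by (intro mult_le_mono1) simp
  finally have "Suc (r * X + x) \<le> r' * X + x'" by simp
  then have "Suc (r * X + x) * (2 * M) \<le> (r' * X + x') * (2 * M)" by (rule mult_le_mono1)
  moreover have "ref r x s < Suc (r * X + x) * (2 * M)" using assms M_pos by (simp add: ref_def)
  ultimately show ?thesis by linarith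
qed

definition wf_prog :: "cmd list \<Rightarrow> bool" where
  "wf_prog prog \<longleftrightarrow> prog \<noteq> [] \<and> (\<forall>c<length prog. wf_cmd k c (prog ! c))"

definition height :: nat where "height = m * lg N"

text \<open>With \<open>z = 2 * M - 1 - j\<close> the or-tree gets heap numbers: the root is 1 and
  the children of \<open>z\<close> are \<open>2 * z\<close> and \<open>2 * z + 1\<close>, so that
  \<open>floorlog\<close> counts levels. A row takes \<open>height + 2\<close> levels, for the
  leaves, the \<open>height\<close> levels of or-gates and the negation.\<close>

definition gate_level :: "nat \<Rightarrow> nat" where
  "gate_level q =
     (let j = q mod (2 * M); r = q div (2 * M) div X
      in if j < 2 * M - 1 then r * (height + 2) + 1 + (height + 1 - floorlog 2 (2 * M - 1 - j))
         else (r + 1) * (height + 2))"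

lemma gate_level_entry:
  assumes "x < X" "j < 2 * M" and q: "q = (r * X + x) * (2 * M) + j"
  shows "gate_level q =
    (if j < 2 * M - 1 then r * (height + 2) + 1 + (height + 1 - floorlog 2 (2 * M - 1 - j))
     else (r + 1) * (height + 2))"
  unfolding gate_level_def Let_def q entry_decode[OF assms(1,2)] ..

lemma gate_level_le:
  assumes "x < X" "j < 2 * M" "q = (r * X + x) * (2 * M) + j"
  shows "gate_level q \<le> (r + 1) * (height + 2)"
proof -
  have "floorlog 2 (2 * M - 1 - j) \<ge> 1" if "j < 2 * M - 1"
    using that by (subst compute_floorlog) auto
  then show ?thesis unfolding gate_level_entry[OF assms] by auto
qed

lemma gate_preds_level:
  assumes wf: "wf_prog prog" and q: "q < size_of prog" and p: "p \<in> gate_preds (gate_at prog q)"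
  shows "p < q" "Suc (gate_level p) \<le> gate_level q"
proof -
  obtain c t x j where c: "c < length prog" "t < T" "x < X" "j < 2 * M"
    and qe: "q = ((c * T + t) * X + x) * (2 * M) + j"
    using gate_cases[OF q] by blast
  let ?r = "c * T + t" let ?st = "((c * T + t) * X + x) * (2 * M)"
  have g: "gate_at prog q =
    (if j < M then leaf (prog ! c) c t x j
     else if j < 2 * M - 1 then GOr (?st + 2 * (j - M)) (?st + 2 * (j - M) + 1)
     else GNot (q - 1))"
    using gate_at_entry[OF c(3,4,2) qe] by (simp add: qe)
  note lev = gate_level_entry[OF c(3,4) qe]
  consider "j < M" | "M \<le> j" "j < 2 * M - 1" | "M \<le> j" "j = 2 * M - 1" using c(4) M_pos by linarith
  then have "p < q \<and> Suc (gate_level p) \<le> gate_level q"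
  proof cases
    case 1
    have "wf_cmd k c (prog ! c)" using wf c by (simp add: wf_prog_def)
    moreover have "p \<in> gate_preds (leaf (prog ! c) c t x j)" using p g 1 by simp
    ultimately obtain r x' s where p': "r < ?r" "x' < X" "s < 2" "p = ref r x' s"
      using leaf_preds[OF _ c(2,3) 1] by blast
    have "gate_level p \<le> (r + 1) * (height + 2)"
      by (rule gate_level_le[OF p'(2), of "2 * M - 2 + s"]) (use p' M_pos in \<open>auto simp: ref_def\<close>)
    also have "\<dots> \<le> ?r * (height + 2)" using p'(1) by (intro mult_le_mono1) simp
    also have "\<dots> < gate_level q" using lev 1 by simp
    finally have "Suc (gate_level p) \<le> gate_level q" by simp
    moreover have "p < q" using ref_less[OF p'(1-3), of x] p'(4) qe by simp
    ultimately show ?thesis by simp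
  next
    case 2
    then obtain b where b: "b < 2" "p = ?st + (2 * (j - M) + b)" using p g by fastforce
    let ?j = "2 * (j - M) + b" let ?z = "2 * M - 1 - j"
    have j: "?j < 2 * M - 1" "?j < j" using 2 b by auto
    have "2 * M - 1 - ?j = 2 * ?z + (1 - b)" using 2 b by auto
    then have "floorlog 2 (2 * M - 1 - ?j) = Suc (floorlog 2 ?z)"
      using 2 b by (subst compute_floorlog) (cases b; auto)
    moreover have "floorlog 2 (2 * M - 1 - ?j) \<le> height + 1"
      using M_power2 M_pos by (intro floorlog_leI) (auto simp: height_def)
    ultimately have "Suc (height + 1 - floorlog 2 (2 * M - 1 - ?j)) = height + 1 - floorlog 2 ?z"
      by simp
    moreover have "gate_level p = ?r * (height + 2) + 1 + (height + 1 - floorlog 2 (2 * M - 1 - ?j))"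
      using gate_level_entry[OF c(3) _ b(2)] j by simp
    ultimately show ?thesis using lev 2 b j qe by simp
  next
    case 3
    then have p': "p = ?st + (2 * M - 2)" "p < q" using p g qe M_pos by auto
    have "gate_level p \<le> ?r * (height + 2) + 1 + (height + 1 - floorlog 2 1)"
      using gate_level_entry[OF c(3) _ p'(1)] M_pos by simp
    moreover have "floorlog 2 1 = 1" by (simp add: floorlog_def)
    ultimately show ?thesis using lev 3 p' by simp
  qed
  then show "p < q" "Suc (gate_level p) \<le> gate_level q" by auto
qed

lemma depth_circuit_of:
  assumes "wf_prog prog"
  shows "circuit_depth (circuit_of prog) \<le> length prog * T * (height + 2)"
proof (rule circuit_depth_le[where d = gate_level])
  fix q assume q: "q < length (gates (circuit_of prog))"
  then have q': "q < size_of prog" by (simp add: circuit_of_def)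
  then have nth: "gates (circuit_of prog) ! q = gate_at prog q" by (simp add: circuit_of_def)
  show "j < q" "Suc (gate_level j) \<le> gate_level q" if "j \<in> gate_preds (gates (circuit_of prog) ! q)" for j
    using gate_preds_level[OF assms q'] that nth by auto
  obtain c t x j where c: "c < length prog" "t < T" "x < X" "j < 2 * M"
    and qe: "q = ((c * T + t) * X + x) * (2 * M) + j"
    using gate_cases[OF q'] by blast
  have "c * T + t + 1 \<le> Suc c * T" using c(2) by simp
  also have "\<dots> \<le> length prog * T" using c by (intro mult_le_mono1) simp
  finally have "(c * T + t + 1) * (height + 2) \<le> length prog * T * (height + 2)" by (rule mult_le_mono1)
  then show "gate_level q \<le> length prog * T * (height + 2)" using gate_level_le[OF c(3,4) qe] by linarith
qed

lemma leaf_inputs: "leaf cm c t x y = GIn i \<Longrightarrow> i < N"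
  by (cases cm) (auto split: if_splits)

lemma leaf_no_random: "leaf cm c t x y \<noteq> GRnd i"
  by (cases cm) auto

lemma gate_at_inputs: "gate_at prog q = GIn i \<Longrightarrow> i < N"
  by (auto simp: gate_at_def Let_def leaf_inputs split: if_splits)

lemma gate_at_no_random: "gate_at prog q \<noteq> GRnd i"
  by (auto simp: gate_at_def Let_def leaf_no_random)

lemma wf_circuit_of:
  assumes "wf_prog prog"
  shows "wf_circuit N r (circuit_of prog)"
  unfolding wf_circuit_def
proof (intro conjI allI impI ballI)
  fix q j assume "q < length (gates (circuit_of prog))" "j \<in> gate_preds (gates (circuit_of prog) ! q)"
  then show "j < q" using gate_preds_level(1)[OF assms] by (simp add: circuit_of_def)
next
  fix i assume "GIn i \<in> set (gates (circuit_of prog))"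
  then show "i < N" using gate_at_inputs by (auto simp: circuit_of_def dest: sym)
next
  fix i assume "GRnd i \<in> set (gates (circuit_of prog))"
  then show "i < r" using gate_at_no_random by (auto simp: circuit_of_def) metis
next
  fix q assume "q \<in> set (outs (circuit_of prog))"
  then obtain j where j: "j < N" "q = res (length prog - 1) j 0" by (auto simp: circuit_of_def)
  have "(length prog - 1) * T + L < length prog * T + 0"
    using assms by (intro row_less) (simp add: wf_prog_def)
  then have "q < size_of prog"
    unfolding j res_def ref_alt by (intro entry_less_size) (use N_less_X j M_pos in auto)
  then show "q < length (gates (circuit_of prog))" by (simp add: circuit_of_def)
qed

section \<open>Values computed by the circuit\<close>

text \<open>Level \<open>a\<close> consists of \<open>2 ^ (h - a)\<close> gates from offset
  \<open>2 * M - 2 * 2 ^ (h - a)\<close> on, and its gate \<open>i\<close> covers the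
  \<open>i\<close>-th block of \<open>2 ^ a\<close> leaves. Level \<open>h\<close> is the
  root.\<close>

lemma or_tree:
  assumes M: "M = 2 ^ h"
    and v: "\<And>j. M \<le> j \<Longrightarrow> j < 2 * M - 1 \<Longrightarrow>
      v (st + j) = (v (st + 2 * (j - M)) \<or> v (st + 2 * (j - M) + 1))"
  shows "a \<le> h \<Longrightarrow> i < 2 ^ (h - a) \<Longrightarrow>
    v (st + (2 * M - 2 * 2 ^ (h - a) + i)) = (\<exists>y. i * 2 ^ a \<le> y \<and> y < (i + 1) * 2 ^ a \<and> v (st + y))"
proof (induction a arbitrary: i)
  case 0
  then show ?case using M by (auto simp: le_less_Suc_eq)
next
  case (Suc a)
  define z :: nat where "z = 2 ^ (h - Suc a)"
  have ha: "2 ^ (h - a) = 2 * z" unfolding z_def using Suc.prems(1)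
    by (metis Suc_diff_Suc Suc_le_lessD power_Suc)
  have zM: "2 * z \<le> M" unfolding ha[symmetric] M by (intro power_increasing) auto
  have z: "i < z" "0 < z" using Suc.prems by (auto simp: z_def)
  let ?j = "2 * M - 2 * z + i"
  have j: "M \<le> ?j" "?j < 2 * M - 1" "2 * (?j - M) = 2 * M - 2 * (2 * z) + 2 * i"
    using zM z by auto
  have "v (st + ?j) = (v (st + (2 * M - 2 * (2 * z) + 2 * i)) \<or> v (st + (2 * M - 2 * (2 * z) + (2 * i + 1))))"
    using v[OF j(1,2)] unfolding j(3) by (simp only: add.assoc)
  also have "\<dots> = ((\<exists>y. (2 * i) * 2 ^ a \<le> y \<and> y < (2 * i + 1) * 2 ^ a \<and> v (st + y)) \<or>
      (\<exists>y. (2 * i + 1) * 2 ^ a \<le> y \<and> y < (2 * i + 1 + 1) * 2 ^ a \<and> v (st + y)))"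
    using Suc.IH[of "2 * i"] Suc.IH[of "2 * i + 1"] Suc.prems(1) z unfolding ha by simp
  also have "\<dots> = (\<exists>y. i * 2 ^ Suc a \<le> y \<and> y < (i + 1) * 2 ^ Suc a \<and> v (st + y))"
  proof -
    have *: "i * 2 ^ Suc a = (2 * i) * 2 ^ a" "(i + 1) * 2 ^ Suc a = (2 * i + 1 + 1) * 2 ^ a"
      by (simp_all add: algebra_simps)
    have mono: "(2 * i) * 2 ^ a \<le> (2 * i + 1) * (2::nat) ^ a" "(2 * i + 1) * 2 ^ a \<le> (2 * i + 1 + 1) * (2::nat) ^ a"
      by (intro mult_le_mono1; simp)+
    show ?thesis unfolding * using mono by (meson le_less_linear less_le_trans order_trans)
  qed
  finally show ?case unfolding z_def .
qed

context
  fixes prog :: "cmd list" and inp :: "bool list" and v :: "nat \<Rightarrow> bool"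
  assumes wf: "wf_prog prog" and inp: "length inp = N"
    and v: "\<And>q. q < size_of prog \<Longrightarrow> v q = gate_sem inp v (gate_at prog q)"
begin

lemma entry_value:
  assumes c: "c < length prog" "t < T" "x < X"
  shows "v (ref (c * T + t) x 0) = (\<exists>y<M. gate_sem inp v (leaf (prog ! c) c t x y))"
    and "v (ref (c * T + t) x 1) = (\<not> v (ref (c * T + t) x 0))"
proof -
  let ?st = "((c * T + t) * X + x) * (2 * M)"
  have "c * T + t < Suc c * T" using c by simp
  also have "\<dots> \<le> length prog * T" using c by (intro mult_le_mono1) simp
  finally have r: "c * T + t < length prog * T" .
  have g: "v (?st + j) = gate_sem inp v
    (if j < M then leaf (prog ! c) c t x j
     else if j < 2 * M - 1 then GOr (?st + 2 * (j - M)) (?st + 2 * (j - M) + 1)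
     else GNot (?st + j - 1))" if "j < 2 * M" for j
    using v[OF entry_less_size[OF c(3) that r]] gate_at_entry[OF c(3) that c(2) refl, of prog c] by simp
  have "v (?st + (2 * M - 2 * 2 ^ (height - height) + 0)) =
      (\<exists>y. 0 * 2 ^ height \<le> y \<and> y < (0 + 1) * 2 ^ height \<and> v (?st + y))"
    by (rule or_tree) (use g in \<open>auto simp: M_power2 height_def\<close>)
  then have "v (?st + (2 * M - 2)) = (\<exists>y<M. v (?st + y))"
    by (simp add: M_power2 height_def)
  also have "\<dots> = (\<exists>y<M. gate_sem inp v (leaf (prog ! c) c t x y))"
    using g by (intro ex_cong1) auto
  finally show "v (ref (c * T + t) x 0) = (\<exists>y<M. gate_sem inp v (leaf (prog ! c) c t x y))"
    by (simp add: ref_def)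
  have "\<not> 2 * M - 1 < M" "?st + (2 * M - 1) - 1 = ?st + (2 * M - 2)" "2 * M - 1 < 2 * M"
    using M_pos by auto
  then have "v (?st + (2 * M - 1)) = (\<not> v (?st + (2 * M - 2)))"
    using g[of "2 * M - 1"] by (simp only: if_False less_irrefl gate_sem.simps)
  moreover have "ref (c * T + t) x 1 = ?st + (2 * M - 1)" "ref (c * T + t) x 0 = ?st + (2 * M - 2)"
    using M_pos by (simp_all add: ref_def)
  ultimately show "v (ref (c * T + t) x 1) = (\<not> v (ref (c * T + t) x 0))"
    by (simp only:)
qed

lemma L_less_T: "L < T" by (simp add: T_def)

lemma res_value:
  assumes "c < length prog" "x < X"
  shows "v (res c x 0) = (\<exists>y<M. gate_sem inp v (leaf (prog ! c) c L x y))"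
    and "v (res c x (Suc 0)) = (\<not> v (res c x 0))"
  using entry_value[OF assms(1) L_less_T assms(2)] by (simp_all add: res_def)

text \<open>For closures: the edge relation is read off after both digits \<open>i\<close> and
  \<open>j\<close> have been overwritten, so moving to a midpoint does not change it.\<close>

lemma upd_upd: 
  assumes "x < X" "i < k" "j < k" "i \<noteq> j" "a < M" "b < M" "y < M"
  shows "upd (upd (upd x i y) i a) j b = upd (upd x i a) j b"
    and "upd (upd (upd x j y) i a) j b = upd (upd x i a) j b"
  by (rule dig_ext; use assms in \<open>auto simp: upd_less dig_upd\<close>)+

text \<open>The squaring step. A path of length \<open>n\<close> is cut after \<open>min n z\<close>
  steps, and the cut point is \<open>p\<close> or the target of an edge, hence below
  \<open>M\<close>.\<close>

lemma relpow_split: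
  assumes R: "R \<subseteq> {..<M} \<times> {..<M}" and p: "p < M"
  shows "(\<exists>n\<le>z + z. (p, q) \<in> R ^^ n) =
    (\<exists>y<M. (\<exists>n\<le>z. (p, y) \<in> R ^^ n) \<and> (\<exists>n\<le>z. (y, q) \<in> R ^^ n))"
proof
  assume "\<exists>n\<le>z + z. (p, q) \<in> R ^^ n"
  then obtain n where n: "n \<le> z + z" "(p, q) \<in> R ^^ n" by blast
  define n1 where "n1 = min n z"
  define n2 where "n2 = n - n1"
  have n12: "n = n1 + n2" "n1 \<le> z" "n2 \<le> z" using n(1) by (auto simp: n1_def n2_def)
  then obtain y where y: "(p, y) \<in> R ^^ n1" "(y, q) \<in> R ^^ n2" using n(2) by (auto simp: relpow_add)
  have "y < M"
  proof (cases n1)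
    case 0
    then show ?thesis using y p by simp
  next
    case (Suc n')
    then show ?thesis using y R by (auto elim: relpow_Suc_E)
  qed
  then show "\<exists>y<M. (\<exists>n\<le>z. (p, y) \<in> R ^^ n) \<and> (\<exists>n\<le>z. (y, q) \<in> R ^^ n)" using y n12 by blast
next
  assume "\<exists>y<M. (\<exists>n\<le>z. (p, y) \<in> R ^^ n) \<and> (\<exists>n\<le>z. (y, q) \<in> R ^^ n)"
  then obtain y n1 n2 where "n1 \<le> z" "n2 \<le> z" "(p, y) \<in> R ^^ n1" "(y, q) \<in> R ^^ n2" by blast
  then have "n1 + n2 \<le> z + z" "(p, q) \<in> R ^^ (n1 + n2)" by (auto simp: relpow_add)
  then show "\<exists>n\<le>z + z. (p, q) \<in> R ^^ n" by blast
qed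

lemma TC_row_value:
  assumes c: "c < length prog" "prog ! c = CTC i j a" and t: "t < T" and x: "x < X"
  shows "v (ref (c * T + t) x 0) = (\<exists>n\<le>2 ^ t. (dig x i, dig x j) \<in>
    {(p, q). p < M \<and> q < M \<and> v (res a (upd (upd x i p) j q) 0)} ^^ n)"
  using t x
proof (induction t arbitrary: x)
  have ij: "i < k" "j < k" "i \<noteq> j" "a < c" using wf c by (auto simp: wf_prog_def dest!: spec[of _ c])
  {
    case 0
    have "(\<exists>n\<le>2 ^ 0. (p, q) \<in> R ^^ n) = (p = q \<or> (p, q) \<in> R)" for p q :: nat and R
      by (auto simp: le_Suc_eq intro: exI[of _ "0::nat"] exI[of _ "1::nat"])
    moreover have "upd (upd x i (dig x i)) j (dig x j) = x" by (simp add: upd_dig)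
    ultimately show ?case
      using entry_value(1)[OF c(1) 0] c M_pos by (auto simp: dig_less)
  next
    case (Suc t)
    let ?R = "\<lambda>x. {(p, q). p < M \<and> q < M \<and> v (res a (upd (upd x i p) j q) 0)}"
    have R: "?R (upd x i y) = ?R x" "?R (upd x j y) = ?R x" if "y < M" for y
      using upd_upd[OF Suc.prems(2) ij(1-3) _ _ that] by auto
    have "v (ref (c * T + Suc t) x 0) =
       (\<exists>y<M. v (ref (c * T + t) (upd x j y) 0) \<and> v (ref (c * T + t) (upd x i y) 0))"
      using entry_value(1)[OF c(1) Suc.prems] c by simp
    also have "\<dots> = (\<exists>y<M. (\<exists>n\<le>2 ^ t. (dig x i, y) \<in> ?R x ^^ n) \<and> (\<exists>n\<le>2 ^ t. (y, dig x j) \<in> ?R x ^^ n))"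
    proof (rule ex_cong1, rule conj_cong[OF refl])
      fix y assume y: "y < M"
      have ul: "upd x i y < X" "upd x j y < X" using upd_less Suc.prems y ij by auto
      show "(v (ref (c * T + t) (upd x j y) 0) \<and> v (ref (c * T + t) (upd x i y) 0)) =
        ((\<exists>n\<le>2 ^ t. (dig x i, y) \<in> ?R x ^^ n) \<and> (\<exists>n\<le>2 ^ t. (y, dig x j) \<in> ?R x ^^ n))"
        using Suc.IH[OF _ ul(1)] Suc.IH[OF _ ul(2)] Suc.prems(1) ij(3)
        unfolding R[OF y] by (simp add: dig_upd[OF y])
    qed
    also have "\<dots> = (\<exists>n\<le>2 ^ t + 2 ^ t. (dig x i, dig x j) \<in> ?R x ^^ n)"
      by (rule relpow_split[symmetric]) (auto simp: dig_less)
    finally show ?case by (simp add: mult_2)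
  }
qed

lemma TC_value:
  assumes c: "c < length prog" "prog ! c = CTC i j a" and x: "x < X"
  shows "v (res c x 0) = ((dig x i, dig x j) \<in>
    {(p, q). p < M \<and> q < M \<and> v (res a (upd (upd x i p) j q) 0)}\<^sup>*)" (is "_ = (_ \<in> ?R\<^sup>*)")
proof -
  have sub: "?R \<subseteq> {..<M} \<times> {..<M}" by auto
  then have fin: "finite ?R" by (rule finite_subset) simp
  have "card ?R \<le> 2 ^ L" using card_mono[OF _ sub] by (simp add: two_power_L)
  then have "((p, q) \<in> ?R\<^sup>*) = (\<exists>n\<le>2 ^ L. (p, q) \<in> ?R ^^ n)" for p q
    using rtrancl_finite_eq_relpow[OF fin] by (auto intro: relpow_imp_rtrancl order_trans)
  then show ?thesis using TC_row_value[OF c L_less_T x] by (simp add: res_def)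
qed

lemma code_at_last:
  assumes "code_at prog b (cs @ [cm])"
  shows "code_at prog b cs" "b + length cs < length prog" "prog ! (b + length cs) = cm"
  using assms by (auto simp: code_at_append code_at_Cons)

lemma comp_value:
  "code_at prog b (comp f b) \<Longrightarrow> wff k f \<Longrightarrow> x < X \<Longrightarrow>
    v (res (b + length (comp f b) - 1) x 0) = fsem M inp f (env x)"
proof (induction f arbitrary: b x)
  case (Rel e)
  then show ?case using M_pos by (auto simp: code_at_Cons res_value)
next
  case (Inp e)
  then show ?case using M_pos inp by (auto simp: code_at_Cons res_value)
next
  case (Neg f)
  let ?cs = "comp f b"
  note c = code_at_last[OF Neg.prems(1)[unfolded comp.simps Let_def]]
  have "b + length ?cs - 1 < length prog" using c by simp
  then have "v (res (b + length ?cs) x 0) = (\<not> v (res (b + length ?cs - 1) x 0))"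
    using res_value(1)[OF c(2) Neg.prems(3)] res_value(2)[of "b + length ?cs - 1" x] c(3) Neg.prems(3) M_pos
    by auto
  then show ?case using Neg.IH[OF c(1)] Neg.prems by (simp add: Let_def)
next
  case (Conj f g)
  let ?cs = "comp f b"
  let ?ds = "comp g (b + length ?cs)"
  have "code_at prog b ((?cs @ ?ds) @ [CConj (b + length ?cs - 1) (b + length ?cs + length ?ds - 1)])"
    using Conj.prems(1) by (simp add: Let_def)
  note c = code_at_last[OF this]
  have cs: "code_at prog b ?cs" "code_at prog (b + length ?cs) ?ds" using c(1) by (auto simp: code_at_append)
  have "v (res (b + length ?cs - 1) x 0) = fsem M inp f (env x)"
    "v (res (b + length ?cs + length ?ds - 1) x 0) = fsem M inp g (env x)"
    using Conj.IH(1)[OF cs(1) _ Conj.prems(3)] Conj.IH(2)[OF cs(2) _ Conj.prems(3)] Conj.prems(2) by auto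
  moreover have "v (res (b + length ?cs + length ?ds) x 0) =
      (v (res (b + length ?cs - 1) x 0) \<and> v (res (b + length ?cs + length ?ds - 1) x 0))"
    using res_value(1)[OF _ Conj.prems(3), of "b + length ?cs + length ?ds"] c(2,3) M_pos
    by (auto simp: add.assoc)
  ultimately show ?case by (simp add: Let_def add.assoc)
next
  case (Ex i f)
  note c = code_at_last[OF Ex.prems(1)[unfolded comp.simps Let_def]]
  have i: "3 \<le> i" "i - 3 < k" "wff k f" using Ex.prems by auto
  have "v (res (b + length (comp f b)) x 0) = (\<exists>y<M. fsem M inp f ((env x)(i := y)))"
  proof -
    have "v (res (b + length (comp f b) - 1) (upd x (i - 3) y) 0) = fsem M inp f ((env x)(i := y))"
      if "y < M" for y
      using Ex.IH[OF c(1) i(3) upd_less[OF Ex.prems(3) that i(2)]] env_upd[OF that i(1)] by (simp only:)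
    then show ?thesis using res_value(1)[OF c(2) Ex.prems(3)] unfolding c(3) by (simp cong: conj_cong)
  qed
  then show ?case by (simp add: Let_def)
next
  case (Sbst i e f)
  note c = code_at_last[OF Sbst.prems(1)[unfolded comp.simps Let_def]]
  have i: "3 \<le> i" "i - 3 < k" "wff k f" using Sbst.prems by auto
  have "v (res (b + length (comp f b)) x 0) = fsem M inp (Sbst i e f) (env x)"
  proof -
    have "v (res (b + length (comp f b) - 1) (upd x (i - 3) y) 0) = fsem M inp f ((env x)(i := y))"
      if "y < M" for y
      using Sbst.IH[OF c(1) i(3) upd_less[OF Sbst.prems(3) that i(2)]] env_upd[OF that i(1)] by (simp only:)
    then show ?thesis using res_value(1)[OF c(2) Sbst.prems(3)] M_pos unfolding c(3) by auto
  qed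
  then show ?case by (simp add: Let_def)
next
  case (TC i j f)
  note c = code_at_last[OF TC.prems(1)[unfolded comp.simps Let_def]]
  have i: "3 \<le> i" "i - 3 < k" "3 \<le> j" "j - 3 < k" "wff k f" using TC.prems by auto
  have "{(p, q). p < M \<and> q < M \<and> v (res (b + length (comp f b) - 1) (upd (upd x (i - 3) p) (j - 3) q) 0)} =
     {(p, q). p < M \<and> q < M \<and> fsem M inp f ((env x)(i := p, j := q))}"
  proof -
    have "v (res (b + length (comp f b) - 1) (upd (upd x (i - 3) p) (j - 3) q) 0) =
        fsem M inp f ((env x)(i := p, j := q))" if "p < M" "q < M" for p q
      using TC.IH[OF c(1) i(5) upd_less[OF upd_less[OF TC.prems(3) that(1) i(2)] that(2) i(4)]]
        env_upd[OF that(1) i(1)] env_upd[OF that(2) i(3)] by (simp only:)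
    then show ?thesis by blast
  qed
  then have "v (res (b + length (comp f b)) x 0) = fsem M inp (TC i j f) (env x)"
    using TC_value[OF c(2,3) TC.prems(3)] i by (simp add: env_def)
  then show ?case by (simp add: Let_def)
qed

end

lemma run_circuit_of:
  assumes f: "wff k f" and inp: "length inp = N"
  shows "run_circuit (circuit_of (comp f 0)) inp \<rho> = map (\<lambda>j. fsem M inp f (env j)) [0..<N]"
proof -
  let ?prog = "comp f 0"
  have wf: "wf_prog ?prog"
    unfolding wf_prog_def using comp_wf[OF f, of _ 0] comp_length by auto
  have g: "length (gates (circuit_of ?prog)) = size_of ?prog"
    "\<And>q. q < size_of ?prog \<Longrightarrow> gates (circuit_of ?prog) ! q = gate_at ?prog q"
    by (auto simp: circuit_of_def)
  have preds: "j < q" if "q < length (gates (circuit_of ?prog))" "j \<in> gate_preds (gates (circuit_of ?prog) ! q)" for q j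
    using gate_preds_level(1)[OF wf] that g by auto
  have norand: "GRnd i \<notin> set (gates (circuit_of ?prog))" for i
    using gate_at_no_random by (auto simp: circuit_of_def) metis
  obtain v where r: "run_circuit (circuit_of ?prog) inp \<rho> = map v (outs (circuit_of ?prog))"
    and v: "\<And>q. q < length (gates (circuit_of ?prog)) \<Longrightarrow> v q = gate_sem inp v (gates (circuit_of ?prog) ! q)"
    using run_circuit_sem[OF preds norand] by blast
  have "v (res (length ?prog - 1) j 0) = fsem M inp f (env j)" if "j < N" for j
    using comp_value[OF wf inp, of v 0 f j] v g f that N_less_X by (auto simp: code_at_def)
  then show ?thesis unfolding r by (simp add: circuit_of_def)
qed

end

section \<open>Case distinctions as arithmetic expressions\<close>

fun pw :: "aexp \<Rightarrow> nat \<Rightarrow> aexp" where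
  "pw a 0 = Cst 1"
| "pw a (Suc n) = Mul a (pw a n)"

text \<open>Truncated subtraction supplies the truth values: \<open>1 - (1 - a)\<close> indicates
  \<open>a \<noteq> 0\<close>, and \<open>1 - ((a - b) + (b - a))\<close> indicates
  equality.\<close>

definition "nz a = Sub (Cst 1) (Sub (Cst 1) a)"
definition "ite c a b = Add (Mul (nz c) a) (Mul (Sub (Cst 1) (nz c)) b)"
definition "eq_e a b = Sub (Cst 1) (Add (Sub a b) (Sub b a))"
definition "less_e a b = nz (Sub b a)"
definition "mod_e a b = Sub a (Mul (Div a b) b)"

lemma aval_pw [simp]: "aval (pw a n) s = aval a s ^ n"
  by (induction n) auto
lemma aval_nz [simp]: "aval (nz a) s = of_bool (aval a s \<noteq> 0)"
  by (auto simp: nz_def)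
lemma aval_ite [simp]: "aval (ite c a b) s = (if aval c s \<noteq> 0 then aval a s else aval b s)"
  by (simp add: ite_def)
lemma aval_eq_e [simp]: "aval (eq_e a b) s = of_bool (aval a s = aval b s)"
  by (auto simp: eq_e_def)
lemma aval_less_e [simp]: "aval (less_e a b) s = of_bool (aval a s < aval b s)"
  by (auto simp: less_e_def)
lemma aval_mod_e [simp]: "aval (mod_e a b) s = aval a s mod aval b s"
  by (simp add: mod_e_def minus_div_mult_eq_mod)

lemma vars_below_combinators [simp]:
  "vars_below d (pw a n) \<longleftrightarrow> n = 0 \<or> vars_below d a"
  "vars_below d (nz a) = vars_below d a"
  "vars_below d (ite c a b) = (vars_below d c \<and> vars_below d a \<and> vars_below d b)"
  "vars_below d (eq_e a b) = (vars_below d a \<and> vars_below d b)"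
  "vars_below d (less_e a b) = (vars_below d a \<and> vars_below d b)"
  "vars_below d (mod_e a b) = (vars_below d a \<and> vars_below d b)"
  by (induction n) (auto simp: nz_def ite_def eq_e_def less_e_def mod_e_def)

fun asubst :: "(nat \<Rightarrow> aexp) \<Rightarrow> aexp \<Rightarrow> aexp" where
  "asubst h (Var i) = h i"
| "asubst h (Cst c) = Cst c"
| "asubst h (Add a b) = Add (asubst h a) (asubst h b)"
| "asubst h (Sub a b) = Sub (asubst h a) (asubst h b)"
| "asubst h (Mul a b) = Mul (asubst h a) (asubst h b)"
| "asubst h (Div a b) = Div (asubst h a) (asubst h b)"

lemma aval_asubst: "aval (asubst h a) s = aval a (\<lambda>i. aval (h i) s)"
  by (induction a) auto

lemma vars_below_asubst: "(\<And>i. vars_below d (h i)) \<Longrightarrow> vars_below d (asubst h a)"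
  by (induction a) auto

type_synonym triple = "aexp \<times> aexp \<times> aexp"

fun tval :: "triple \<Rightarrow> (nat \<Rightarrow> nat) \<Rightarrow> nat list" where
  "tval (a, b, c) s = [aval a s, aval b s, aval c s]"

fun tvars :: "nat \<Rightarrow> triple \<Rightarrow> bool" where
  "tvars d (a, b, c) = (vars_below d a \<and> vars_below d b \<and> vars_below d c)"

fun ite3 :: "aexp \<Rightarrow> triple \<Rightarrow> triple \<Rightarrow> triple" where
  "ite3 c (a1, a2, a3) (b1, b2, b3) = (ite c a1 b1, ite c a2 b2, ite c a3 b3)"

lemma tval_ite3 [simp]: "tval (ite3 c A B) s = (if aval c s \<noteq> 0 then tval A s else tval B s)"
  by (cases A; cases B) auto
lemma tvars_ite3 [simp]: "tvars d (ite3 c A B) = (vars_below d c \<and> tvars d A \<and> tvars d B)"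
  by (cases A; cases B) auto

section \<open>Gate codes as arithmetic expressions in the gate number\<close>

context
  fixes m k :: nat
begin

definition "M_e = pw (Var 2) m"
definition "X_e = pw M_e k"
definition "L_e = Mul (Cst (2 * m)) (Var 1)"
definition "T_e = Add L_e (Cst 1)"
definition "dig_e x i = mod_e (Div x (pw M_e i)) M_e"
definition "upd_e x i y = Add (Sub x (Mul (dig_e x i) (pw M_e i))) (Mul y (pw M_e i))"
definition "ref_e r x s = Add (Add (Mul (Add (Mul r X_e) x) (Mul (Cst 2) M_e))
   (Sub (Mul (Cst 2) M_e) (Cst 2))) (Cst s)"
definition "res_e c x s = ref_e (Add (Mul (Cst c) T_e) L_e) x s"
definition "env_e x i = (if i < 3 then Var i else dig_e x (i - 3))"
definition "size_e nc = Mul (Mul (Mul (Cst nc) T_e) X_e) (Mul (Cst 2) M_e)"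

definition "and_e p q = (Cst 4, p, q)"
definition "const_e b = (Cst 0, b, Cst 0)"

fun leaf_e :: "cmd \<Rightarrow> nat \<Rightarrow> aexp \<Rightarrow> aexp \<Rightarrow> aexp \<Rightarrow> triple" where
  "leaf_e (CRel e) c t x y = const_e (nz (asubst (env_e x) e))"
| "leaf_e (CInp e) c t x y =
    ite3 (less_e (asubst (env_e x) e) (Var 0)) (Cst 1, asubst (env_e x) e, Cst 0) (const_e (Cst 0))"
| "leaf_e (CNeg a) c t x y = and_e (res_e a x 1) (res_e a x 1)"
| "leaf_e (CConj a b) c t x y = and_e (res_e a x 0) (res_e b x 0)"
| "leaf_e (CEx i a) c t x y = and_e (res_e a (upd_e x i y) 0) (res_e a (upd_e x i y) 0)"
| "leaf_e (CSbst i e a) c t x y =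
    ite3 (less_e (asubst (env_e x) e) M_e)
     (and_e (res_e a (upd_e x i (asubst (env_e x) e)) 0) (res_e a (upd_e x i (asubst (env_e x) e)) 0))
     (const_e (Cst 0))"
| "leaf_e (CTC i j a) c t x y =
    ite3 t
     (and_e (ref_e (Sub (Add (Mul (Cst c) T_e) t) (Cst 1)) (upd_e x j y) 0)
            (ref_e (Sub (Add (Mul (Cst c) T_e) t) (Cst 1)) (upd_e x i y) 0))
     (ite3 (eq_e (dig_e x i) (dig_e x j)) (const_e (Cst 1)) (and_e (res_e a x 0) (res_e a x 0)))"

text \<open>The program does not depend on \<open>N\<close>, so a chain of case distinctions over
  its commands is a single fixed expression.\<close>

fun select_e :: "aexp \<Rightarrow> aexp \<Rightarrow> aexp \<Rightarrow> aexp \<Rightarrow> nat \<Rightarrow> cmd list \<Rightarrow> triple" where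
  "select_e ce t x y b [] = const_e (Cst 0)"
| "select_e ce t x y b (cm # cms) = ite3 (eq_e ce (Cst b)) (leaf_e cm b t x y) (select_e ce t x y (Suc b) cms)"

text \<open>Numbers from the size of the circuit on stand for the entries of the output list, which
  carry the code 6.\<close>

definition table_e :: "cmd list \<Rightarrow> triple" where
  "table_e prog =
    (let q = Var 3; w = Mul (Cst 2) M_e; j = mod_e q w; e = Div q w; x = mod_e e X_e; r = Div e X_e;
         ch = Add (Sub q j) (Mul (Cst 2) (Sub j M_e))
     in ite3 (less_e q (size_e (length prog)))
         (ite3 (less_e j M_e) (select_e (Div r T_e) (mod_e r T_e) x j 0 prog)
           (ite3 (less_e j (Sub w (Cst 1))) (Cst 5, ch, Add ch (Cst 1)) (Cst 3, Sub q (Cst 1), Cst 0)))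
         (Cst 6, res_e (length prog - 1) (Sub q (size_e (length prog))) 0, Cst 0))"

lemma vars_below_layout [simp]:
  "2 < d \<Longrightarrow> vars_below d M_e" "2 < d \<Longrightarrow> vars_below d X_e" "2 < d \<Longrightarrow> vars_below d L_e"
  "2 < d \<Longrightarrow> vars_below d T_e" "2 < d \<Longrightarrow> vars_below d x \<Longrightarrow> vars_below d (dig_e x i)"
  "2 < d \<Longrightarrow> vars_below d x \<Longrightarrow> vars_below d y \<Longrightarrow> vars_below d (upd_e x i y)"
  "2 < d \<Longrightarrow> vars_below d r \<Longrightarrow> vars_below d x \<Longrightarrow> vars_below d (ref_e r x s)"
  "2 < d \<Longrightarrow> vars_below d x \<Longrightarrow> vars_below d (res_e c x s)"
  "2 < d \<Longrightarrow> vars_below d x \<Longrightarrow> vars_below d (env_e x i)"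
  "2 < d \<Longrightarrow> vars_below d (size_e c)"
  by (simp_all add: M_e_def X_e_def L_e_def T_e_def dig_e_def upd_e_def ref_e_def res_e_def env_e_def
      size_e_def)

lemma tvars_leaf_e:
  assumes "2 < d" "vars_below d t" "vars_below d x" "vars_below d y"
  shows "tvars d (leaf_e cm c t x y)"
proof -
  have "vars_below d (asubst (env_e x) e)" for e using assms by (intro vars_below_asubst) simp
  then show ?thesis using assms by (cases cm) (auto simp: const_e_def and_e_def)
qed

lemma tvars_select_e:
  assumes "2 < d" "vars_below d ce" "vars_below d t" "vars_below d x" "vars_below d y"
  shows "tvars d (select_e ce t x y b cms)"
  using assms by (induction cms arbitrary: b) (auto simp: const_e_def tvars_leaf_e)

lemma tvars_table_e: "tvars 4 (table_e prog)"
  unfolding table_e_def Let_def by (simp add: tvars_select_e)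

end

context layout
begin

lemma aval_layout [simp]:
  "aval (M_e m) (table_env N q) = M" "aval (X_e m k) (table_env N q) = X"
  "aval (L_e m) (table_env N q) = L" "aval (T_e m) (table_env N q) = T"
  "aval (dig_e m x i) (table_env N q) = dig (aval x (table_env N q)) i"
  "aval (upd_e m x i y) (table_env N q) = upd (aval x (table_env N q)) i (aval y (table_env N q))"
  "aval (ref_e m k r x s) (table_env N q) = ref (aval r (table_env N q)) (aval x (table_env N q)) s"
  "aval (res_e m k c x s) (table_env N q) = res c (aval x (table_env N q)) s"
  by (simp_all add: M_e_def X_e_def L_e_def T_e_def dig_e_def upd_e_def ref_e_def res_e_def
      M_def X_def L_def T_def dig_def upd_def ref_def res_def table_env_def)

lemma aval_size_e [simp]: "aval (size_e m k (length prog)) (table_env N q) = size_of prog"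
  by (simp add: size_e_def size_of_def)

lemma aval_env_e [simp]: "aval (asubst (env_e m x) e) (table_env N q) = aval e (env (aval x (table_env N q)))"
proof -
  have "(\<lambda>i. aval (env_e m x i) (table_env N q)) = env (aval x (table_env N q))"
    by (auto simp: fun_eq_iff env_e_def env_def) (auto simp: table_env_def)
  then show ?thesis by (simp add: aval_asubst)
qed

lemma table_env_0: "table_env N q 0 = N"
  by (simp add: table_env_def)

lemma table_env_3: "table_env N q 3 = q"
  by (simp add: table_env_def)

lemma tval_leaf_e:
  "tval (leaf_e m k cm c t x y) (table_env N q) =
    gate_code (leaf cm c (aval t (table_env N q)) (aval x (table_env N q)) (aval y (table_env N q)))"
  by (cases cm) (auto simp: const_e_def and_e_def table_env_0 simp del: asubst.simps)

lemma tval_select_e: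
  assumes "b \<le> aval ce (table_env N q)" "aval ce (table_env N q) < b + length cms"
  shows "tval (select_e m k ce t x y b cms) (table_env N q) =
    gate_code (leaf (cms ! (aval ce (table_env N q) - b)) (aval ce (table_env N q))
      (aval t (table_env N q)) (aval x (table_env N q)) (aval y (table_env N q)))"
  using assms
proof (induction cms arbitrary: b)
  case (Cons cm cms)
  show ?case
  proof (cases "aval ce (table_env N q) = b")
    case False
    then have "aval ce (table_env N q) - b = Suc (aval ce (table_env N q) - Suc b)" using Cons.prems by simp
    with False Cons show ?thesis by simp
  qed (simp add: tval_leaf_e)
qed simp

lemma tval_table_e:
  "tval (table_e m k prog) (table_env N q) =
    (if q < size_of prog then gate_code (gate_at prog q)
     else [6, res (length prog - 1) (q - size_of prog) 0, 0])"
proof (cases "q < size_of prog")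
  case True
  then have "q div (2 * M) < length prog * T * X"
    using M_pos by (simp add: size_of_def less_mult_imp_div_less)
  then have "q div (2 * M) div X div T < length prog" by (simp add: less_mult_imp_div_less)
  then show ?thesis using True
    by (simp add: table_e_def Let_def gate_at_def table_env_3 tval_select_e)
next
  case False
  then show ?thesis
    by (simp add: table_e_def Let_def table_env_3)
qed

lemma triple_at_table_e:
  assumes "table_e m k prog = (E1, E2, E3)"
  shows "triple_at E1 E2 E3 N q = (if q < size_of prog then gate_code (gate_at prog q)
     else [6, res (length prog - 1) (q - size_of prog) 0, 0])"
  using tval_table_e[of prog q] assms by (simp add: triple_at_def)

lemma circuit_code_circuit_of:
  assumes "table_e m k prog = (E1, E2, E3)"
  shows "circuit_code (circuit_of prog) =
    concat (map (triple_at E1 E2 E3 N) [0..<aval (Add (size_e m k (length prog)) (Var 0)) (table_env N 0)])"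
proof -
  have s: "aval (Add (size_e m k (length prog)) (Var 0)) (table_env N 0) = size_of prog + N"
    by (simp only: aval.simps aval_size_e) (simp add: table_env_def)
  have u: "[0..<size_of prog + N] = [0..<size_of prog] @ map (\<lambda>j. j + size_of prog) [0..<N]"
    using upt_add_eq_append[of 0 "size_of prog" N] by (simp add: map_add_upt add.commute)
  have t: "map (triple_at E1 E2 E3 N) [0..<size_of prog] = map (\<lambda>q. gate_code (gate_at prog q)) [0..<size_of prog]"
    by (intro map_cong) (auto simp: triple_at_table_e[OF assms])
  show ?thesis unfolding s u map_append concat_append t
    by (simp add: circuit_code_def circuit_of_def triple_at_table_e[OF assms] o_def)
qed

end

text \<open>The length of the program is a constant; each command has \<open>O(log N)\<close> rows,
  and a row has depth \<open>O(log N)\<close>.\<close>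

theorem formula_circuits_RNC2:
  assumes "wff k f" "0 < k" "0 < m"
  shows "RNC2_algorithm (\<lambda>_. 0) (\<lambda>N. layout.circuit_of N m k (comp f 0))"
proof -
  have lay: "layout m k" using assms by (simp add: layout_def)
  let ?prog = "comp f 0"
  let ?C = "\<lambda>N. layout.circuit_of N m k ?prog"
  have wf: "layout.wf_prog k ?prog"
    unfolding layout.wf_prog_def[OF lay] using comp_wf[OF assms(1), of _ 0] comp_length by auto
  obtain E1 E2 E3 where E: "table_e m k ?prog = (E1, E2, E3)" by (cases "table_e m k ?prog") auto
  let ?S = "Add (size_e m k (length ?prog)) (Var 0)"
  have "logspace_uniform ?C"
    unfolding logspace_uniform_def layout.circuit_code_circuit_of[OF lay E]
    using table_in_logspace[of ?S E1 E2 E3] tvars_table_e[of m k ?prog] unfolding E by auto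
  moreover have "poly_bounded (\<lambda>N. circuit_size (?C N))"
  proof (rule poly_bounded_polyf, rule polyf_mono)
    show "polyf (\<lambda>N. abound ?S (2 * N + 1))"
      by (intro polyf_abound polyf_add polyf_mult polyf_const polyf_id)
    show "circuit_size (?C N) \<le> abound ?S (2 * N + 1)" for N
    proof -
      have "circuit_size (?C N) = aval ?S (table_env N 0)"
        by (simp add: circuit_size_def layout.circuit_of_def[OF lay] layout.aval_size_e[OF lay] del: length_greater_0_conv)
          (simp add: table_env_def)
      also have "\<dots> \<le> abound ?S (2 * N + 1)"
        by (rule aval_le_abound[of 3])
          (use two_power_lg_le[of N] lg_le[of N] in \<open>auto simp: table_env_def\<close>)
      finally show ?thesis .
    qed
  qed
  moreover have "(\<lambda>N. real (circuit_depth (?C N))) \<in> O(\<lambda>N. (ln (real N))\<^sup>2)"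
  proof -
    have lgO: "(\<lambda>N. real (lg N)) \<in> O(\<lambda>N. ln (real N))"
    proof (rule landau_o.big_trans)
      show "(\<lambda>N. real (lg N)) \<in> O(\<lambda>N. real (floorlog 2 N))"
        using lg_le_floorlog by (intro landau_o.big_mono always_eventually) auto
      show "(\<lambda>N. real (floorlog 2 N)) \<in> O(\<lambda>N. ln (real N))" by (rule floorlog_polyf[OF polyf_id])
    qed
    have cO: "(\<lambda>N::nat. c) \<in> O(\<lambda>N. ln (real N))" for c :: real by real_asymp
    have fO: "(\<lambda>N. a * real (lg N) + c) \<in> O(\<lambda>N. ln (real N))" for a c :: real
      using lgO cO by (intro sum_in_bigo) auto
    let ?g = "\<lambda>N. real (length ?prog) * ((real (2 * m) * real (lg N) + 1) * (real m * real (lg N) + 2))"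
    have "(\<lambda>N. real (circuit_depth (?C N))) \<in> O(?g)"
    proof (intro landau_o.big_mono always_eventually allI)
      fix N
      have "circuit_depth (?C N) \<le> length ?prog * layout.T N m * (layout.height N m + 2)"
        by (rule layout.depth_circuit_of[OF lay wf])
      also have "\<dots> = length ?prog * (2 * m * lg N + 1) * (m * lg N + 2)"
        by (simp add: layout.T_def[OF lay] layout.L_def[OF lay] layout.height_def[OF lay])
      finally have "real (circuit_depth (?C N)) \<le> real (length ?prog * (2 * m * lg N + 1) * (m * lg N + 2))"
        by (simp only: of_nat_le_iff)
      also have "\<dots> = ?g N" by (simp add: algebra_simps)
      finally have "real (circuit_depth (?C N)) \<le> ?g N" .
      then show "norm (real (circuit_depth (?C N))) \<le> norm (?g N)" by simp
    qed
    also have "?g \<in> O(\<lambda>N. ln (real N) * ln (real N))"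
    proof -
      have "(\<lambda>N. real (2 * m) * real (lg N) + 1) \<in> O(\<lambda>N. ln (real N))" "(\<lambda>N. real m * real (lg N) + 2) \<in> O(\<lambda>N. ln (real N))"
        by (rule fO)+
      then have "(\<lambda>N. (real (2 * m) * real (lg N) + 1) * (real m * real (lg N) + 2)) \<in> O(\<lambda>N. ln (real N) * ln (real N))"
        by (rule landau_o.big_mult)
      then show ?thesis by (cases "length ?prog = 0") (simp_all del: of_nat_mult)
    qed
    finally show ?thesis by (simp add: power2_eq_square)
  qed
  ultimately show ?thesis
    unfolding RNC2_algorithm_def using layout.wf_circuit_of[OF lay wf] by (auto intro: poly_bounded_polyf polyf_const)
qed

section \<open>Walks and trees\<close>

fun walk :: "nat set set \<Rightarrow> nat list \<Rightarrow> bool" where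
  "walk E [] = False"
| "walk E [v] = True"
| "walk E (u # v # p) = ({u, v} \<in> E \<and> walk E (v # p))"

fun wt :: "(nat set \<Rightarrow> nat) \<Rightarrow> nat list \<Rightarrow> nat" where
  "wt w (u # v # p) = w {u, v} + wt w (v # p)"
| "wt w _ = 0"

lemma walk_iff: "walk E p \<longleftrightarrow> p \<noteq> [] \<and> (\<forall>i. Suc i < length p \<longrightarrow> {p ! i, p ! Suc i} \<in> E)"
proof (induction E p rule: walk.induct)
  case (3 E u v p)
  have "(\<forall>i. Suc i < length (u # v # p) \<longrightarrow> {(u # v # p) ! i, (u # v # p) ! Suc i} \<in> E) \<longleftrightarrow>
    {u, v} \<in> E \<and> (\<forall>i. Suc i < length (v # p) \<longrightarrow> {(v # p) ! i, (v # p) ! Suc i} \<in> E)"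
    (is "?l = ?r")
  proof
    assume ?l
    from this[rule_format, of 0] this[rule_format, of "Suc _"] show ?r by auto
  next
    assume r: ?r
    show ?l
    proof (intro allI impI)
      fix i assume "Suc i < length (u # v # p)"
      then show "{(u # v # p) ! i, (u # v # p) ! Suc i} \<in> E" using r by (cases i) auto
    qed
  qed
  then show ?case using 3 by simp
qed auto

lemma path_weight_eq_wt: "path_weight w p = wt w p"
proof (induction w p rule: wt.induct)
  case (1 w u v p)
  then show ?case by (simp add: path_weight_def lessThan_Suc_eq_insert_0 sum.reindex del: sum.lessThan_Suc)
qed (auto simp: path_weight_def)

lemma simple_path_iff: "simple_path E u p v \<longleftrightarrow> walk E p \<and> distinct p \<and> hd p = u \<and> last p = v"
  by (auto simp: simple_path_def walk_iff)

lemma walk_mono: "walk E p \<Longrightarrow> E \<subseteq> F \<Longrightarrow> walk F p"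
  by (induction E p rule: walk.induct) auto

lemma walk_append: "walk E (p @ v # q) \<longleftrightarrow> walk E (p @ [v]) \<and> walk E (v # q)"
proof (induction p)
  case (Cons a p)
  then show ?case by (cases p) auto
qed simp

lemma wt_append: "wt w (p @ v # q) = wt w (p @ [v]) + wt w (v # q)"
proof (induction p)
  case (Cons a p)
  then show ?case by (cases p) auto
qed simp

lemma walk_snoc: "p \<noteq> [] \<Longrightarrow> walk E (p @ [v]) \<longleftrightarrow> walk E p \<and> {last p, v} \<in> E"
  by (induction E p rule: walk.induct) auto

lemma wt_snoc: "p \<noteq> [] \<Longrightarrow> wt w (p @ [v]) = wt w p + w {last p, v}"
  by (induction w p rule: wt.induct) auto

lemma walk_rev: "walk E (rev p) \<longleftrightarrow> walk E p"
proof (induction E p rule: walk.induct)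
  case (3 E u v p)
  have "walk E ((rev p @ [v]) @ [u]) \<longleftrightarrow> walk E (rev p @ [v]) \<and> {v, u} \<in> E" by (subst walk_snoc) auto
  then show ?case using 3 by (auto simp: insert_commute)
qed auto

lemma wt_rev: "wt w (rev p) = wt w p"
proof (induction w p rule: wt.induct)
  case (1 w u v p)
  have "wt w ((rev p @ [v]) @ [u]) = wt w (rev p @ [v]) + w {v, u}" by (subst wt_snoc) auto
  then show ?case using 1 by (simp add: insert_commute)
qed auto

lemma walk_join:
  assumes "walk E p" "walk E q" "last p = hd q"
  obtains r where "walk E r" "hd r = hd p" "last r = last q" "wt w r = wt w p + wt w q"
proof -
  obtain b z where p: "p = b @ [z]" using assms(1) by (cases p rule: rev_cases) auto
  obtain q' where q: "q = z # q'" using assms p by (cases q) auto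
  show ?thesis
  proof
    show "walk E (b @ z # q')" using assms p q by (simp add: walk_append[of E b z q'])
    show "wt w (b @ z # q') = wt w p + wt w q" using p q by (simp add: wt_append[of w b z q'])
    show "hd (b @ z # q') = hd p" using p by (cases b) auto
    show "last (b @ z # q') = last q" using q by simp
  qed
qed

text \<open>The segment between two occurrences of a vertex is cut out, which increases neither
  weight nor length.\<close>

lemma walk_to_path:
  "walk E p \<Longrightarrow> \<exists>q. walk E q \<and> distinct q \<and> hd q = hd p \<and> last q = last p \<and>
     wt w q \<le> wt w p \<and> length q \<le> length p"
proof (induction "length p" arbitrary: p rule: less_induct)
  case less
  show ?case
  proof (cases "distinct p")
    case False
    then obtain xs ys zs y where p: "p = xs @ [y] @ ys @ [y] @ zs" using not_distinct_decomp by blast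
    let ?q = "xs @ y # zs"
    have w1: "walk E (xs @ y # (ys @ y # zs))" using less.prems p by simp
    then have w: "walk E (xs @ [y])" "walk E (y # ys @ y # zs)" 
      using walk_append[of E xs y "ys @ y # zs"] by simp_all
    then have "walk E ((y # ys) @ y # zs)" by simp
    then have "walk E (y # zs)" by (simp only: walk_append[of E "y # ys" y zs])
    with w have q: "walk E ?q" by (simp add: walk_append[of E xs y zs])
    have "wt w p = wt w (xs @ [y]) + wt w ((y # ys) @ y # zs)"
      using wt_append[of w xs y "ys @ y # zs"] p by simp
    also have "\<dots> = wt w (xs @ [y]) + (wt w ((y # ys) @ [y]) + wt w (y # zs))" by (simp only: wt_append[of w "y # ys" y zs])
    finally have "wt w ?q \<le> wt w p" by (simp add: wt_append[of w xs y zs])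
    moreover have "hd ?q = hd p" "last ?q = last p" "length ?q < length p" using p by (cases xs; simp)+
    ultimately show ?thesis using less.hyps[OF _ q] by fastforce
  qed (use less.prems in auto)
qed

lemma walk_avoid: "walk E p \<Longrightarrow> u \<notin> set p \<Longrightarrow> walk (E - {{u, a}}) p"
  by (induction E p rule: walk.induct) (auto simp: doubleton_eq_iff)

text \<open>If two paths leave \<open>u\<close> towards different neighbours \<open>a\<close> and
  \<open>b\<close>, the rest of the first one followed by the reverse of the second leads from
  \<open>a\<close> back to \<open>u\<close> without the edge \<open>{u, a}\<close>. Shortened to a
  path and closed by that edge, it is a cycle.\<close>

lemma acyclic_unique_path:
  assumes "\<nexists>p. is_cycle T p"
  shows "walk T p \<Longrightarrow> walk T q \<Longrightarrow> distinct p \<Longrightarrow> distinct q \<Longrightarrow> hd p = hd q \<Longrightarrow> last p = last q \<Longrightarrow> p = q"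
proof (induction p arbitrary: q)
  case (Cons u p')
  obtain q' where q: "q = u # q'" using Cons.prems by (cases q) auto
  show ?case
  proof (cases "p' = [] \<or> q' = []")
    case True
    then show ?thesis using Cons.prems q by (cases p'; cases q'; force split: if_splits)
  next
    case False
    then obtain a p'' b q'' where p': "p' = a # p''" and q': "q' = b # q''" by (metis neq_Nil_conv)
    show ?thesis
    proof (cases "a = b")
      case True
      then have "p' = q'" using Cons.IH[of q'] Cons.prems q p' q' by auto
      then show ?thesis using q by simp
    next
      case ab: False
      let ?E = "T - {{u, a}}"
      have "walk ?E p'" using walk_avoid[of T p' u a] Cons.prems p' by auto
      moreover have "walk ?E q'" using walk_avoid[of T q' u a] Cons.prems q q' by auto
      then have "walk ?E q" using Cons.prems(2) ab q q' by (auto simp: doubleton_eq_iff)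
      then have "walk ?E (rev q)" by (simp add: walk_rev)
      moreover have "last p' = hd (rev q)" using Cons.prems p' q by (simp add: hd_rev)
      ultimately obtain r where r: "walk ?E r" "hd r = a" "last r = u"
        using walk_join[of ?E p' "rev q"] p' q by (metis last_rev list.sel(1))
      obtain z where z: "walk ?E z" "distinct z" "hd z = a" "last z = u" 
        using walk_to_path[OF r(1)] r by auto
      have au: "a \<noteq> u" using Cons.prems p' by auto
      obtain z1 z2 where z12: "z = a # z1 # z2"
        using z au by (cases z; cases "tl z") auto
      \<comment> \<open>A path consisting of \<open>a\<close> and \<open>u\<close> alone would use
        the removed edge.\<close>
      have "z2 \<noteq> []" using z z12 by (auto simp: insert_commute)
      then have "3 \<le> length z" using z12 by (cases z2) auto
      moreover have "walk T z" using z(1) by (rule walk_mono) auto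
      moreover have "{u, a} \<in> T" using Cons.prems p' by auto
      ultimately have "is_cycle T z" using z by (auto simp: is_cycle_def walk_iff)
      then show ?thesis using assms by blast
    qed
  qed
qed simp

lemma spanning_tree_path:
  assumes "spanning_tree n E T" "walk T p" "distinct p" "hd p = u" "last p = v"
  shows "tree_dist w T u v = wt w p"
proof -
  have "(THE p. simple_path T u p v) = p"
  proof (rule the_equality)
    show "simple_path T u p v" using assms by (simp add: simple_path_iff)
    show "q = p" if "simple_path T u q v" for q
      using acyclic_unique_path[of T q p] assms that by (auto simp: simple_path_iff spanning_tree_def)
  qed
  then show ?thesis by (simp add: tree_dist_def path_weight_eq_wt)
qed

lemma tree_dist_le:
  assumes "spanning_tree n E T" "walk T p" "hd p = u" "last p = v"
  shows "tree_dist w T u v \<le> wt w p"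
  using walk_to_path[OF assms(2), of w] spanning_tree_path[OF assms(1)] assms(3,4) by metis

lemma tree_dist_walk:
  assumes "spanning_tree n E T" "u < n" "v < n"
  obtains p where "walk T p" "distinct p" "hd p = u" "last p = v" "wt w p = tree_dist w T u v"
proof -
  obtain p where "simple_path T u p v"
    using assms unfolding spanning_tree_def connected_graph_def by blast
  then show ?thesis using that[of p] spanning_tree_path[OF assms(1)] by (auto simp: simple_path_iff)
qed

lemma tree_dist_sym_le:
  assumes "spanning_tree n E T" "u < n" "v < n"
  shows "tree_dist w T v u \<le> tree_dist w T u v"
proof -
  obtain p where p: "walk T p" "hd p = u" "last p = v" "wt w p = tree_dist w T u v"
    using tree_dist_walk[OF assms] by metis
  have "p \<noteq> []" using p by auto
  then show ?thesis
    using tree_dist_le[OF assms(1), of "rev p" v u w] p by (simp add: walk_rev wt_rev hd_rev last_rev)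
qed

lemma tree_dist_triangle:
  assumes "spanning_tree n E T" "u < n" "v < n" "x < n"
  shows "tree_dist w T u v \<le> tree_dist w T u x + tree_dist w T x v"
proof -
  obtain p where p: "walk T p" "hd p = u" "last p = x" "wt w p = tree_dist w T u x"
    using tree_dist_walk[OF assms(1,2,4)] by metis
  obtain q where q: "walk T q" "hd q = x" "last q = v" "wt w q = tree_dist w T x v"
    using tree_dist_walk[OF assms(1,4,3)] by metis
  obtain r where "walk T r" "hd r = u" "last r = v" "wt w r = wt w p + wt w q"
    using walk_join[OF p(1) q(1), of w] p q by metis
  then show ?thesis using tree_dist_le[OF assms(1), of r u v w] p q by simp
qed

text \<open>Take a vertex of maximal \<open>\<phi>\<close> on the cycle. Both edges of the cycle at
  this vertex lead to its parent, so its two neighbours coincide, which is impossible for distinct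
  vertices and length at least 3.\<close>

lemma rooted_tree_acyclic:
  fixes par :: "nat \<Rightarrow> nat" and \<phi> :: "nat \<Rightarrow> nat"
  assumes dec: "\<And>v. v < n \<Longrightarrow> v \<noteq> s \<Longrightarrow> \<phi> (par v) < \<phi> v"
  shows "\<not> is_cycle {{par v, v} | v. v < n \<and> v \<noteq> s} p"
proof
  let ?T = "{{par v, v} | v. v < n \<and> v \<noteq> s}"
  assume c: "is_cycle ?T p"
  let ?l = "length p"
  have l: "3 \<le> ?l" "distinct p" using c by (auto simp: is_cycle_def)
  have edge: "{p ! i, p ! (Suc i mod ?l)} \<in> ?T" if "i < ?l" for i
  proof (cases "Suc i < ?l")
    case True
    then have "{p ! i, p ! Suc i} \<in> ?T" using c unfolding is_cycle_def by blast
    then show ?thesis using True by simp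
  next
    case False
    then have i: "i = ?l - 1" using that by simp
    have "p \<noteq> []" using l by auto
    then have "p ! i = last p" "p ! (Suc i mod ?l) = hd p" using l i by (auto simp: last_conv_nth hd_conv_nth)
    moreover have "{last p, hd p} \<in> ?T" using c unfolding is_cycle_def by blast
    ultimately show ?thesis by simp
  qed
  have up: "y = par x" if "{x, y} \<in> ?T" "\<phi> y \<le> \<phi> x" for x y
    using that dec by (fastforce simp: doubleton_eq_iff)
  have "p \<noteq> []" using l by auto
  then have "Max (\<phi> ` set p) \<in> \<phi> ` set p" by (intro Max_in) auto
  then obtain x where "x \<in> set p" "\<phi> x = Max (\<phi> ` set p)" by force
  then have x: "x \<in> set p" "\<And>y. y \<in> set p \<Longrightarrow> \<phi> y \<le> \<phi> x" by auto
  from x(1) obtain i where i: "i < ?l" "p ! i = x" by (auto simp: in_set_conv_nth)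
  let ?j = "Suc i mod ?l"
  define h where "h = (if i = 0 then ?l - 1 else i - 1)"
  have h: "h < ?l" "Suc h mod ?l = i" using i l by (auto simp: h_def)
  have j: "?j < ?l" using l by (intro mod_less_divisor) linarith
  have "p ! ?j = par x" using up[of x "p ! ?j"] edge[OF i(1)] x(2) j i by simp
  moreover have "p ! h = par x" using up[of x "p ! h"] edge[OF h(1)] h x(2) i by (simp add: insert_commute)
  ultimately have "h = ?j" using l(2) h(1) j by (metis nth_eq_iff_index_eq)
  then show False using l(1) i(1) unfolding h_def
    by (cases "Suc i = ?l") (auto split: if_splits)
qed

section \<open>Shortest path trees\<close>

text \<open>
  Weights may be \<open>0\<close>, so distances alone do not orient the edges of a shortest path tree. Walks are
  therefore compared by \<open>n * weight + hops\<close>; a simple path has fewer than \<open>n\<close> hops, so the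
  distance is the quotient by \<open>n\<close> of the minimum.
\<close>

locale weighted_graph =
  fixes n :: nat and E :: "nat set set" and w :: "nat set \<Rightarrow> nat"
  assumes simple: "simple_graph n E" and conn: "connected_graph n E"
begin

definition "hcost p = n * wt w p + (length p - 1)"

definition "hdist s v = (LEAST d. \<exists>p. walk E p \<and> hd p = s \<and> last p = v \<and> hcost p = d)"

definition "gdist s v = hdist s v div n"

definition "is_parent s u v \<longleftrightarrow> u < n \<and> {u, v} \<in> E \<and> hdist s v = hdist s u + n * w {u, v} + 1"

text \<open>Ties are broken by vertex number, because every output bit is computed separately and
  all of them have to refer to the same tree.\<close>

definition "parent s v = (LEAST u. is_parent s u v)"

definition "spt s = {{parent s v, v} | v. v < n \<and> v \<noteq> s}"

lemma edgeD: "{u, v} \<in> E \<Longrightarrow> u < n \<and> v < n \<and> u \<noteq> v"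
  using simple by (auto simp: simple_graph_def doubleton_eq_iff)

lemma walk_vertices: "walk E p \<Longrightarrow> hd p < n \<Longrightarrow> set p \<subseteq> {..<n}"
proof (induction p rule: induct_list012)
  case (3 u v p)
  then show ?case using edgeD[of u v] by auto
qed auto

lemma hcost_snoc: "p \<noteq> [] \<Longrightarrow> hcost (p @ [v]) = hcost p + n * w {last p, v} + 1"
  unfolding hcost_def wt_snoc by (cases p) (auto simp: algebra_simps)

lemma hdist_le: "walk E p \<Longrightarrow> hd p = s \<Longrightarrow> last p = v \<Longrightarrow> hdist s v \<le> hcost p"
  unfolding hdist_def by (rule Least_le) blast

lemma hdist_walk:
  assumes "s < n" "v < n"
  obtains p where "walk E p" "hd p = s" "last p = v" "hcost p = hdist s v"
proof -
  obtain q where "walk E q" "hd q = s" "last q = v"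
    using conn assms by (auto simp: connected_graph_def simple_path_iff)
  then have "\<exists>d p. walk E p \<and> hd p = s \<and> last p = v \<and> hcost p = d" by blast
  from LeastI_ex[OF this] show ?thesis using that unfolding hdist_def by blast
qed

lemma path_length_le: "walk E p \<Longrightarrow> hd p < n \<Longrightarrow> distinct p \<Longrightarrow> length p \<le> n"
  using walk_vertices[of p] card_mono[of "{..<n}" "set p"] by (simp add: distinct_card)

lemma gdist_le:
  assumes "walk E p" "hd p = s" "last p = v" "s < n"
  shows "gdist s v \<le> wt w p"
proof -
  obtain q where q: "walk E q" "distinct q" "hd q = s" "last q = v" "wt w q \<le> wt w p"
    using walk_to_path[OF assms(1), of w] assms by auto
  have "length q \<le> n" using path_length_le q assms by auto
  then have "hdist s v < n * Suc (wt w q)"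
    using hdist_le[OF q(1,3,4)] assms(4) by (simp add: hcost_def)
  then have "gdist s v < Suc (wt w q)"
    unfolding gdist_def by (simp add: less_mult_imp_div_less mult.commute)
  then show ?thesis using q by simp
qed

lemma hdist_path:
  assumes "s < n" "v < n"
  obtains p where "walk E p" "distinct p" "hd p = s" "last p = v" "hcost p = hdist s v" "wt w p = gdist s v"
proof -
  obtain p where p: "walk E p" "hd p = s" "last p = v" "hcost p = hdist s v"
    using hdist_walk[OF assms] by blast
  obtain q where q: "walk E q" "distinct q" "hd q = s" "last q = v" "wt w q \<le> wt w p" "length q \<le> length p"
    using walk_to_path[OF p(1), of w] p by auto
  have "hcost q \<le> hcost p" using q by (simp add: hcost_def add_mono diff_le_mono)
  then have eq: "hcost q = hdist s v" using hdist_le[OF q(1,3,4)] p by simp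
  have "q \<noteq> []" using q by auto
  then have "length q - 1 < n" using path_length_le[of q] q assms by (cases q) auto
  then have "gdist s v = wt w q" unfolding gdist_def eq[symmetric] by (simp add: hcost_def)
  then show ?thesis using that q eq by simp
qed

lemma hdist_self: "hdist s s = 0"
  using hdist_le[of "[s]" s s] by (simp add: hcost_def)

lemma hdist_edge:
  assumes "s < n" "{u, v} \<in> E"
  shows "hdist s v \<le> hdist s u + n * w {u, v} + 1"
proof -
  obtain p where p: "walk E p" "hd p = s" "last p = u" "hcost p = hdist s u"
    using hdist_walk[OF assms(1)] edgeD[OF assms(2)] by blast
  have ne: "p \<noteq> []" using p by auto
  then have "hdist s v \<le> hcost (p @ [v])" using p assms by (intro hdist_le) (auto simp: walk_snoc)
  then show ?thesis using hcost_snoc[OF ne] p by simp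
qed

lemma parent_exists:
  assumes "s < n" "v < n" "v \<noteq> s"
  shows "\<exists>u. is_parent s u v"
proof -
  obtain p where p: "walk E p" "hd p = s" "last p = v" "hcost p = hdist s v"
    using hdist_walk[OF assms(1,2)] by blast
  then obtain q where q: "p = q @ [v]" by (cases p rule: rev_cases) auto
  have ne: "q \<noteq> []" using q p assms by auto
  have e: "walk E q" "{last q, v} \<in> E" using p q ne by (auto simp: walk_snoc)
  have "hdist s (last q) \<le> hcost q" using e p q ne by (intro hdist_le) auto
  then have "hdist s v \<ge> hdist s (last q) + n * w {last q, v} + 1"
    using p q hcost_snoc[OF ne] by simp
  then show ?thesis using hdist_edge[OF assms(1) e(2)] edgeD[OF e(2)] e unfolding is_parent_def
    by (intro exI[of _ "last q"]) auto
qed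

lemma parent: "s < n \<Longrightarrow> v < n \<Longrightarrow> v \<noteq> s \<Longrightarrow> is_parent s (parent s v) v"
  unfolding parent_def using LeastI_ex[OF parent_exists] by blast

text \<open>A parent has smaller \<open>hdist\<close> than its child, so climbing to the root
  terminates, and the costs of the edges on the way add up exactly to \<open>hdist\<close>.\<close>

lemma spt_walk:
  assumes "s < n" "v < n"
  shows "\<exists>p. walk (spt s) p \<and> hd p = s \<and> last p = v \<and> hcost p = hdist s v"
  using assms(2)
proof (induction "hdist s v" arbitrary: v rule: less_induct)
  case less
  show ?case
  proof (cases "v = s")
    case True
    then show ?thesis by (intro exI[of _ "[s]"]) (simp add: hdist_self hcost_def)
  next
    case False
    note par = parent[OF assms(1) less.prems False, unfolded is_parent_def]
    then obtain p where p: "walk (spt s) p" "hd p = s" "last p = parent s v" "hcost p = hdist s (parent s v)"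
      using less.hyps[of "parent s v"] by auto
    have ne: "p \<noteq> []" using p by auto
    have "{parent s v, v} \<in> spt s" using less.prems False by (auto simp: spt_def)
    then show ?thesis using p ne par
      by (intro exI[of _ "p @ [v]"]) (auto simp: walk_snoc hcost_snoc)
  qed
qed

lemma spt_spanning_tree:
  assumes "s < n"
  shows "spanning_tree n E (spt s)"
  unfolding spanning_tree_def
proof (intro conjI)
  show "spt s \<subseteq> E" using parent[OF assms] by (auto simp: spt_def is_parent_def)
  show "\<nexists>p. is_cycle (spt s) p"
    unfolding spt_def using rooted_tree_acyclic[of n s "hdist s" "parent s"] parent[OF assms]
    by (auto simp: is_parent_def)
  show "connected_graph n (spt s)"
    unfolding connected_graph_def
  proof (intro allI impI)
    fix u v assume uv: "u < n" "v < n"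
    obtain p where p: "walk (spt s) p" "hd p = s" "last p = u" using spt_walk[OF assms uv(1)] by blast
    obtain q where q: "walk (spt s) q" "hd q = s" "last q = v" using spt_walk[OF assms uv(2)] by blast
    have "p \<noteq> []" using p by auto
    then have "walk (spt s) (rev p)" "hd (rev p) = u" "last (rev p) = hd q"
      using p q by (auto simp: walk_rev hd_rev last_rev)
    from walk_join[OF this(1) q(1) this(3)] obtain r where "walk (spt s) r" "hd r = u" "last r = v"
      using \<open>hd (rev p) = u\<close> q by metis
    from walk_to_path[OF this(1)] this show "\<exists>p. simple_path (spt s) u p v"
      by (auto simp: simple_path_iff)
  qed
qed

lemma spt_dist_le:
  assumes "s < n" "v < n"
  shows "tree_dist w (spt s) s v \<le> gdist s v"
proof -
  obtain p where p: "walk (spt s) p" "hd p = s" "last p = v" "hcost p = hdist s v"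
    using spt_walk[OF assms] by blast
  have "wt w p \<le> hcost p div n" using assms(1) by (simp add: hcost_def)
  then show ?thesis using tree_dist_le[OF spt_spanning_tree[OF assms(1)] p(1-3), of w] p(4)
    by (simp add: gdist_def)
qed

lemma tree_dist_ge:
  assumes "spanning_tree n E T" "s < n" "v < n"
  shows "gdist s v \<le> tree_dist w T s v"
proof -
  obtain p where p: "walk T p" "hd p = s" "last p = v" "wt w p = tree_dist w T s v"
    using tree_dist_walk[OF assms] by metis
  have "walk E p" using assms(1) p(1) by (auto simp: spanning_tree_def intro: walk_mono)
  then show ?thesis using gdist_le p assms by metis
qed

lemma gdist_triangle:
  assumes "s < n" "t < n" "v < n"
  shows "gdist s t \<le> gdist s v + gdist t v"
proof -
  obtain p where p: "walk E p" "hd p = s" "last p = v" "wt w p = gdist s v"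
    using hdist_path[OF assms(1,3)] by metis
  obtain q where q: "walk E q" "hd q = t" "last q = v" "wt w q = gdist t v"
    using hdist_path[OF assms(2,3)] by metis
  have "q \<noteq> []" using q by auto
  then have "walk E (rev q)" "hd (rev q) = v" "last (rev q) = t" "wt w (rev q) = gdist t v"
    using q by (auto simp: walk_rev wt_rev hd_rev last_rev)
  then obtain r where "walk E r" "hd r = s" "last r = t" "wt w r = gdist s v + gdist t v"
    using walk_join[OF p(1), of "rev q" w] p by metis
  then show ?thesis using gdist_le assms by metis
qed

section \<open>The factor 2\<close>

definition "gsum s = (\<Sum>v<n. gdist s v)"

lemma cost_ge:
  assumes "spanning_tree n E T" "s1 < n" "s2 < n" "0 \<le> lam"
  shows "lam * real (gsum s1) + real (gsum s2) \<le> routing_cost2 n w s1 s2 lam T"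
proof -
  have "lam * real (gsum s1) + real (gsum s2) = (\<Sum>v<n. lam * real (gdist s1 v) + real (gdist s2 v))"
    by (simp add: gsum_def sum.distrib sum_distrib_left)
  also have "\<dots> \<le> routing_cost2 n w s1 s2 lam T"
    unfolding routing_cost2_def
    using tree_dist_ge[OF assms(1)] assms(2-4) by (intro sum_mono add_mono mult_left_mono) auto
  finally show ?thesis .
qed

text \<open>The triangle inequality through \<open>v\<close>, summed over all
  \<open>v\<close>.\<close>

lemma diameter_le:
  assumes "s < n" "t < n"
  shows "n * gdist s t \<le> gsum s + gsum t"
proof -
  have "(\<Sum>v<n. gdist s t) \<le> (\<Sum>v<n. gdist s v + gdist t v)"
    using gdist_triangle[OF assms] by (intro sum_mono) auto
  then show ?thesis by (simp add: gsum_def sum.distrib)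
qed

text \<open>The bound goes through the root of the tree, from which the tree realises the distances
  of the graph.\<close>

lemma cross_dist_le:
  assumes "s < n" "t < n" "v < n"
  shows "tree_dist w (spt s) t v \<le> gdist s t + gdist s v"
proof -
  note T = spt_spanning_tree[OF assms(1)]
  have "tree_dist w (spt s) t v \<le> tree_dist w (spt s) t s + tree_dist w (spt s) s v"
    by (rule tree_dist_triangle[OF T assms(2,3,1)])
  moreover have "tree_dist w (spt s) t s \<le> gdist s t"
    using tree_dist_sym_le[OF T assms(1,2), of w] spt_dist_le[OF assms(1,2)] by linarith
  ultimately show ?thesis using spt_dist_le[OF assms(1,3)] by linarith
qed

lemma cross_sum_le:
  assumes "s < n" "t < n"
  shows "(\<Sum>v<n. tree_dist w (spt s) t v) \<le> 2 * gsum s + gsum t"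
proof -
  have "(\<Sum>v<n. tree_dist w (spt s) t v) \<le> (\<Sum>v<n. gdist s t + gdist s v)"
    using cross_dist_le[OF assms] by (intro sum_mono) auto
  also have "\<dots> = n * gdist s t + gsum s" by (simp add: sum.distrib gsum_def)
  finally show ?thesis using diameter_le[OF assms] by simp
qed

lemma own_sum_le:
  assumes "s < n"
  shows "(\<Sum>v<n. tree_dist w (spt s) s v) \<le> gsum s"
  unfolding gsum_def using spt_dist_le[OF assms] by (intro sum_mono) auto

lemma routing_cost2_sums: "routing_cost2 n w s1 s2 lam T =
  lam * real (\<Sum>v<n. tree_dist w T s1 v) + real (\<Sum>v<n. tree_dist w T s2 v)"
  by (simp add: routing_cost2_def sum.distrib sum_distrib_left)

lemma spt_two_approx:
  assumes s: "s1 < n" "s2 < n" and lam: "1 \<le> lam" and T: "spanning_tree n E T"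
  defines "r \<equiv> (if 2 * real (gsum s1) \<le> lam * real (gsum s1) + real (gsum s2) then s1 else s2)"
  shows "routing_cost2 n w s1 s2 lam (spt r) \<le> 2 * routing_cost2 n w s1 s2 lam T"
proof -
  let ?a = "real (gsum s1)" let ?b = "real (gsum s2)"
  have "routing_cost2 n w s1 s2 lam (spt r) \<le> 2 * (lam * ?a + ?b)"
  proof (cases "2 * ?a \<le> lam * ?a + ?b")
    case True
    then have "routing_cost2 n w s1 s2 lam (spt r) \<le> lam * ?a + real (2 * gsum s1 + gsum s2)"
      unfolding routing_cost2_sums r_def using lam own_sum_le[OF s(1)] cross_sum_le[OF s]
      by (intro add_mono mult_left_mono) (auto simp del: of_nat_sum of_nat_add of_nat_mult)
    then show ?thesis using True by simp
  next
    case False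
    then have "routing_cost2 n w s1 s2 lam (spt r) \<le> lam * real (2 * gsum s2 + gsum s1) + ?b"
      unfolding routing_cost2_sums r_def using lam own_sum_le[OF s(2)] cross_sum_le[OF s(2,1)]
      by (intro add_mono mult_left_mono) (auto simp del: of_nat_sum of_nat_add of_nat_mult)
    moreover have "(2 * lam - 1) * ?b \<le> lam * ?a"
    proof -
      have "(2 * lam - 1) * ?b \<le> (2 * lam - 1) * ((2 - lam) * ?a)"
        using False lam by (intro mult_left_mono) (auto simp: algebra_simps)
      also have "\<dots> = lam * ?a - 2 * ((lam - 1)\<^sup>2 * ?a)" by (simp add: power2_eq_square algebra_simps)
      also have "\<dots> \<le> lam * ?a" by simp
      finally show ?thesis .
    qed
    ultimately show ?thesis by (simp add: algebra_simps)
  qed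
  then show ?thesis using cost_ge[OF T s, of lam] lam by simp
qed

text \<open>\<open>arg_min\<close> meets its specification once a minimum exists; it does, as there
  are finitely many spanning trees and \<open>spt 0\<close> is one of them.\<close>

lemma W2MRCT_spanning_tree:
  assumes "0 < n"
  shows "spanning_tree n E (W2MRCT n E w s1 s2 lam)"
proof -
  have "E \<subseteq> Pow {..<n}" using simple by (auto simp: simple_graph_def)
  then have "finite E" by (rule finite_subset) simp
  then have "finite {T. spanning_tree n E T}"
    by (rule finite_subset[rotated, OF finite_Pow_iff[THEN iffD2]]) (auto simp: spanning_tree_def)
  moreover have "{T. spanning_tree n E T} \<noteq> {}" using spt_spanning_tree[OF assms] by blast
  ultimately obtain T where "is_arg_min (routing_cost2 n w s1 s2 lam) (\<lambda>T. T \<in> {T. spanning_tree n E T}) T"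
    using ex_is_arg_min_if_finite by blast
  then have "is_arg_min (routing_cost2 n w s1 s2 lam) (spanning_tree n E) T" by simp
  then have "is_arg_min (routing_cost2 n w s1 s2 lam) (spanning_tree n E) (W2MRCT n E w s1 s2 lam)"
    unfolding W2MRCT_def arg_min_def by (rule someI)
  then show ?thesis by (simp add: is_arg_min_def)
qed

end

section \<open>The formula of the algorithm\<close>

text \<open>The closures for binary values, sums and comparisons describe deterministic
  computations: the only successor of \<open>st i\<close> is \<open>st (Suc i)\<close>, and
  \<open>st t\<close> is final. The reachable states are then exactly those of the run.\<close>

lemma chain_rtrancl:
  assumes "\<And>i c. i \<le> t \<Longrightarrow> (st i, c) \<in> R \<longleftrightarrow> i < t \<and> c = st (Suc i)"
  shows "(st 0, c) \<in> R\<^sup>* \<longleftrightarrow> (\<exists>i\<le>t. c = st i)"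
proof
  assume "(st 0, c) \<in> R\<^sup>*"
  then show "\<exists>i\<le>t. c = st i"
  proof induction
    case (step y z)
    then show ?case using assms Suc_leI by metis
  qed auto
next
  assume "\<exists>i\<le>t. c = st i"
  then obtain i where i: "i \<le> t" "c = st i" by blast
  have "(st 0, st i) \<in> R\<^sup>*" using i(1)
  proof (induction i)
    case (Suc i)
    then show ?case using assms[of i "st (Suc i)"] by (meson Suc_leD Suc_le_lessD rtrancl.rtrancl_into_rtrancl)
  qed simp
  then show "(st 0, c) \<in> R\<^sup>*" using i by simp
qed

lemma pair_code_eq: "i < (P::nat) \<Longrightarrow> c = q * P + i \<longleftrightarrow> c div P = q \<and> c mod P = i"
  by (metis add.commute div_mult_mod_eq div_mult_self3 div_less add_cancel_right_right mod_mult_self1 mod_less less_nat_zero_code)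

definition "Disj f g = Neg (Conj (Neg f) (Neg g))"
definition "Ifte c f g = Disj (Conj c f) (Conj (Neg c) g)"

lemma fsem_Disj [simp]: "fsem M x (Disj f g) s \<longleftrightarrow> fsem M x f s \<or> fsem M x g s"
  by (simp add: Disj_def)
lemma fsem_Ifte [simp]: "fsem M x (Ifte c f g) s \<longleftrightarrow> (if fsem M x c s then fsem M x f s else fsem M x g s)"
  by (simp add: Ifte_def)
lemma wff_Disj [simp]: "wff k (Disj f g) \<longleftrightarrow> wff k f \<and> wff k g"
  by (simp add: Disj_def)
lemma wff_Ifte [simp]: "wff k (Ifte c f g) \<longleftrightarrow> wff k c \<and> wff k f \<and> wff k g"
  by (auto simp: Ifte_def)

text \<open>
  Variable \<open>4\<close> holds the number of vertices, from which the width \<open>b\<close> of the binary words in the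
  instance and all addresses are computed.
\<close>

definition "width_e = Div (Sub (Var 0) (Add (Mul (Var 4) (Var 4)) (Add (Mul (Cst 3) (Var 4)) (Cst 1))))
   (Add (Mul (Var 4) (Var 4)) (Cst 2))"
definition "entry_e u v = Add (Add (Var 4) (Cst 1)) (Mul (Add (Mul u (Var 4)) v) (Add (Cst 1) width_e))"
definition "sources_e = Add (Add (Var 4) (Cst 1)) (Mul (Mul (Var 4) (Var 4)) (Add (Cst 1) width_e))"
definition "num_e = Add sources_e (Mul (Cst 2) (Var 4))"
text \<open>Closures relate single numbers, so a state with two components is coded in base
  \<open>2 ^ lg N\<close>, the value of variable 2. The second component is a vertex, a counter up
  to \<open>n\<close> or a bit position up to \<open>b\<close>, hence smaller than the base.\<close>

definition "fst_e a = Div a (Var 2)"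
definition "snd_e a = mod_e a (Var 2)"
definition "pair_e a i = Add (Mul a (Var 2)) i"

text \<open>The word at address \<open>13\<close> has value \<open>12\<close>: Horner's scheme from the most significant bit on.\<close>

definition "Value_f = Sbst 14 width_e (Sbst 15 (pair_e (Var 12) (Cst 0)) (TC 14 15
   (Conj (Rel (eq_e (snd_e (Var 14)) (Add (snd_e (Var 15)) (Cst 1))))
     (Ifte (Inp (Add (Var 13) (snd_e (Var 15))))
        (Rel (eq_e (fst_e (Var 15)) (Add (Mul (Cst 2) (fst_e (Var 14))) (Cst 1))))
        (Rel (eq_e (fst_e (Var 15)) (Mul (Cst 2) (fst_e (Var 14)))))))))"

text \<open>\<open>{10, 11}\<close> is an edge of weight \<open>12\<close>.\<close>

definition "Edge_f = Conj (Rel (less_e (Var 10) (Var 4))) (Conj (Rel (less_e (Var 11) (Var 4)))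
   (Conj (Inp (entry_e (Var 10) (Var 11)))
     (Sbst 13 (Add (entry_e (Var 10) (Var 11)) (Cst 1)) Value_f)))"

text \<open>There is a walk from \<open>9\<close> to \<open>16\<close> whose cost is \<open>17\<close>.\<close>

definition "Walk_f = Sbst 18 (Var 9) (Sbst 19 (pair_e (Var 17) (Var 16)) (TC 18 19
   (Sbst 10 (snd_e (Var 18)) (Sbst 11 (snd_e (Var 19))
    (Sbst 12 (Div (Sub (Sub (fst_e (Var 19)) (fst_e (Var 18))) (Cst 1)) (Var 4))
      (Conj (Rel (eq_e (fst_e (Var 19)) (Add (fst_e (Var 18)) (Add (Mul (Var 4) (Var 12)) (Cst 1)))))
        Edge_f))))))"

text \<open>This is \<open>hdist\<close>: 17 is the least cost of a walk from 9 to 16.\<close>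

definition "Dist_f = Conj Walk_f (Neg (Ex 20 (Conj (Rel (less_e (Var 20) (Var 17))) (Sbst 17 (Var 20) Walk_f))))"

text \<open>The distances from \<open>9\<close> sum up to \<open>21\<close>.\<close>

definition "Sum_f = Sbst 22 (Cst 0) (Sbst 23 (pair_e (Var 21) (Var 4)) (TC 22 23
   (Sbst 16 (snd_e (Var 22)) (Ex 17 (Conj Dist_f
     (Conj (Rel (less_e (snd_e (Var 22)) (Var 4)))
     (Conj (Rel (eq_e (snd_e (Var 23)) (Add (snd_e (Var 22)) (Cst 1))))
       (Rel (eq_e (fst_e (Var 23)) (Add (fst_e (Var 22)) (Div (Var 17) (Var 4))))))))))))"

text \<open>
  \<open>den * 25 \<le> num * 24\<close>. With \<open>A = 24\<close> and \<open>B = 25\<close>, the automaton reads the bits of \<open>num\<close> and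
  \<open>den\<close> in parallel from the least significant one on; after \<open>i\<close> bits its state is
  \<open>(A * (num mod 2 ^ i) - B * (den mod 2 ^ i)) div 2 ^ i + B\<close>, which stays between \<open>0\<close> and \<open>A + B\<close>.
\<close>

definition "Compare_f = Ex 28 (Conj (Rel (less_e (Var 25) (Add (Var 28) (Cst 1))))
  (Sbst 26 (pair_e (Var 25) (Cst 0)) (Sbst 27 (pair_e (Var 28) width_e) (TC 26 27
   (Conj (Rel (less_e (snd_e (Var 26)) width_e))
   (Conj (Rel (eq_e (snd_e (Var 27)) (Add (snd_e (Var 26)) (Cst 1))))
    (Ifte (Inp (Add num_e (snd_e (Var 26))))
      (Ifte (Inp (Add (Add num_e width_e) (snd_e (Var 26))))
        (Rel (eq_e (fst_e (Var 27)) (Div (Add (fst_e (Var 26)) (Var 24)) (Cst 2))))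
        (Rel (eq_e (fst_e (Var 27)) (Div (Add (fst_e (Var 26)) (Add (Var 24) (Var 25))) (Cst 2)))))
      (Ifte (Inp (Add (Add num_e width_e) (snd_e (Var 26))))
        (Rel (eq_e (fst_e (Var 27)) (Div (fst_e (Var 26)) (Cst 2))))
        (Rel (eq_e (fst_e (Var 27)) (Div (Add (fst_e (Var 26)) (Var 25)) (Cst 2))))))))))))"

text \<open>In the shortest path tree with root \<open>9\<close>, the parent of \<open>31\<close> is \<open>30\<close>.\<close>

definition "Candidate_f = Ex 32 (Ex 33 (Ex 12
   (Conj (Sbst 16 (Var 30) (Sbst 17 (Var 32) Dist_f))
   (Conj (Sbst 16 (Var 31) (Sbst 17 (Var 33) Dist_f))
   (Conj (Sbst 10 (Var 30) (Sbst 11 (Var 31) Edge_f))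
     (Rel (eq_e (Var 33) (Add (Var 32) (Add (Mul (Var 4) (Var 12)) (Cst 1))))))))))"

definition "Parent_f = Conj Candidate_f (Conj (Neg (Rel (eq_e (Var 31) (Var 9))))
   (Neg (Ex 34 (Conj (Rel (less_e (Var 34) (Var 30))) (Sbst 30 (Var 34) Candidate_f)))))"

text \<open>Tree edges are unordered, so both orientations are tried; variable 34 keeps the old
  value of 30 during the exchange.\<close>

definition "Tree_f = Disj Parent_f (Sbst 34 (Var 30) (Sbst 30 (Var 31) (Sbst 31 (Var 34) Parent_f)))"

text \<open>The unary prefix ends at the first \<open>False\<close>, whose position is the number of
  vertices.\<close>

definition "Vertices_f = Conj (Rel (less_e (Var 4) (Var 0))) (Conj (Neg (Inp (Var 4)))
   (Neg (Ex 35 (Conj (Rel (less_e (Var 35) (Var 4))) (Neg (Inp (Var 35)))))))"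

text \<open>Output bit 0 is the flag, which never announces failure; bit \<open>j > 0\<close> is the
  matrix entry with number \<open>j - 1\<close>. The quantifiers over 4 to 8 have unique witnesses
  and act as definitions of the number of vertices, the two sources and their distance sums.\<close>

definition "Output_f = Disj (Neg (Rel (Var 3))) (Ex 4 (Conj Vertices_f
   (Ex 5 (Conj (Conj (Rel (less_e (Var 5) (Var 4))) (Inp (Add sources_e (Var 5))))
   (Ex 6 (Conj (Conj (Rel (less_e (Var 6) (Var 4))) (Inp (Add (Add sources_e (Var 4)) (Var 6))))
   (Ex 7 (Conj (Sbst 9 (Var 5) (Sbst 21 (Var 7) Sum_f))
   (Ex 8 (Conj (Sbst 9 (Var 6) (Sbst 21 (Var 8) Sum_f))
   (Sbst 30 (Div (Sub (Var 3) (Cst 1)) (Var 4)) (Sbst 31 (mod_e (Sub (Var 3) (Cst 1)) (Var 4))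
     (Ifte (Sbst 24 (Var 7) (Sbst 25 (Sub (Mul (Cst 2) (Var 7)) (Var 8)) Compare_f))
       (Sbst 9 (Var 5) Tree_f) (Sbst 9 (Var 6) Tree_f))))))))))))))"

lemma fsem_Ex_unique:
  assumes "\<And>y. y < M \<Longrightarrow> fsem M x A (t(i := y)) \<longleftrightarrow> y = z" "z < M"
  shows "fsem M x (Ex i (Conj A B)) t \<longleftrightarrow> fsem M x B (t(i := z))"
  using assms by auto

text \<open>The 33 bound variables are those from 3 to 35.\<close>

lemma wff_Output_f: "wff 33 Output_f"
proof -
  have e: "vars_below 36 width_e" "\<And>u v. vars_below 36 (entry_e u v) = (vars_below 36 u \<and> vars_below 36 v)"
    "vars_below 36 sources_e" "vars_below 36 num_e"
    "\<And>a. vars_below 36 (fst_e a) = vars_below 36 a" "\<And>a. vars_below 36 (snd_e a) = vars_below 36 a"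
    "\<And>a i. vars_below 36 (pair_e a i) = (vars_below 36 a \<and> vars_below 36 i)"
    by (auto simp: width_e_def entry_e_def sources_e_def num_e_def fst_e_def snd_e_def pair_e_def)
  have v: "wff 33 Value_f" by (simp add: Value_f_def e)
  have ed: "wff 33 Edge_f" by (simp add: Edge_f_def e v)
  have wa: "wff 33 Walk_f" by (simp add: Walk_f_def e ed)
  have di: "wff 33 Dist_f" by (simp add: Dist_f_def wa)
  have su: "wff 33 Sum_f" by (simp add: Sum_f_def e di)
  have co: "wff 33 Compare_f" by (simp add: Compare_f_def e)
  have ca: "wff 33 Candidate_f" by (simp add: Candidate_f_def e di ed)
  have pa: "wff 33 Parent_f" by (simp add: Parent_f_def ca)
  have tr: "wff 33 Tree_f" by (simp add: Tree_f_def pa)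
  show ?thesis by (simp add: Output_f_def Vertices_f_def e su co tr)
qed

section \<open>Addresses in the input word\<close>

lemma concat_blocks_length:
  "(\<And>v. v < n \<Longrightarrow> length (f v) = c) \<Longrightarrow> length (concat (map f [0..<n])) = n * c"
  by (induction n) auto

lemma concat_blocks_nth:
  "(\<And>v. v < n \<Longrightarrow> length (f v) = c) \<Longrightarrow> v < n \<Longrightarrow> i < c \<Longrightarrow> concat (map f [0..<n]) ! (v * c + i) = f v ! i"
proof (induction n)
  case (Suc n)
  have l: "length (concat (map f [0..<n])) = n * c" by (rule concat_blocks_length) (use Suc in auto)
  show ?case
  proof (cases "v < n")
    case True
    have "v * c + i < Suc v * c" using Suc.prems by simp
    also have "\<dots> \<le> n * c" using True by (intro mult_le_mono1) simp
    finally show ?thesis using Suc True l by (simp add: nth_append)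
  next
    case False
    then show ?thesis using Suc.prems l by (simp add: nth_append less_Suc_eq)
  qed
qed simp

text \<open>\<open>P\<close> is the base of the pair coding, and the bound on \<open>M\<close> makes
  room for all pairs. Costs are below \<open>n * n * (W + 1)\<close>, and the comparison runs
  through states up to three times the distance sum of \<open>s1\<close>, which is at most
  \<open>n * n * W\<close>; this is the origin of the factor 4.\<close>

locale encoded_instance = weighted_graph n E w
  for n :: nat and E :: "nat set set" and w :: "nat set \<Rightarrow> nat" +
  fixes s1 s2 num den b P M W :: nat
  assumes s: "s1 < n" "s2 < n"
    and W: "\<And>e. e \<in> E \<Longrightarrow> w e \<le> W"
    and wb: "\<And>e. e \<in> E \<Longrightarrow> w e < 2 ^ b"
    and nb: "num < 2 ^ b" and db: "den < 2 ^ b"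
    and P: "length (encode_instance b n E w s1 s2 num den) < P"
    and M: "n * n * (W + 1) * 4 * P \<le> M"
begin

definition "x = encode_instance b n E w s1 s2 num den"
definition "N = length x"

lemma length_x: "N = n + 1 + n * n * (1 + b) + 2 * n + 2 * b"
proof -
  have r: "length (concat (map (\<lambda>v. if {u, v} \<in> E then True # word_of b (w {u, v}) else False # word_of b 0) [0..<n])) = n * (1 + b)" for u
    by (rule concat_blocks_length) (auto simp: word_of_def)
  show ?thesis
    unfolding N_def x_def encode_instance_def length_append
    by (subst concat_blocks_length[OF r]) (simp add: word_of_def algebra_simps)
qed

lemma x_parts:
  obtains A where "x = replicate n True @ [False] @ A @ map (\<lambda>v. v = s1) [0..<n] @ map (\<lambda>v. v = s2) [0..<n] @
     word_of b num @ word_of b den" "length A = n * n * (1 + b)"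
    "\<And>u v i. u < n \<Longrightarrow> v < n \<Longrightarrow> i < 1 + b \<Longrightarrow> A ! ((u * n + v) * (1 + b) + i) =
       (if {u, v} \<in> E then True # word_of b (w {u, v}) else False # word_of b 0) ! i"
proof -
  let ?e = "\<lambda>u v. if {u, v} \<in> E then True # word_of b (w {u, v}) else False # word_of b 0"
  let ?r = "\<lambda>u. concat (map (?e u) [0..<n])"
  have e: "length (?e u v) = 1 + b" for u v by (simp add: word_of_def)
  have r: "length (?r u) = n * (1 + b)" for u by (rule concat_blocks_length[OF e])
  have l: "length (concat (map ?r [0..<n])) = n * n * (1 + b)"
    by (subst concat_blocks_length[OF r]) (simp add: algebra_simps)
  have "concat (map ?r [0..<n]) ! ((u * n + v) * (1 + b) + i) = ?e u v ! i"
    if "u < n" "v < n" "i < 1 + b" for u v i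
  proof -
    have "v * (1 + b) + i < Suc v * (1 + b)" using that by simp
    also have "\<dots> \<le> n * (1 + b)" using that by (intro mult_le_mono1) simp
    finally have lt: "v * (1 + b) + i < n * (1 + b)" .
    have "concat (map ?r [0..<n]) ! (u * (n * (1 + b)) + (v * (1 + b) + i)) = ?r u ! (v * (1 + b) + i)"
      by (rule concat_blocks_nth[OF r that(1) lt])
    also have "\<dots> = ?e u v ! i" by (rule concat_blocks_nth[OF e that(2,3)])
    finally show ?thesis by (simp add: algebra_simps)
  qed
  then show ?thesis using that[OF _ l] by (simp add: x_def encode_instance_def)
qed

lemma x_unary: "i < n \<Longrightarrow> x ! i" "\<not> x ! n"
  by (rule x_parts; simp add: nth_append)+

lemma x_edge: "u < n \<Longrightarrow> v < n \<Longrightarrow> x ! (n + 1 + (u * n + v) * (1 + b)) \<longleftrightarrow> {u, v} \<in> E"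
  and x_edge_less: "u < n \<Longrightarrow> v < n \<Longrightarrow> i < 1 + b \<Longrightarrow> n + 1 + (u * n + v) * (1 + b) + i < n + 1 + n * n * (1 + b)"
  and x_weight: "{u, v} \<in> E \<Longrightarrow> i < b \<Longrightarrow> x ! (n + 1 + (u * n + v) * (1 + b) + 1 + i) = bit (w {u, v}) i"
proof -
  have lt: "(u * n + v) * (1 + b) + i < n * n * (1 + b)" if "u < n" "v < n" "i < 1 + b" for u v i
  proof -
    have "u * n + v < Suc u * n" using that by simp
    also have "\<dots> \<le> n * n" using that by (intro mult_le_mono1) simp
    finally have "Suc (u * n + v) * (1 + b) \<le> n * n * (1 + b)" by (intro mult_le_mono1) simp
    then show ?thesis using that by simp
  qed
  obtain A where A: "x = replicate n True @ [False] @ A @ map (\<lambda>v. v = s1) [0..<n] @ map (\<lambda>v. v = s2) [0..<n] @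
     word_of b num @ word_of b den" "length A = n * n * (1 + b)"
    "\<And>u v i. u < n \<Longrightarrow> v < n \<Longrightarrow> i < 1 + b \<Longrightarrow> A ! ((u * n + v) * (1 + b) + i) =
       (if {u, v} \<in> E then True # word_of b (w {u, v}) else False # word_of b 0) ! i"
    by (rule x_parts, rule that)
  have sh: "x ! (n + 1 + j) = A ! j" if "j < n * n * (1 + b)" for j
    using that A(2) unfolding A(1) by (simp add: nth_append)
  show "x ! (n + 1 + (u * n + v) * (1 + b)) \<longleftrightarrow> {u, v} \<in> E" if "u < n" "v < n"
    using sh[OF lt[OF that, of 0]] A(3)[OF that, of 0] by simp
  show "n + 1 + (u * n + v) * (1 + b) + i < n + 1 + n * n * (1 + b)" if "u < n" "v < n" "i < 1 + b"
    using lt[OF that] by simp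
  show "x ! (n + 1 + (u * n + v) * (1 + b) + 1 + i) = bit (w {u, v}) i" if e: "{u, v} \<in> E" "i < b"
  proof -
    have uv: "u < n" "v < n" "Suc i < 1 + b" using edgeD[OF e(1)] e(2) by auto
    have "x ! (n + 1 + ((u * n + v) * (1 + b) + Suc i)) = bit (w {u, v}) i"
      unfolding sh[OF lt[OF uv]] A(3)[OF uv] using e by (simp add: word_of_def)
    then show ?thesis by (simp add: add.assoc)
  qed
qed

lemma x_tail:
  shows "v < n \<Longrightarrow> x ! (n + 1 + n * n * (1 + b) + v) \<longleftrightarrow> v = s1"
    and "v < n \<Longrightarrow> x ! (n + 1 + n * n * (1 + b) + n + v) \<longleftrightarrow> v = s2"
    and "i < b \<Longrightarrow> x ! (n + 1 + n * n * (1 + b) + 2 * n + i) = bit num i"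
    and "i < b \<Longrightarrow> x ! (n + 1 + n * n * (1 + b) + 2 * n + b + i) = bit den i"
proof -
  obtain A where A: "x = replicate n True @ [False] @ A @ map (\<lambda>v. v = s1) [0..<n] @ map (\<lambda>v. v = s2) [0..<n] @
     word_of b num @ word_of b den" "length A = n * n * (1 + b)"
    by (rule x_parts, rule that)
  define a where "a = n + 1 + n * n * (1 + b)"
  let ?Z = "map (\<lambda>v. v = s1) [0..<n] @ map (\<lambda>v. v = s2) [0..<n] @ word_of b num @ word_of b den"
  have "x = (replicate n True @ [False] @ A) @ ?Z" "length (replicate n True @ [False] @ A) = a"
    using A by (auto simp: a_def)
  then have "x ! (a + j) = ?Z ! j" for j by (metis nth_append_length_plus)
  from this[of v] this[of "n + v"] this[of "2 * n + i"] this[of "2 * n + b + i"]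
  show "v < n \<Longrightarrow> x ! (n + 1 + n * n * (1 + b) + v) \<longleftrightarrow> v = s1"
    "v < n \<Longrightarrow> x ! (n + 1 + n * n * (1 + b) + n + v) \<longleftrightarrow> v = s2"
    "i < b \<Longrightarrow> x ! (n + 1 + n * n * (1 + b) + 2 * n + i) = bit num i"
    "i < b \<Longrightarrow> x ! (n + 1 + n * n * (1 + b) + 2 * n + b + i) = bit den i"
    unfolding a_def[symmetric] by (auto simp: nth_append word_of_def add.assoc)
qed

lemma sizes: "0 < n" "n < N" "b < N" "N < P" "n * n < N" "n < P" "b < P" "0 < P" "P \<le> M"
proof -
  show "0 < n" using s by simp
  show a: "n < N" "b < N" "N < P" "n * n < N" using P length_x by (auto simp: x_def N_def)
  then show "n < P" "b < P" "0 < P" by auto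
  have "1 * P \<le> n * n * (W + 1) * 4 * P" using \<open>0 < n\<close> by (intro mult_le_mono1) (simp add: Suc_le_eq)
  then show "P \<le> M" using M by linarith
qed

definition "good s \<longleftrightarrow> s 0 = N \<and> s 2 = P \<and> s 4 = n" for s :: "nat \<Rightarrow> nat"

lemma good_upd [simp]: "5 \<le> i \<Longrightarrow> good (s(i := y)) = good s"
  by (simp add: good_def)

lemma good_simps: "good s \<Longrightarrow> s 0 = N" "good s \<Longrightarrow> s 2 = P" "good s \<Longrightarrow> s 4 = n"
  by (auto simp: good_def)

text \<open>Subtracting from \<open>N\<close> what does not depend on \<open>b\<close> leaves
  \<open>b * (n * n + 2)\<close>: one word for each matrix entry and two for \<open>num\<close> and
  \<open>den\<close>.\<close>

lemma width_e: "good s \<Longrightarrow> aval width_e s = b"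
proof -
  assume g: "good s"
  have "N - (n * n + (3 * n + 1)) = b * (n * n + 2)"
    unfolding length_x by (simp add: algebra_simps)
  moreover have "aval width_e s = (N - (n * n + (3 * n + 1))) div (n * n + 2)"
    using g by (simp add: width_e_def good_simps)
  moreover have "b * (n * n + 2) div (n * n + 2) = b" by (rule nonzero_mult_div_cancel_right) simp
  ultimately show ?thesis by (simp only:)
qed

lemma layout_e:
  assumes "good s"
  shows "aval (entry_e u v) s = n + 1 + (aval u s * n + aval v s) * (1 + b)"
    and "aval sources_e s = n + 1 + n * n * (1 + b)"
    and "aval num_e s = n + 1 + n * n * (1 + b) + 2 * n"
    and "aval (fst_e a) s = aval a s div P" "aval (snd_e a) s = aval a s mod P"
    and "aval (pair_e a i) s = aval a s * P + aval i s"
  using assms by (simp_all add: entry_e_def sources_e_def num_e_def fst_e_def snd_e_def pair_e_def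
      good_simps width_e)

section \<open>Meaning of the subformulas\<close>

text \<open>After \<open>j\<close> steps the state is \<open>V div 2 ^ (b - j)\<close> together with
  the position \<open>b - j\<close>. As \<open>V < 2 ^ b\<close>, the run starts with value 0 at
  position \<open>b\<close>, and the position 0 of the target singles out its last state.\<close>

lemma sem_Value:
  assumes g: "good s" and V: "V < 2 ^ b" "(V + 1) * P \<le> M"
    and bits: "\<And>i. i < b \<Longrightarrow> s 13 + i < N \<and> x ! (s 13 + i) = bit V i"
  shows "fsem M x Value_f s \<longleftrightarrow> s 12 = V"
proof -
  define st where "st j = (V div 2 ^ (b - j)) * P + (b - j)" for j
  let ?R = "{(a, c). a < M \<and> c < M \<and> a mod P = c mod P + 1 \<and>
     c div P = 2 * (a div P) + of_bool (s 13 + c mod P < N \<and> x ! (s 13 + c mod P))}"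
  have bP: "b - j < P" for j using sizes by (meson diff_le_self le_less_trans)
  have st: "st j div P = V div 2 ^ (b - j)" "st j mod P = b - j" for j
    using bP[of j] by (auto simp: st_def)
  have stM: "st j < M" for j
  proof -
    have "st j < (V div 2 ^ (b - j) + 1) * P" using bP[of j] by (simp add: st_def)
    also have "\<dots> \<le> (V + 1) * P" by (intro mult_le_mono1) simp
    finally show ?thesis using V by simp
  qed
  have chain: "(st j, c) \<in> ?R \<longleftrightarrow> j < b \<and> c = st (Suc j)" if j: "j \<le> b" for j c
  proof -
    have c: "c = st (Suc j) \<longleftrightarrow> c div P = V div 2 ^ (b - Suc j) \<and> c mod P = b - Suc j"
      unfolding st_def by (rule pair_code_eq[OF bP])
    have step: "V div 2 ^ (b - Suc j) = 2 * (V div 2 ^ (b - j)) + of_bool (bit V (b - Suc j))" if "j < b"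
    proof -
      have "b - j = Suc (b - Suc j)" using that by simp
      then have "V div 2 ^ (b - j) = V div 2 ^ (b - Suc j) div 2" by (simp only: power_Suc2 div_mult2_eq)
      moreover have "of_bool (bit V (b - Suc j)) = V div 2 ^ (b - Suc j) mod 2"
        by (simp add: bit_iff_odd mod_2_eq_odd)
      ultimately show ?thesis by simp
    qed
    show ?thesis
    proof
      assume a: "(st j, c) \<in> ?R"
      then have "b - j = c mod P + 1" by (simp add: st)
      then have "j < b" and "c mod P = b - Suc j" by auto
      have "s 13 + c mod P < N" "x ! (s 13 + c mod P) = bit V (b - Suc j)"
        using bits[of "b - Suc j"] \<open>j < b\<close> unfolding \<open>c mod P = b - Suc j\<close> by auto
      then have "c div P = V div 2 ^ (b - Suc j)"
        using a step[OF \<open>j < b\<close>] by (simp only: mem_Collect_eq case_prod_conv st simp_thms)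
      then show "j < b \<and> c = st (Suc j)" using c \<open>j < b\<close> \<open>c mod P = b - Suc j\<close> by simp
    next
      assume a: "j < b \<and> c = st (Suc j)"
      then show "(st j, c) \<in> ?R" using c step bits[of "b - Suc j"] stM[of j] stM[of "Suc j"] by (simp add: st)
    qed
  qed
  have "fsem M x Value_f s \<longleftrightarrow> b < M \<and> s 12 * P < M \<and> (b, s 12 * P) \<in> ?R\<^sup>*"
    unfolding Value_f_def using g sizes(3,4,9)
    by (simp add: layout_e width_e N_def[symmetric] cong: if_cong)
  also have "(b, s 12 * P) \<in> ?R\<^sup>* \<longleftrightarrow> (\<exists>j\<le>b. s 12 * P = st j)"
    using chain_rtrancl[of b st ?R, OF chain] V(1) by (simp add: st_def)
  also have "\<dots> \<longleftrightarrow> s 12 = V"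
  proof
    assume "\<exists>j\<le>b. s 12 * P = st j"
    then obtain j where j: "j \<le> b" "s 12 * P = st j" by blast
    then have "b - j = 0" using st(2)[of j] by (metis mod_mult_self2_is_0)
    then show "s 12 = V" using j st(1)[of j] sizes(8) by (simp flip: j(2))
  next
    assume "s 12 = V"
    then show "\<exists>j\<le>b. s 12 * P = st j" by (intro exI[of _ b]) (simp add: st_def)
  qed
  finally show ?thesis using sizes(7,9) V by auto
qed

lemma bound_mono: "a \<le> n * n * (W + 1) * 4 \<Longrightarrow> a * P \<le> M"
  using M mult_le_mono1[of a "n * n * (W + 1) * 4" P] by linarith

lemma n_pos_mult: "c \<le> n * n * c" 
  using mult_le_mono1[of 1 "n * n" c] sizes(1) by simp

lemma sem_Edge:
  assumes g: "good s"
  shows "fsem M x Edge_f s \<longleftrightarrow> {s 10, s 11} \<in> E \<and> s 12 = w {s 10, s 11}"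
proof -
  let ?a = "n + 1 + (s 10 * n + s 11) * (1 + b)"
  show ?thesis
  proof (cases "s 10 < n \<and> s 11 < n")
    case True
    then have uv: "s 10 < n" "s 11 < n" by auto
    have less: "?a + i < N" if "i < 1 + b" for i
      using x_edge_less[OF uv that] length_x by linarith
    have eq: "fsem M x Edge_f s \<longleftrightarrow> {s 10, s 11} \<in> E \<and> ?a + 1 < M \<and> fsem M x Value_f (s(13 := ?a + 1))"
      using less[of 0] True x_edge[OF uv] g
      by (simp add: Edge_f_def layout_e good_simps N_def[symmetric])
    show ?thesis
    proof (cases "{s 10, s 11} \<in> E")
      case e: True
      have "?a < N" using less[of 0] by simp
      then have "?a + 1 < M" using sizes(4,9) by linarith
      moreover have "fsem M x Value_f (s(13 := ?a + 1)) \<longleftrightarrow> (s(13 := ?a + 1)) 12 = w {s 10, s 11}"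
      proof (rule sem_Value)
        show "good (s(13 := ?a + 1))" using g by simp
        show "w {s 10, s 11} < 2 ^ b" by (rule wb[OF e])
        have "w {s 10, s 11} + 1 \<le> W + 1" using W[OF e] by simp
        also have "\<dots> \<le> n * n * (W + 1) * 4" using n_pos_mult[of "W + 1"] by linarith
        finally show "(w {s 10, s 11} + 1) * P \<le> M" by (rule bound_mono)
        show "(s(13 := ?a + 1)) 13 + i < N \<and> x ! ((s(13 := ?a + 1)) 13 + i) = bit (w {s 10, s 11}) i" if "i < b" for i
          using less[of "Suc i"] x_weight[OF e that] that by simp
      qed
      ultimately show ?thesis using eq e by simp
    qed (use eq in simp)
  next
    case False
    then have "{s 10, s 11} \<notin> E" using edgeD by blast
    moreover have "\<not> fsem M x Edge_f s" using False g by (auto simp: Edge_f_def good_simps)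
    ultimately show ?thesis by simp
  qed
qed

lemma wt_le: "walk E p \<Longrightarrow> wt w p \<le> (length p - 1) * W"
proof (induction p rule: induct_list012)
  case (3 u v p)
  then have "w {u, v} \<le> W" using W by simp
  then show ?case using 3 by simp
qed auto

lemma gdist_bound:
  assumes "r < n" "v < n"
  shows "gdist r v \<le> (n - 1) * W" "hdist r v + 1 \<le> n * n * (W + 1)"
proof -
  obtain p where p: "walk E p" "distinct p" "hd p = r" "last p = v" "hcost p = hdist r v" "wt w p = gdist r v"
    using hdist_path[OF assms] by metis
  have len: "length p - 1 \<le> n - 1" using path_length_le[of p] p assms by (intro diff_le_mono) auto
  have "gdist r v \<le> (length p - 1) * W" using wt_le[OF p(1)] p by simp
  also have "\<dots> \<le> (n - 1) * W" using len by (rule mult_le_mono1)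
  finally show g: "gdist r v \<le> (n - 1) * W" .
  have "hdist r v = n * gdist r v + (length p - 1)" using p by (simp add: hcost_def)
  also have "\<dots> \<le> n * ((n - 1) * W) + (n - 1)" using g len by (intro add_mono mult_le_mono2)
  finally have "hdist r v + 1 \<le> n * ((n - 1) * W) + n" using sizes(1) by linarith
  also have "\<dots> \<le> n * (n * W) + n * n" by (intro add_mono mult_le_mono) auto
  finally show "hdist r v + 1 \<le> n * n * (W + 1)" by (simp add: algebra_simps)
qed

lemma gsum_bound: "r < n \<Longrightarrow> (\<Sum>v<j. gdist r v) \<le> n * n * W" if "j \<le> n"
proof -
  assume r: "r < n"
  have "(\<Sum>v<j. gdist r v) \<le> j * ((n - 1) * W)"
    using sum_bounded_above[of "{..<j}" "gdist r" "(n - 1) * W"] gdist_bound[OF r] that by auto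
  also have "\<dots> \<le> n * (n * W)" using that by (intro mult_le_mono) auto
  finally show ?thesis by (simp add: algebra_simps)
qed

lemma hdist_less_M: "r < n \<Longrightarrow> v < n \<Longrightarrow> (hdist r v + 1) * P \<le> M" "r < n \<Longrightarrow> v < n \<Longrightarrow> hdist r v < M"
proof -
  assume "r < n" "v < n"
  then have "hdist r v + 1 \<le> n * n * (W + 1) * 4" using gdist_bound(2)[of r v] by linarith
  then show *: "(hdist r v + 1) * P \<le> M" by (rule bound_mono)
  have "(hdist r v + 1) * 1 \<le> (hdist r v + 1) * P" using sizes(8) by (intro mult_le_mono2) simp
  with * show "hdist r v < M" by simp
qed

text \<open>The product graph whose states code a cost and a vertex; paths in it from
  \<open>r\<close> are walks of the graph with their running cost.\<close>

definition "hop_rel = {(a, c). a < M \<and> c < M \<and> {a mod P, c mod P} \<in> E \<and>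
   c div P = a div P + n * w {a mod P, c mod P} + 1}"

text \<open>Costs grow along a walk, so if its final state is below \<open>M\<close> then so are all
  intermediate ones, and the restriction to numbers below \<open>M\<close> cuts off no walk to such
  a state.\<close>

lemma hop_rel_reach:
  assumes r: "r < n"
  shows "(r, a) \<in> hop_rel\<^sup>* \<longleftrightarrow>
    a < M \<and> (\<exists>p. walk E p \<and> hd p = r \<and> last p = a mod P \<and> hcost p = a div P)"
proof
  assume "(r, a) \<in> hop_rel\<^sup>*"
  then show "a < M \<and> (\<exists>p. walk E p \<and> hd p = r \<and> last p = a mod P \<and> hcost p = a div P)"
  proof induction
    case base
    then show ?case using r sizes by (auto intro!: exI[of _ "[r]"] simp: hcost_def)
  next
    case (step a c)
    then obtain p where p: "walk E p" "hd p = r" "last p = a mod P" "hcost p = a div P" by blast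
    then have ne: "p \<noteq> []" by auto
    have "walk E (p @ [c mod P])" "hd (p @ [c mod P]) = r" "last (p @ [c mod P]) = c mod P"
      "hcost (p @ [c mod P]) = c div P"
      using step p ne by (auto simp: hop_rel_def walk_snoc hcost_snoc)
    then show ?case using step by (auto simp: hop_rel_def)
  qed
next
  assume "a < M \<and> (\<exists>p. walk E p \<and> hd p = r \<and> last p = a mod P \<and> hcost p = a div P)"
  then obtain p where a: "a < M" and p: "walk E p" "hd p = r" "last p = a mod P" "hcost p = a div P" by blast
  have "hcost p * P + last p < M \<Longrightarrow> (r, hcost p * P + last p) \<in> hop_rel\<^sup>*" if "walk E p" "hd p = r" for p
    using that
  proof (induction p rule: rev_induct)
    case (snoc v p)
    show ?case
    proof (cases "p = []")
      case True
      then show ?thesis using snoc by (simp add: hcost_def)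
    next
      case False
      have wp: "walk E p" "hd p = r" "{last p, v} \<in> E" using snoc.prems False by (auto simp: walk_snoc)
      have lt: "last p < P" "v < P" using edgeD[OF wp(3)] sizes by auto
      have h: "hcost (p @ [v]) = hcost p + n * w {last p, v} + 1" by (rule hcost_snoc[OF False])
      have "hcost p * P + last p < Suc (hcost p) * P" using lt by simp
      also have "\<dots> \<le> hcost (p @ [v]) * P" unfolding h by (intro mult_le_mono1) simp
      finally have less: "hcost p * P + last p < M" using snoc.prems by simp
      have "(hcost p * P + last p, hcost (p @ [v]) * P + last (p @ [v])) \<in> hop_rel"
      proof -
        have "(hcost p * P + last p) mod P = last p" "(hcost p * P + last p) div P = hcost p"
          "(hcost (p @ [v]) * P + v) mod P = v" "(hcost (p @ [v]) * P + v) div P = hcost (p @ [v])"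
          using lt by auto
        then show ?thesis using less snoc.prems(1) wp h unfolding hop_rel_def last_snoc
          by (simp only: mem_Collect_eq case_prod_conv simp_thms)
      qed
      then show ?thesis using snoc.IH[OF less wp(1,2)] by (rule rtrancl_into_rtrancl[rotated])
    qed
  qed simp
  from this[OF p(1,2)] show "(r, a) \<in> hop_rel\<^sup>*" using p a by simp
qed

text \<open>The weight of a step is not guessed but solved for from the difference of the two costs;
  the equation that follows rejects differences of the wrong form.\<close>

lemma sem_Walk:
  assumes g: "good s" and r: "s 9 < n" "s 16 < P"
  shows "fsem M x Walk_f s \<longleftrightarrow> s 17 * P + s 16 < M \<and>
    (\<exists>p. walk E p \<and> hd p = s 9 \<and> last p = s 16 \<and> hcost p = s 17)"
proof -
  let ?F = "Sbst 10 (snd_e (Var 18)) (Sbst 11 (snd_e (Var 19))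
    (Sbst 12 (Div (Sub (Sub (fst_e (Var 19)) (fst_e (Var 18))) (Cst 1)) (Var 4))
      (Conj (Rel (eq_e (fst_e (Var 19)) (Add (fst_e (Var 18)) (Add (Mul (Var 4) (Var 12)) (Cst 1)))))
        Edge_f)))"
  have step: "fsem M x ?F (t(18 := a, 19 := c)) \<longleftrightarrow> {a mod P, c mod P} \<in> E \<and>
     c div P = a div P + n * w {a mod P, c mod P} + 1" if ac: "a < M" "c < M" and t: "good t" for a c t
  proof -
    have ml: "a mod P < M" "c mod P < M" using sizes by (meson mod_less_divisor less_le_trans)+
    have "(c div P - a div P - 1) div n \<le> c" by (meson div_le_dividend diff_le_self le_trans)
    then have d: "(c div P - a div P - 1) div n < M" using ac by simp
    have "fsem M x ?F (t(18 := a, 19 := c)) \<longleftrightarrow>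
      c div P = a div P + (n * ((c div P - a div P - 1) div n) + 1) \<and> {a mod P, c mod P} \<in> E \<and>
      (c div P - a div P - 1) div n = w {a mod P, c mod P}"
      using t ml d by (simp add: layout_e sem_Edge good_simps)
    also have "\<dots> \<longleftrightarrow> {a mod P, c mod P} \<in> E \<and> c div P = a div P + n * w {a mod P, c mod P} + 1"
      using sizes(1) by auto
    finally show ?thesis .
  qed
  have gd: "good (s(18 := s 9, 19 := s 17 * P + s 16))" using g by simp
  have "{(a, c). a < M \<and> c < M \<and> fsem M x ?F ((s(18 := s 9, 19 := s 17 * P + s 16))(18 := a, 19 := c))} = hop_rel"
    unfolding hop_rel_def using step[OF _ _ gd] by blast
  moreover have "s 9 < M" using r sizes by linarith
  ultimately have "fsem M x Walk_f s \<longleftrightarrow> s 17 * P + s 16 < M \<and> (s 9, s 17 * P + s 16) \<in> hop_rel\<^sup>*"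
    unfolding Walk_f_def using g by (simp add: layout_e)
  then show ?thesis unfolding hop_rel_reach[OF r(1)] using r(2) by simp
qed

text \<open>Minimality is tested only among costs whose states fit below \<open>M\<close>, and
  \<open>hdist_less_M\<close> puts the true minimum among them.\<close>

lemma sem_Dist:
  assumes g: "good s" and r: "s 9 < n" "s 16 < P"
  shows "fsem M x Dist_f s \<longleftrightarrow> s 16 < n \<and> s 17 = hdist (s 9) (s 16)"
proof -
  let ?Q = "\<lambda>d. \<exists>p. walk E p \<and> hd p = s 9 \<and> last p = s 16 \<and> hcost p = d"
  have eq: "fsem M x Dist_f s \<longleftrightarrow> (s 17 * P + s 16 < M \<and> ?Q (s 17)) \<and>
      \<not> (\<exists>y<M. y < s 17 \<and> y < M \<and> y * P + s 16 < M \<and> ?Q y)"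
    unfolding Dist_f_def using g r by (simp add: sem_Walk cong: conj_cong)
  show ?thesis
  proof
    assume a: "fsem M x Dist_f s"
    then obtain p where p: "walk E p" "hd p = s 9" "last p = s 16" "hcost p = s 17" unfolding eq by blast
    have "last p \<in> set p" using p(1) by (cases p rule: rev_cases) auto
    then have v: "s 16 < n" using walk_vertices[OF p(1)] p r by auto
    have le: "hdist (s 9) (s 16) \<le> s 17" using hdist_le p by metis
    have "?Q (hdist (s 9) (s 16))" using hdist_walk[OF r(1) v] by metis
    moreover have "hdist (s 9) (s 16) * P + s 16 < M" "hdist (s 9) (s 16) < M"
      using hdist_less_M[OF r(1) v] r(2) by simp_all
    ultimately have "\<not> hdist (s 9) (s 16) < s 17" using a unfolding eq by blast
    then show "s 16 < n \<and> s 17 = hdist (s 9) (s 16)" using v le by simp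
  next
    assume a: "s 16 < n \<and> s 17 = hdist (s 9) (s 16)"
    then have v: "s 16 < n" by simp
    have "?Q (s 17)" using hdist_walk[OF r(1) v] a by metis
    moreover have "s 17 * P + s 16 < M" using hdist_less_M(1)[OF r(1) v] a r(2) by simp
    moreover have "\<not> ?Q y" if "y < s 17" for y using hdist_le that a by (metis not_le)
    ultimately show "fsem M x Dist_f s" unfolding eq by blast
  qed
qed

text \<open>\<open>Dist_f\<close> determines variable 17, so a state has at most one successor: the
  run visits the pairs of \<open>j\<close> and the partial sum over \<open>v < j\<close>.\<close>

lemma sem_Sum:
  assumes g: "good s" and r: "s 9 < n"
  shows "fsem M x Sum_f s \<longleftrightarrow> s 21 = gsum (s 9)"
proof -
  let ?F = "Sbst 16 (snd_e (Var 22)) (Ex 17 (Conj Dist_f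
     (Conj (Rel (less_e (snd_e (Var 22)) (Var 4)))
     (Conj (Rel (eq_e (snd_e (Var 23)) (Add (snd_e (Var 22)) (Cst 1))))
       (Rel (eq_e (fst_e (Var 23)) (Add (fst_e (Var 22)) (Div (Var 17) (Var 4)))))))))"
  let ?R = "{(a, c). a < M \<and> c < M \<and> a mod P < n \<and> c mod P = a mod P + 1 \<and>
    c div P = a div P + gdist (s 9) (a mod P)}"
  have step: "fsem M x ?F (t(22 := a, 23 := c)) \<longleftrightarrow> a mod P < n \<and> c mod P = a mod P + 1 \<and>
    c div P = a div P + gdist (s 9) (a mod P)" if t: "good t" "t 9 = s 9" for a c t
  proof -
    have ml: "a mod P < M" "a mod P < P" using sizes by (meson mod_less_divisor less_le_trans)+
    have "fsem M x ?F (t(22 := a, 23 := c)) \<longleftrightarrow>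
      (\<exists>d<M. (a mod P < n \<and> d = hdist (s 9) (a mod P)) \<and> a mod P < n \<and> c mod P = a mod P + 1 \<and>
         c div P = a div P + d div n)"
      using t ml r by (simp add: layout_e sem_Dist good_simps)
    then show ?thesis using hdist_less_M(2)[OF r, of "a mod P"] by (auto simp: gdist_def)
  qed
  define st where "st j = (\<Sum>v<j. gdist (s 9) v) * P + j" for j
  have st: "st j div P = (\<Sum>v<j. gdist (s 9) v)" "st j mod P = j" "st j < M" if "j \<le> n" for j
  proof -
    have j: "j < P" using that sizes by simp
    then show "st j div P = (\<Sum>v<j. gdist (s 9) v)" "st j mod P = j" by (auto simp: st_def)
    have "(\<Sum>v<j. gdist (s 9) v) + 1 \<le> n * n * W + n * n"
      using gsum_bound[OF that r] sizes(1) by (intro add_mono) (auto simp: Suc_le_eq)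
    then have "(\<Sum>v<j. gdist (s 9) v) + 1 \<le> n * n * (W + 1) * 4" by (simp add: algebra_simps)
    from bound_mono[OF this] show "st j < M" using j by (simp add: st_def)
  qed
  have chain: "(st j, c) \<in> ?R \<longleftrightarrow> j < n \<and> c = st (Suc j)" if j: "j \<le> n" for j c
  proof (cases "j < n")
    case True
    have "c = st (Suc j) \<longleftrightarrow> c div P = (\<Sum>v<Suc j. gdist (s 9) v) \<and> c mod P = Suc j"
      unfolding st_def by (rule pair_code_eq) (use True sizes in simp)
    then show ?thesis using st[OF j] st(3)[of "Suc j"] True by auto
  qed (use st[OF j] in simp)
  have M0: "0 < M" using sizes by linarith
  have gd: "good (s(22 := 0, 23 := s 21 * P + n))" using g by simp
  have "{(a, c). a < M \<and> c < M \<and> fsem M x ?F ((s(22 := 0, 23 := s 21 * P + n))(22 := a, 23 := c))} = ?R"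
    using step[OF gd] by auto
  then have "fsem M x Sum_f s \<longleftrightarrow> s 21 * P + n < M \<and> (0, s 21 * P + n) \<in> ?R\<^sup>*"
    unfolding Sum_f_def using g M0 by (simp add: layout_e good_simps)
  also have "\<dots> \<longleftrightarrow> s 21 * P + n < M \<and> (\<exists>j\<le>n. s 21 * P + n = st j)"
    using chain_rtrancl[of n st ?R, OF chain] by (simp add: st_def)
  also have "\<dots> \<longleftrightarrow> s 21 = gsum (s 9)"
  proof
    assume "s 21 * P + n < M \<and> (\<exists>j\<le>n. s 21 * P + n = st j)"
    then obtain j where j: "j \<le> n" "s 21 * P + n = st j" by blast
    then show "s 21 = gsum (s 9)" 
    proof -
      have "j = n" using st(2)[OF j(1)] sizes(6) unfolding j(2)[symmetric] by simp
      with j(2) have "s 21 * P + n = st n" by simp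
      then have "s 21 = st n div P" using sizes(6) by (simp flip: \<open>s 21 * P + n = st n\<close>)
      then show ?thesis unfolding gsum_def using st(1)[of n] by simp
    qed
  next
    assume "s 21 = gsum (s 9)"
    then have "s 21 * P + n = st n" by (simp add: st_def gsum_def)
    then show "s 21 * P + n < M \<and> (\<exists>j\<le>n. s 21 * P + n = st j)" using st(3)[of n] by auto
  qed
  finally show ?thesis .
qed

text \<open>Writing \<open>2 ^ i - q mod 2 ^ i\<close> in place of a negative term keeps the state a
  natural number, shifted by \<open>B\<close>. Before division by \<open>2 ^ i\<close>, bit
  \<open>i\<close> of \<open>p\<close> contributes \<open>A * 2 ^ i\<close>, and the larger shift
  contributes \<open>B * 2 ^ i\<close> unless bit \<open>i\<close> of \<open>q\<close> cancels it.
  Rounding down in every step is harmless, as iterated \<open>div\<close> is \<open>div\<close> by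
  the product.\<close>

lemma compare_state_step:
  "(A * (p mod 2 ^ Suc i) + B * (2 ^ Suc i - q mod 2 ^ Suc i)) div 2 ^ Suc i =
   ((A * (p mod 2 ^ i) + B * (2 ^ i - q mod 2 ^ i)) div 2 ^ i +
     (if bit p i then A else 0) + (if bit q i then 0 else B)) div (2::nat)"
proof -
  let ?z = "2 ^ i :: nat"
  have pm: "z mod 2 ^ Suc i = of_bool (bit z i) * ?z + z mod ?z" for z :: nat
    using mod_mult2_eq[of z ?z 2] by (simp add: bit_iff_odd mod_2_eq_odd mult.commute)
  have q: "q mod ?z \<le> ?z" by (simp add: less_imp_le)
  have "B * (2 ^ Suc i - q mod 2 ^ Suc i) = B * (?z - q mod ?z) + (if bit q i then 0 else B) * ?z"
    unfolding pm using q by (cases "bit q i") (simp_all add: algebra_simps)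
  moreover have "A * (p mod 2 ^ Suc i) = A * (p mod ?z) + (if bit p i then A else 0) * ?z"
    unfolding pm by (simp add: algebra_simps)
  ultimately have "A * (p mod 2 ^ Suc i) + B * (2 ^ Suc i - q mod 2 ^ Suc i) =
     (A * (p mod ?z) + B * (?z - q mod ?z)) + ((if bit p i then A else 0) + (if bit q i then 0 else B)) * ?z"
    by (simp only: distrib_left distrib_right ac_simps)
  then have "(A * (p mod 2 ^ Suc i) + B * (2 ^ Suc i - q mod 2 ^ Suc i)) div ?z =
     (A * (p mod ?z) + B * (?z - q mod ?z)) div ?z + ((if bit p i then A else 0) + (if bit q i then 0 else B))"
    by (simp only: div_mult_self1) simp
  then show ?thesis unfolding power_Suc2 div_mult2_eq by (simp add: add.assoc)
qed

text \<open>\<open>num\<close> and \<open>den\<close> may be exponential, but the state never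
  exceeds \<open>s 24 + s 25\<close>. After all \<open>b\<close> bits it is at least
  \<open>s 25\<close> exactly if the signed difference of the two products is not negative.\<close>

lemma sem_Compare:
  assumes g: "good s" and AB: "(s 24 + s 25 + 1) * P \<le> M"
  shows "fsem M x Compare_f s \<longleftrightarrow> den * s 25 \<le> num * s 24"
proof -
  let ?A = "s 24" and ?B = "s 25"
  let ?a = "n + 1 + n * n * (1 + b) + 2 * n"
  define st where "st i = (?A * (num mod 2 ^ i) + ?B * (2 ^ i - den mod 2 ^ i)) div 2 ^ i" for i
  define sc where "sc i = st i * P + i" for i
  let ?F = "Conj (Rel (less_e (snd_e (Var 26)) width_e))
   (Conj (Rel (eq_e (snd_e (Var 27)) (Add (snd_e (Var 26)) (Cst 1))))
    (Ifte (Inp (Add num_e (snd_e (Var 26))))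
      (Ifte (Inp (Add (Add num_e width_e) (snd_e (Var 26))))
        (Rel (eq_e (fst_e (Var 27)) (Div (Add (fst_e (Var 26)) (Var 24)) (Cst 2))))
        (Rel (eq_e (fst_e (Var 27)) (Div (Add (fst_e (Var 26)) (Add (Var 24) (Var 25))) (Cst 2)))))
      (Ifte (Inp (Add (Add num_e width_e) (snd_e (Var 26))))
        (Rel (eq_e (fst_e (Var 27)) (Div (fst_e (Var 26)) (Cst 2))))
        (Rel (eq_e (fst_e (Var 27)) (Div (Add (fst_e (Var 26)) (Var 25)) (Cst 2)))))))"
  let ?R = "{(a, c). a < M \<and> c < M \<and> a mod P < b \<and> c mod P = a mod P + 1 \<and>
    c div P = (a div P + (if bit num (a mod P) then ?A else 0) + (if bit den (a mod P) then 0 else ?B)) div 2}"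
  have step: "fsem M x ?F (t(26 := a, 27 := c)) \<longleftrightarrow> a mod P < b \<and> c mod P = a mod P + 1 \<and>
    c div P = (a div P + (if bit num (a mod P) then ?A else 0) + (if bit den (a mod P) then 0 else ?B)) div 2"
    if t: "good t" "t 24 = ?A" "t 25 = ?B" for a c t
  proof (cases "a mod P < b")
    case True
    have "?a + a mod P < N" "?a + b + a mod P < N" using True length_x by auto
    moreover have "x ! (?a + a mod P) = bit num (a mod P)" "x ! (?a + b + a mod P) = bit den (a mod P)"
      using x_tail(3,4)[OF True] by auto
    ultimately show ?thesis using True t by (simp add: layout_e width_e N_def[symmetric] add.assoc)
  qed (use t in \<open>simp add: layout_e width_e\<close>)
  have st_le: "st i \<le> ?A + ?B" for i
  proof -
    have "?A * (num mod 2 ^ i) + ?B * (2 ^ i - den mod 2 ^ i) \<le> ?A * 2 ^ i + ?B * 2 ^ i"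
      by (intro add_mono mult_le_mono2) (auto simp: less_imp_le)
    then have "st i \<le> ((?A + ?B) * 2 ^ i) div 2 ^ i" unfolding st_def by (intro div_le_mono) (simp add: algebra_simps)
    then show ?thesis by simp
  qed
  have sc: "sc i div P = st i" "sc i mod P = i" "sc i < M" if "i \<le> b" for i
  proof -
    have i: "i < P" using that sizes by simp
    then show "sc i div P = st i" "sc i mod P = i" by (auto simp: sc_def)
    have "sc i < (st i + 1) * P" using i by (simp add: sc_def)
    also have "\<dots> \<le> (?A + ?B + 1) * P" using st_le by (intro mult_le_mono1) simp
    finally show "sc i < M" using AB by simp
  qed
  have chain: "(sc i, c) \<in> ?R \<longleftrightarrow> i < b \<and> c = sc (Suc i)" if i: "i \<le> b" for i c
  proof (cases "i < b")
    case True
    have "c = sc (Suc i) \<longleftrightarrow> c div P = st (Suc i) \<and> c mod P = Suc i"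
      unfolding sc_def by (rule pair_code_eq) (use True sizes in simp)
    moreover have "st (Suc i) = (st i + (if bit num i then ?A else 0) + (if bit den i then 0 else ?B)) div 2"
      unfolding st_def by (rule compare_state_step)
    ultimately show ?thesis using sc[OF i] sc(3)[of "Suc i"] True by auto
  qed (use sc[OF i] in simp)
  have "?B * P < M" using sc(3)[of 0] by (simp add: sc_def st_def)
  have gd: "good (s(28 := y, 26 := ?B * P, 27 := y * P + b))" for y using g by simp
  have R: "{(a, c). a < M \<and> c < M \<and> fsem M x ?F ((s(28 := y, 26 := ?B * P, 27 := y * P + b))(26 := a, 27 := c))} = ?R" for y
    using step[OF gd] by auto
  have "fsem M x Compare_f s \<longleftrightarrow>
     (\<exists>y<M. ?B < y + 1 \<and> y * P + b < M \<and> (?B * P, y * P + b) \<in> ?R\<^sup>*)"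
    unfolding Compare_f_def using g R \<open>?B * P < M\<close> by (simp add: layout_e width_e)
  also have "\<dots> \<longleftrightarrow> (\<exists>y<M. ?B < y + 1 \<and> y * P + b < M \<and> (\<exists>i\<le>b. y * P + b = sc i))"
    using chain_rtrancl[of b sc ?R, OF chain] by (simp add: sc_def st_def)
  also have "\<dots> \<longleftrightarrow> ?B \<le> st b"
  proof
    assume "\<exists>y<M. ?B < y + 1 \<and> y * P + b < M \<and> (\<exists>i\<le>b. y * P + b = sc i)"
    then obtain y i where y: "?B < y + 1" "i \<le> b" "y * P + b = sc i" by blast
    have "i = b" using sc(2)[OF y(2)] sizes(7) unfolding y(3)[symmetric] by simp
    moreover have "y = st i" using sc(1)[OF y(2)] sizes(7) unfolding y(3)[symmetric] by simp
    ultimately show "?B \<le> st b" using y(1) by simp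
  next
    assume "?B \<le> st b"
    moreover have "st b \<le> st b * P" using sizes(8) by simp
    then have "st b < M" using sc(3)[of b] unfolding sc_def by linarith
    ultimately show "\<exists>y<M. ?B < y + 1 \<and> y * P + b < M \<and> (\<exists>i\<le>b. y * P + b = sc i)"
      using sc(3)[of b] by (intro exI[of _ "st b"]) (auto simp: sc_def)
  qed
  \<comment> \<open>All bits have been read, so the residues modulo \<open>2 ^ b\<close> are
    \<open>num\<close> and \<open>den\<close> themselves.\<close>
  also have "\<dots> \<longleftrightarrow> ?B * 2 ^ b \<le> ?A * num + ?B * (2 ^ b - den)"
    using nb db unfolding st_def by (simp add: less_eq_div_iff_mult_less_eq)
  also have "\<dots> \<longleftrightarrow> den * ?B \<le> num * ?A"
  proof -
    have "?B * 2 ^ b = ?B * (2 ^ b - den) + ?B * den" using db by (simp flip: distrib_left)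
    then show ?thesis by (simp add: mult.commute)
  qed
  finally show ?thesis .
qed

lemma sem_Candidate:
  assumes g: "good s" and r: "s 9 < n" "s 30 < P" "s 31 < P"
  shows "fsem M x Candidate_f s \<longleftrightarrow> is_parent (s 9) (s 30) (s 31)"
proof -
  let ?r = "s 9" and ?u = "s 30" and ?v = "s 31"
  have uM: "?u < M" "?v < M" using r sizes by auto
  have "fsem M x Candidate_f s \<longleftrightarrow> (\<exists>d<M. \<exists>d'<M. \<exists>c<M. (?u < n \<and> d = hdist ?r ?u) \<and>
     (?v < n \<and> d' = hdist ?r ?v) \<and> ({?u, ?v} \<in> E \<and> c = w {?u, ?v}) \<and> d' = d + (n * c + 1))"
    unfolding Candidate_f_def using g r uM by (simp add: sem_Dist sem_Edge good_simps cong: conj_cong)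
  also have "\<dots> \<longleftrightarrow> is_parent ?r ?u ?v"
  proof
    assume "is_parent ?r ?u ?v"
    then have e: "{?u, ?v} \<in> E" "hdist ?r ?v = hdist ?r ?u + n * w {?u, ?v} + 1" by (auto simp: is_parent_def)
    have uv: "?u < n" "?v < n" using edgeD[OF e(1)] by auto
    have "w {?u, ?v} \<le> n * w {?u, ?v}" using sizes(1) by simp
    then have "w {?u, ?v} < M" using e(2) hdist_less_M(2)[OF r(1) uv(2)] by linarith
    then show "\<exists>d<M. \<exists>d'<M. \<exists>c<M. (?u < n \<and> d = hdist ?r ?u) \<and>
     (?v < n \<and> d' = hdist ?r ?v) \<and> ({?u, ?v} \<in> E \<and> c = w {?u, ?v}) \<and> d' = d + (n * c + 1)"
      using e uv hdist_less_M(2)[OF r(1) uv(1)] hdist_less_M(2)[OF r(1) uv(2)]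
      by (intro exI[of _ "hdist ?r ?u"] exI[of _ "hdist ?r ?v"] exI[of _ "w {?u, ?v}"] conjI) simp_all
  qed (auto simp: is_parent_def)
  finally show ?thesis .
qed

lemma sem_Parent:
  assumes g: "good s" and r: "s 9 < n" "s 30 < P" "s 31 < P"
  shows "fsem M x Parent_f s \<longleftrightarrow> s 31 \<noteq> s 9 \<and> s 31 < n \<and> s 30 = parent (s 9) (s 31)"
proof -
  let ?r = "s 9" and ?u = "s 30" and ?v = "s 31"
  have "fsem M x Parent_f s \<longleftrightarrow> is_parent ?r ?u ?v \<and> ?v \<noteq> ?r \<and> \<not> (\<exists>y<M. y < ?u \<and> y < M \<and> is_parent ?r y ?v)"
    unfolding Parent_f_def using g r by (simp add: sem_Candidate good_simps cong: conj_cong)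
  also have "\<dots> \<longleftrightarrow> ?v \<noteq> ?r \<and> ?v < n \<and> ?u = parent ?r ?v"
  proof
    assume a: "is_parent ?r ?u ?v \<and> ?v \<noteq> ?r \<and> \<not> (\<exists>y<M. y < ?u \<and> y < M \<and> is_parent ?r y ?v)"
    then have "?v < n" using edgeD by (auto simp: is_parent_def)
    moreover have "?u = parent ?r ?v" unfolding parent_def
    proof (rule Least_equality[symmetric])
      show "is_parent ?r ?u ?v" using a by simp
      show "?u \<le> y" if "is_parent ?r y ?v" for y
        using a that r(2) sizes(9) by (meson not_le less_trans less_le_trans)
    qed
    ultimately show "?v \<noteq> ?r \<and> ?v < n \<and> ?u = parent ?r ?v" using a by simp
  next
    assume a: "?v \<noteq> ?r \<and> ?v < n \<and> ?u = parent ?r ?v"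
    then have "is_parent ?r ?u ?v" using parent[OF r(1)] by simp
    moreover have "\<not> is_parent ?r y ?v" if "y < ?u" for y
      using that a not_less_Least unfolding parent_def by metis
    ultimately show "is_parent ?r ?u ?v \<and> ?v \<noteq> ?r \<and> \<not> (\<exists>y<M. y < ?u \<and> y < M \<and> is_parent ?r y ?v)"
      using a by blast
  qed
  finally show ?thesis .
qed

lemma sem_Tree:
  assumes g: "good s" and r: "s 9 < n" "s 30 < P" "s 31 < P"
  shows "fsem M x Tree_f s \<longleftrightarrow> {s 30, s 31} \<in> spt (s 9)"
proof -
  have lt: "s 30 < M" "s 31 < M" using r sizes by auto
  have "fsem M x Tree_f s \<longleftrightarrow> (s 31 \<noteq> s 9 \<and> s 31 < n \<and> s 30 = parent (s 9) (s 31)) \<or>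
     (s 30 \<noteq> s 9 \<and> s 30 < n \<and> s 31 = parent (s 9) (s 30))"
    unfolding Tree_f_def using g r lt by (simp add: sem_Parent)
  then show ?thesis by (auto simp: spt_def doubleton_eq_iff)
qed

lemma sem_Vertices:
  assumes "s 0 = N" "s 2 = P"
  shows "fsem M x Vertices_f s \<longleftrightarrow> s 4 = n"
proof -
  have "fsem M x Vertices_f s \<longleftrightarrow> s 4 < N \<and> \<not> x ! (s 4) \<and> (\<forall>i<M. i < s 4 \<longrightarrow> i < N \<and> x ! i)"
    unfolding Vertices_f_def using assms by (auto simp: N_def[symmetric])
  also have "\<dots> \<longleftrightarrow> s 4 = n"
  proof
    assume a: "s 4 < N \<and> \<not> x ! (s 4) \<and> (\<forall>i<M. i < s 4 \<longrightarrow> i < N \<and> x ! i)"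
    then have "\<not> s 4 < n" using x_unary(1) by blast
    moreover have "n < M" using sizes by linarith
    then have "\<not> n < s 4" using a x_unary(2) by blast
    ultimately show "s 4 = n" by simp
  qed (use x_unary sizes in auto)
  finally show ?thesis .
qed

text \<open>The test is \<open>2 * gsum s1 \<le> lam * gsum s1 + gsum s2\<close> multiplied by
  \<open>den\<close>. Where \<open>gsum s2\<close> exceeds \<open>2 * gsum s1\<close>, truncation
  makes the left-hand side 0, and the test succeeds as it should.\<close>

definition "chosen = (if den * (2 * gsum s1 - gsum s2) \<le> num * gsum s1 then s1 else s2)"

lemma sem_Output:
  assumes s: "s 0 = N" "s 2 = P" "s 3 < N"
  shows "fsem M x Output_f s \<longleftrightarrow> s 3 = 0 \<or> {(s 3 - 1) div n, (s 3 - 1) mod n} \<in> spt chosen"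
proof -
  let ?q = "s 3 - 1"
  have gd: "good (s(4 := n))" using s by (simp add: good_def)
  have lt: "?q div n < M" "?q mod n < M" "?q div n < P" "?q mod n < P" "n < M" "s1 < M" "s2 < M"
  proof -
    have "?q div n \<le> ?q" by simp
    then show "?q div n < P" using s(3) sizes by linarith
    then show "?q div n < M" using sizes by linarith
    have "?q mod n < n" using sizes by simp
    then show "?q mod n < P" "?q mod n < M" using sizes by linarith+
    show "n < M" "s1 < M" "s2 < M" using sizes encoded_instance.s[OF encoded_instance_axioms] by linarith+
  qed
  have sb: "gsum r \<le> n * n * W" if "r < n" for r unfolding gsum_def by (rule gsum_bound) (use that in auto)
  have s12: "s1 < n" "s2 < n" by (rule encoded_instance.s[OF encoded_instance_axioms])+
  let ?D1 = "gsum s1" and ?D2 = "gsum s2"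
  have D: "?D1 + (2 * ?D1 - ?D2) + 1 \<le> n * n * (W + 1) * 4"
  proof -
    have "n * n * (W + 1) * 4 = 4 * (n * n * W) + 4 * (n * n)" by (simp add: algebra_simps)
    then show ?thesis using sb[OF s12(1)] n_pos_mult[of 1] by linarith
  qed
  have AB: "(?D1 + (2 * ?D1 - ?D2) + 1) * P \<le> M" by (rule bound_mono[OF D])
  have DM: "?D1 < M" "2 * ?D1 - ?D2 < M"
  proof -
    have "z \<le> z * P" for z using sizes(8) by simp
    from order_trans[OF this AB] show "?D1 < M" "2 * ?D1 - ?D2 < M" by linarith+
  qed
  have D2M: "?D2 < M"
  proof -
    have "n * n * (W + 1) * 4 = 4 * (n * n * W) + 4 * (n * n)" by (simp add: algebra_simps)
    then have "?D2 + 1 \<le> n * n * (W + 1) * 4" using sb[OF s12(2)] n_pos_mult[of 1] by linarith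
    from bound_mono[OF this] have "(?D2 + 1) * P \<le> M" .
    moreover have "z \<le> z * P" for z using sizes(8) by simp
    then have "?D2 + 1 \<le> (?D2 + 1) * P" by blast
    ultimately have "?D2 + 1 \<le> M" by (rule order_trans[rotated])
    then show ?thesis by linarith
  qed
  let ?T = "Sbst 30 (Div (Sub (Var 3) (Cst 1)) (Var 4)) (Sbst 31 (mod_e (Sub (Var 3) (Cst 1)) (Var 4))
     (Ifte (Sbst 24 (Var 7) (Sbst 25 (Sub (Mul (Cst 2) (Var 7)) (Var 8)) Compare_f))
       (Sbst 9 (Var 5) Tree_f) (Sbst 9 (Var 6) Tree_f)))"
  have T: "fsem M x ?T (s(4 := n, 5 := s1, 6 := s2, 7 := ?D1, 8 := ?D2)) \<longleftrightarrow> {?q div n, ?q mod n} \<in> spt chosen"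
    using gd lt s12 AB DM by (simp add: sem_Compare sem_Tree chosen_def)
  have S1: "fsem M x (Sbst 9 (Var 5) (Sbst 21 (Var 7) Sum_f)) (s(4 := n, 5 := s1, 6 := s2, 7 := d)) \<longleftrightarrow> d = ?D1"
    if "d < M" for d using gd lt s12 that by (simp add: sem_Sum)
  have S2: "fsem M x (Sbst 9 (Var 6) (Sbst 21 (Var 8) Sum_f)) (s(4 := n, 5 := s1, 6 := s2, 7 := c, 8 := d)) \<longleftrightarrow> d = ?D2"
    if "d < M" for c d using gd lt s12 that by (simp add: sem_Sum)
  have V1: "fsem M x (Conj (Rel (less_e (Var 5) (Var 4))) (Inp (Add sources_e (Var 5)))) (s(4 := n, 5 := v)) \<longleftrightarrow> v = s1" for v
  proof -
    have "n + 1 + n * n * (1 + b) + v < N" if "v < n" using that length_x by linarith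
    then show ?thesis using gd s12 x_tail(1)[of v] by (auto simp: layout_e N_def[symmetric] good_simps)
  qed
  have V2: "fsem M x (Conj (Rel (less_e (Var 6) (Var 4))) (Inp (Add (Add sources_e (Var 4)) (Var 6)))) (s(4 := n, 5 := u, 6 := v)) \<longleftrightarrow> v = s2" for u v
  proof -
    have "n + 1 + n * n * (1 + b) + n + v < N" if "v < n" using that length_x by linarith
    then show ?thesis using gd s12 x_tail(2)[of v] by (auto simp: layout_e N_def[symmetric] good_simps)
  qed
  have V0: "fsem M x Vertices_f (s(4 := y)) \<longleftrightarrow> y = n" for y by (subst sem_Vertices) (use s in auto)
  have "fsem M x Output_f s \<longleftrightarrow> s 3 = 0 \<or> fsem M x ?T (s(4 := n, 5 := s1, 6 := s2, 7 := ?D1, 8 := ?D2))"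
    unfolding Output_f_def fsem_Disj
    by (subst fsem_Ex_unique[OF V0 lt(5)], subst fsem_Ex_unique[OF V1 lt(6)],
        subst fsem_Ex_unique[OF V2 lt(7)], subst fsem_Ex_unique[OF S1 DM(1)], assumption,
        subst fsem_Ex_unique[OF S2 D2M], assumption, simp)
  then show ?thesis unfolding T .
qed

text \<open>\<open>n * n < N\<close> leaves room for the flag and the whole matrix. The decoder
  reads entries with \<open>u < v\<close> only, so each tree edge is found under its increasing
  orientation.\<close>

lemma decode_Output:
  assumes out: "\<And>j. j < N \<Longrightarrow> out j \<longleftrightarrow> j = 0 \<or> {(j - 1) div n, (j - 1) mod n} \<in> spt r" and r: "r < n"
  shows "decode_output n (map out [0..<N]) = Some (spt r)"
proof -
  have N: "[0..<N] = 0 # map Suc [0..<N - 1]"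
    using sizes(2) upt_conv_Cons[of 0 N] map_Suc_upt[of 0 "N - 1"] by simp
  have bit: "{u, v} \<in> spt r \<longleftrightarrow> u * n + v < N - 1 \<and> out (Suc (u * n + v))" if "u < n" "v < n" for u v
  proof -
    have "u * n + v < Suc u * n" using that by simp
    also have "\<dots> \<le> n * n" using that by (intro mult_le_mono1) simp
    finally have "u * n + v < N - 1" using sizes(5) by linarith
    then show ?thesis using out[of "Suc (u * n + v)"] that by simp
  qed
  have sub: "spt r \<subseteq> E" using spt_spanning_tree[OF r] by (simp add: spanning_tree_def)
  have "{{u, v} |u v. u < v \<and> v < n \<and> u * n + v < N - 1 \<and> out (Suc (u * n + v))} = spt r" (is "?S = _")
  proof (intro equalityI subsetI)
    fix e assume "e \<in> ?S"
    then show "e \<in> spt r" using bit by auto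
  next
    fix e assume e: "e \<in> spt r"
    then obtain v where "e = {parent r v, v}" by (auto simp: spt_def)
    then obtain u v where uv: "e = {u, v}" "u < v" "v < n"
    proof -
      have "{parent r v, v} \<in> E" using e sub \<open>e = {parent r v, v}\<close> by auto
      from edgeD[OF this] that[of "parent r v" v] that[of v "parent r v"] \<open>e = {parent r v, v}\<close>
      show ?thesis by (auto simp: insert_commute neq_iff)
    qed
    then show "e \<in> ?S" using bit[of u v] e by auto
  qed
  then show ?thesis using out[of 0] sizes(2) unfolding N
    by (simp add: o_def cong: conj_cong)
qed

lemma chosen_less: "chosen < n"
  using s by (simp add: chosen_def)

lemma chosen_good:
  assumes "1 \<le> den" "den \<le> num"
  defines "lam \<equiv> real num / real den"
  shows "spanning_tree n E (spt chosen)"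
    and "routing_cost2 n w s1 s2 lam (spt chosen) \<le> 2 * routing_cost2 n w s1 s2 lam (W2MRCT n E w s1 s2 lam)"
proof -
  show "spanning_tree n E (spt chosen)" by (rule spt_spanning_tree[OF chosen_less])
  have lam: "1 \<le> lam" using assms by (simp add: lam_def)
  let ?a = "gsum s1" and ?b = "gsum s2"
  have "den * (2 * ?a - ?b) \<le> num * ?a \<longleftrightarrow> 2 * real ?a \<le> lam * real ?a + real ?b"
  proof (cases "?b \<le> 2 * ?a")
    case True
    have "den * (2 * ?a - ?b) \<le> num * ?a \<longleftrightarrow> real (den * (2 * ?a - ?b)) \<le> real (num * ?a)"
      by (simp only: of_nat_le_iff)
    also have "\<dots> \<longleftrightarrow> real den * (2 * real ?a - real ?b) \<le> real num * real ?a"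
      using True by (simp add: of_nat_diff)
    also have "\<dots> \<longleftrightarrow> 2 * real ?a \<le> lam * real ?a + real ?b"
      using assms(1) by (simp add: lam_def field_simps)
    finally show ?thesis .
  next
    case False
    then have "2 * real ?a \<le> real ?b" by linarith
    moreover have "0 \<le> lam * real ?a" using lam by simp
    ultimately show ?thesis using False by simp
  qed
  then have "chosen = (if 2 * real ?a \<le> lam * real ?a + real ?b then s1 else s2)"
    by (simp add: chosen_def)
  then show "routing_cost2 n w s1 s2 lam (spt chosen) \<le> 2 * routing_cost2 n w s1 s2 lam (W2MRCT n E w s1 s2 lam)"
    using spt_two_approx[OF s lam W2MRCT_spanning_tree[OF sizes(1)]] by simp
qed

end

section \<open>Choice of the parameters\<close>

text \<open>The weight bound has to be a natural number. Coefficients are rounded up, negative ones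
  to 0, and \<open>n + 1\<close> takes care of \<open>n = 0\<close>.\<close>

lemma poly_le_monomial: "\<exists>c d. \<forall>n. poly p (real n) \<le> real (c * (n + 1) ^ d)"
proof (induction p)
  case (pCons a p)
  then obtain c d where c: "\<And>n. poly p (real n) \<le> real (c * (n + 1) ^ d)" by blast
  have "poly (pCons a p) (real n) \<le> real ((nat \<lceil>a\<rceil> + c) * (n + 1) ^ Suc d)" for n
  proof -
    have "real n * poly p (real n) \<le> real n * real (c * (n + 1) ^ d)"
      by (rule mult_left_mono[OF c]) simp
    also have "\<dots> \<le> real (n + 1) * real (c * (n + 1) ^ d)" by (rule mult_right_mono) simp_all
    finally have "real n * poly p (real n) \<le> real (n + 1) * real (c * (n + 1) ^ d)" .
    moreover have "a * 1 \<le> real (nat \<lceil>a\<rceil>) * real ((n + 1) ^ Suc d)"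
    proof -
      have "a \<le> real (nat \<lceil>a\<rceil>)" by linarith
      also have "\<dots> = real (nat \<lceil>a\<rceil>) * 1" by simp
      also have "\<dots> \<le> real (nat \<lceil>a\<rceil>) * real ((n + 1) ^ Suc d)"
      proof (rule mult_left_mono)
        have "1 \<le> (n + 1) ^ Suc d" by (rule one_le_power) simp
        then show "(1::real) \<le> real ((n + 1) ^ Suc d)" using of_nat_mono by fastforce
      qed simp
      finally show ?thesis by simp
    qed
    ultimately show ?thesis by (simp add: algebra_simps)
  qed
  then show ?case by blast
qed (intro exI[of _ 0], simp)

theorem theorem22:
  fixes p :: "real poly"
  shows "\<exists>(C :: nat \<Rightarrow> circuit) (r :: nat \<Rightarrow> nat) (\<epsilon> :: nat \<Rightarrow> real) (\<delta> :: nat \<Rightarrow> real).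
    RNC2_algorithm r C \<and> \<epsilon> \<longlonglongrightarrow> 0 \<and> \<delta> \<longlonglongrightarrow> 0 \<and>
    (\<forall>n E w s1 s2 num den b.
       simple_graph n E \<and> connected_graph n E \<and>
       (\<forall>e\<in>E. real (w e) \<le> poly p (real n)) \<and>
       s1 < n \<and> s2 < n \<and> 1 \<le> den \<and> den \<le> num \<and>
       (\<forall>e\<in>E. w e < 2 ^ b) \<and> num < 2 ^ b \<and> den < 2 ^ b \<longrightarrow>
       (let lam = real num / real den;
            x = encode_instance b n E w s1 s2 num den;
            N = length x;
            answer = (\<lambda>\<rho>. decode_output n (run_circuit (C N) x \<rho>));
            good = (\<lambda>T. spanning_tree n E T \<and>
                      routing_cost2 n w s1 s2 lam T
                        \<le> (2 + \<epsilon> n) * routing_cost2 n w s1 s2 lam (W2MRCT n E w s1 s2 lam))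
        in measure_pmf.prob (random_bits (r N)) {\<rho>. \<exists>T. answer \<rho> = Some T \<and> good T} \<ge> 1 - \<delta> n \<and>
           (\<forall>\<rho>. length \<rho> = r N \<longrightarrow> answer \<rho> = None \<or> (\<exists>T. answer \<rho> = Some T \<and> good T))))"
proof -
  obtain c d where cd: "\<And>n. poly p (real n) \<le> real (c * (n + 1) ^ d)" using poly_le_monomial by blast
  \<comment> \<open>The exponent is what \<open>n * n * (W + 1) * 4 * P\<close> costs in powers of
    \<open>P\<close>: 2 for \<open>n * n\<close>, \<open>c + d\<close> for \<open>W + 1\<close>, 2
    for the constant 4 and 1 for \<open>P\<close>.\<close>
  define m where "m = c + d + 5"
  let ?C = "\<lambda>N. layout.circuit_of N m 33 (comp Output_f 0)"
  have lay: "layout m 33" by (simp add: layout_def m_def)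
  have rnc: "RNC2_algorithm (\<lambda>_. 0) ?C"
    by (rule formula_circuits_RNC2[OF wff_Output_f]) (simp_all add: m_def)
  have main: "\<exists>T. decode_output n (run_circuit (?C (length x)) x \<rho>) = Some T \<and> spanning_tree n E T \<and>
      routing_cost2 n w s1 s2 lam T \<le> 2 * routing_cost2 n w s1 s2 lam (W2MRCT n E w s1 s2 lam)"
    if g: "simple_graph n E" "connected_graph n E" "\<forall>e\<in>E. real (w e) \<le> poly p (real n)"
      and s: "s1 < n" "s2 < n" and nd: "1 \<le> den" "den \<le> num"
      and b: "\<forall>e\<in>E. w e < 2 ^ b" "num < 2 ^ b" "den < 2 ^ b"
      and x: "x = encode_instance b n E w s1 s2 num den" and lam: "lam = real num / real den"
    for n E w s1 s2 num den b x lam \<rho>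
  proof -
    define P where "P = (2::nat) ^ lg (length x)"
    define W where "W = c * (n + 1) ^ d"
    have len: "length x < P" by (simp add: P_def less_two_power_lg)
    have nx: "n < length x" unfolding x encode_instance_def by simp
    have P2: "2 \<le> P" "n + 1 \<le> P" using len nx s by linarith+
    have M: "n * n * (W + 1) * 4 * P \<le> P ^ m"
    proof -
      have "c + 1 \<le> 2 ^ c" using less_exp[of c] by linarith
      also have "\<dots> \<le> P ^ c" using P2 by (intro power_mono) auto
      finally have "(c + 1) * P ^ d \<le> P ^ c * P ^ d" by (rule mult_le_mono1)
      moreover have "c * (n + 1) ^ d \<le> c * P ^ d" using P2 by (intro mult_le_mono2 power_mono) auto
      moreover have "1 \<le> P ^ d" using P2 by simp
      ultimately have W: "W + 1 \<le> P ^ c * P ^ d" unfolding W_def distrib_right by linarith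
      have "4 \<le> P * P" using mult_le_mono[OF P2(1) P2(1)] by simp
      then have "n * n * (W + 1) * 4 * P \<le> P * P * (P ^ c * P ^ d) * (P * P) * P"
        using P2 W by (intro mult_le_mono) auto
      also have "\<dots> = P ^ m" by (simp add: m_def power_add eval_nat_numeral)
      finally show ?thesis .
    qed
    interpret encoded_instance n E w s1 s2 num den b P "P ^ m" W
    proof
      show "w e \<le> W" if "e \<in> E" for e
      proof -
        have "real (w e) \<le> real (c * (n + 1) ^ d)" using g(3) cd[of n] that by force
        then show ?thesis unfolding W_def by (simp only: of_nat_le_iff)
      qed
    qed (use g s b M len x in auto)
    have xx: "encoded_instance.x n E w s1 s2 num den b = x" by (simp add: x_def x)
    have NN: "encoded_instance.N n E w s1 s2 num den b = length x" by (simp add: N_def xx)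
    have LM: "layout.M (length x) m = P ^ m" by (simp add: layout.M_def[OF lay] P_def)
    let ?env = "layout.env (length x) m"
    \<comment> \<open>Variable 3 is the lowest digit of \<open>j\<close>, which is \<open>j\<close>
      itself because \<open>j < P \<le> P ^ m\<close>.\<close>
    have env: "?env j 0 = length x" "?env j 2 = P" "j < length x \<Longrightarrow> ?env j 3 = j" for j
    proof -
      have "P \<le> P ^ m" using sizes(9) .
      then show "?env j 0 = length x" "?env j 2 = P" "j < length x \<Longrightarrow> ?env j 3 = j"
        using len by (simp_all add: layout.env_def[OF lay] layout.dig_def[OF lay] LM P_def)
    qed
    have "run_circuit (?C (length x)) x \<rho> = map (\<lambda>j. fsem (P ^ m) x Output_f (?env j)) [0..<length x]"
      using layout.run_circuit_of[OF lay wff_Output_f refl, of x \<rho>] unfolding LM .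
    moreover have "decode_output n (map (\<lambda>j. fsem (P ^ m) x Output_f (?env j)) [0..<length x]) = Some (spt chosen)"
    proof (rule decode_Output[unfolded NN, OF _ chosen_less])
      fix j assume j: "j < length x"
      then show "fsem (P ^ m) x Output_f (?env j) \<longleftrightarrow> j = 0 \<or> {(j - 1) div n, (j - 1) mod n} \<in> spt chosen"
        using sem_Output[of "?env j"] env[of j] unfolding xx NN by simp
    qed
    ultimately show ?thesis using chosen_good[OF nd] lam by simp
  qed
  \<comment> \<open>Without random bits the empty word is the only outcome, so success has
    probability 1 and both error terms can be 0.\<close>
  have prob: "measure_pmf.prob (random_bits 0) A = 1" if "[] \<in> A" for A
  proof -
    have "{\<rho> :: bool list. length \<rho> = 0} = {[]}" by auto
    then have "random_bits 0 = return_pmf []" by (simp add: random_bits_def pmf_of_set_singleton)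
    then show ?thesis using that by (simp add: measure_return_pmf)
  qed
  show ?thesis
    by (rule exI[of _ ?C], rule exI[of _ "\<lambda>_. 0"], rule exI[of _ "\<lambda>_. 0"], rule exI[of _ "\<lambda>_. 0"])
      (use rnc main prob in \<open>simp add: Let_def\<close>)
qed

end
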